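(* Let $(X_i)_{i\ge 1}$ be i.i.d. real random variables with $\mathbb E X_1=0$, $\mathbb E X_1^2=\sigma^2\in(0,\infty)$. Assume that $X_1$ is non-lattice and that $\mathbb E|X_1|^{2+\delta}<\infty$ for some $\delta>0$. Then for any $\varepsilon,\eta,\Delta_0>0$, there exists a constant $q_0>0$ such that for any $q\in(0,q_0)$, we have, as $n\to\infty$, uniformly in $x\in[\eta^{-1}\sqrt n,\eta\sqrt n]$, $y\in[\eta^{-1}\sqrt n,\sigma\sqrt{qn\log n}]$ and $\Delta\in[\Delta_0,n^{1/2-\varepsilon}]$, $$\mathbb P\big(x+S_n\in[0,\Delta]+y,\ \tau_x>n\big)\sim\frac{\Delta}{\sigma\sqrt n}\,\psi\Big(\frac{y}{\sigma\sqrt n},\frac{x}{\sigma\sqrt n}\Big).$$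
   Context: Notation: $S_n=\sum_{i=1}^n X_i$; for $x\ge0$, $\tau_x=\inf\{k\ge1:\ x+S_k<0\}$. A random variable $X$ is non-lattice if for all $h>0$ and $a\in[0,h)$, $\mathbb P(X\in h\mathbb Z+a)\ne1$. $\psi(s,x)=\frac1{\sqrt{2\pi}}\big(e^{-(s-x)^2/2}-e^{-(s+x)^2/2}\big)$ for $s,x\in\mathbb R$. $[0,\Delta]+y=[y,y+\Delta]$. Uniform asymptotic equivalence: $a_n(\theta)\sim b_n(\theta)$ uniformly in $\theta\in A_n$ as $n\to\infty$ means $\lim_{n\to\infty}\sup_{\theta\in A_n}\left|\frac{a_n(\theta)}{b_n(\theta)}-1\right|=0$. *)

theory Defs
  imports "HOL-Probability.Probability"
begin

definition walk :: "(nat \<Rightarrow> 'a \<Rightarrow> real) \<Rightarrow> nat \<Rightarrow> 'a \<Rightarrow> real" where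
  "walk X n \<omega> = (\<Sum>i=1..n. X i \<omega>)"

(* If the walk never becomes negative, the infimum is over the empty set and equals \<infinity>. *)
definition exit_time :: "(nat \<Rightarrow> 'a \<Rightarrow> real) \<Rightarrow> real \<Rightarrow> 'a \<Rightarrow> enat" where
  "exit_time X x \<omega> = Inf {enat k | k. k \<ge> 1 \<and> x + walk X k \<omega> < 0}"

definition non_lattice :: "'a measure \<Rightarrow> ('a \<Rightarrow> real) \<Rightarrow> bool" where
  "non_lattice M Y \<longleftrightarrow>
     (\<forall>h>0. \<forall>a\<in>{0..<h}. measure M {\<omega> \<in> space M. Y \<omega> \<in> {h * of_int k + a | k. True}} \<noteq> 1)"

definition psi :: "real \<Rightarrow> real \<Rightarrow> real" where
  "psi s x = 1 / sqrt (2 * pi) * (exp (- (s - x)\<^sup>2 / 2) - exp (- (s + x)\<^sup>2 / 2))"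

(* The supremum is taken in [0, \<infinity>], so that it is meaningful for unbounded families
   and equals 0 when the parameter set is empty. *)
definition unif_asymp_equiv ::
  "(nat \<Rightarrow> 'b set) \<Rightarrow> (nat \<Rightarrow> 'b \<Rightarrow> real) \<Rightarrow> (nat \<Rightarrow> 'b \<Rightarrow> real) \<Rightarrow> bool" where
  "unif_asymp_equiv A a b \<longleftrightarrow>
     (\<lambda>n. SUP \<theta>\<in>A n. ennreal \<bar>a n \<theta> / b n \<theta> - 1\<bar>) \<longlonglongrightarrow> 0"

end

theory Submission imports Defs "HOL-Real_Asymp.Real_Asymp" begin

text \<open>
  The proof combines a discrete reflection principle with a local limit theorem in the range of moderate
  deviations; no coupling with Brownian motion is used.

  Truncation. With \<open>b = n powr (1 / 2 - \<kappa>)\<close> and \<open>\<kappa>\<close> small, discard all paths with a step larger than b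
  (\<open>kill_trunc_diff\<close>). By the moment of order \<open>2 + \<delta>\<close> and the concentration bound \<open>concentration\<close> for the free
  walk, this changes the probability by an amount that is polynomially smaller than \<open>\<Delta> / sqrt n\<close>. The main
  term is at least of order \<open>\<Delta> n powr (- 1 / 2 - q / 2)\<close>, so the error is negligible for \<open>q < \<delta> / 2\<close>.

  Local limit theorem. For the truncated walk an exponential tilt by \<open>\<beta>\<close> of order \<open>sqrt (log n / n)\<close>, up to a
  small power of n, satisfies \<open>\<bar>\<beta>\<bar> b \<longlonglongrightarrow> 0\<close>. Hence the tilted law has a density close to one with respect to the step
  law, and its characteristic function is uniformly close to that of a shifted step (\<open>tilt_estimates\<close>).
  For all such laws at once, Fourier inversion against the Fejer kernel reduces the local limit theorem to
  a single dominated convergence (\<open>smooth_local_limit\<close>). The non-lattice assumption enters through the bound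
  \<open>\<bar>\<phi>(t)\<bar> \<le> 1 - c t\<^sup>2\<close> on compact intervals (\<open>char_decay\<close>). Removing the smoothing (\<open>interval_local_limit\<close>) and the
  tilt gives the Gaussian local probability with a relative error tending to zero, for all numbers of steps
  m with \<open>n powr (1 - \<kappa> / 4) \<le> m \<le> n\<close> and all distances of order \<open>sqrt (n log n)\<close> (\<open>trunc_local_limit\<close>). For smaller
  m a Chernoff bound shows that distances of order \<open>sqrt n\<close> are not reached (\<open>trunc_chernoff\<close>).

  Reflection. The killed paths from x to \<open>[y, y + \<Delta>]\<close> and all the paths from x to the mirror image
  \<open>[- y - \<Delta>, - y]\<close> pass through a first negative position z, which lies in \<open>[- b, 0)\<close>. From z the two targets
  have asymptotically equal probabilities, since the exponents of the two Gaussian terms differ by a quantity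
  of order \<open>(b + \<Delta>) y / m\<close>. Recursion on the number of steps (\<open>discrete_reflection\<close>) transfers this to x. For
  the truncated walk, the probability of surviving and ending in the target is therefore the difference of
  the two free probabilities, up to a small multiple of the larger one (\<open>reflection_estimate\<close>). The difference
  of the two Gaussian terms is the main term expressed by \<open>psi\<close>, and it is comparable with its positive part because x and y are at least of order \<open>sqrt n\<close>.
\<close>

section \<open>The Fejer kernel\<close>

text \<open>The Fejer kernel of width of order \<open>1 / A\<close>, a probability density on the line whose Fourier transform is
  the triangle function supported by \<open>[- A, A]\<close>. Written with the everywhere defined function sinc it is
  visibly continuous and nonnegative; for \<open>x \<noteq> 0\<close> it equals \<open>(1 - cos (A x)) / (\<pi> A x\<^sup>2)\<close>.\<close>

definition fejer :: "real \<Rightarrow> real \<Rightarrow> real" where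
  "fejer A x = A / (2 * pi) * (sinc (A * x / 2))\<^sup>2"

text \<open>The primitive of the kernel that vanishes at the origin, in terms of the sine integral. It increases
  from \<open>- 1 / 2\<close> to \<open>1 / 2\<close>, which encodes that the kernel has total mass one.\<close>

definition fejer_prim :: "real \<Rightarrow> real \<Rightarrow> real" where
  "fejer_prim A x = (Si (A * x) - sin (A * x / 2) * sinc (A * x / 2)) / pi"

lemma fejer_nonneg: "A > 0 \<Longrightarrow> 0 \<le> fejer A x"
  by (simp add: fejer_def)

lemma fejer_eq: "x \<noteq> 0 \<Longrightarrow> A > 0 \<Longrightarrow> fejer A x = (1 - cos (A * x)) / (pi * A * x\<^sup>2)"
proof -
  assume x: "x \<noteq> 0" "A > 0"
  have "cos (A * x) = 1 - 2 * (sin (A * x / 2))\<^sup>2"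
    using cos_double_sin[of "A * x / 2"] by simp
  then show ?thesis
    using x by (simp add: fejer_def field_simps power2_eq_square)
qed

lemma continuous_on_fejer [continuous_intros]:
  "continuous_on S f \<Longrightarrow> continuous_on S (\<lambda>x. fejer A (f x))"
  unfolding fejer_def by (intro continuous_intros continuous_on_compose2[OF continuous_on_sinc[of UNIV id]]) 
    (auto intro: continuous_intros)

lemma borel_measurable_fejer [measurable]: "fejer A \<in> borel_measurable borel"
  unfolding fejer_def by measurable

lemma abs_sinc_le_1: "\<bar>sinc x\<bar> \<le> 1"
proof (cases "x = 0")
  case False
  then show ?thesis
    using abs_sin_x_le_abs_x[of x] by (simp add: abs_divide)
qed auto

lemma fejer_le: "A > 0 \<Longrightarrow> fejer A x \<le> A / (2 * pi)"
proof -
  assume "A > 0"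
  moreover have "(sinc (A * x / 2))\<^sup>2 \<le> 1"
    using abs_sinc_le_1[of "A * x / 2"] by (simp add: abs_square_le_1)
  ultimately show ?thesis
    unfolding fejer_def using mult_left_mono[of "(sinc (A * x / 2))\<^sup>2" 1 "A / (2 * pi)"] by simp
qed

lemma fejer_cos:
  assumes A: "A > 0"
  shows "fejer A x = (LBINT t:{0..A}. (1 - t / A) * cos (t * x)) / pi"
proof (cases "x = 0")
  case True
  have "(LBINT t:{0..A}. (1 - t / A) * cos (t * x)) = (LBINT t. (1 - t / A) * indicator {0..A} t)"
    unfolding set_lebesgue_integral_def using True by (simp add: mult.commute)
  also have "\<dots> = (A - A\<^sup>2 / (2 * A)) - (0 - 0\<^sup>2 / (2 * A))"
    by (rule integral_FTC_Icc_real) (use A in \<open>auto intro!: derivative_eq_intros simp: field_simps\<close>)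
  finally show ?thesis using A True by (simp add: fejer_def field_simps power2_eq_square)
next
  case False
  let ?F = "\<lambda>t. (1 - t / A) * sin (t * x) / x - cos (t * x) / (A * x\<^sup>2)"
  have "(LBINT t:{0..A}. (1 - t / A) * cos (t * x)) = (LBINT t. ((1 - t / A) * cos (t * x)) * indicator {0..A} t)"
    unfolding set_lebesgue_integral_def by (simp add: mult.commute)
  also have "\<dots> = ?F A - ?F 0"
    by (rule integral_FTC_Icc_real)
      (use A False in \<open>auto intro!: derivative_eq_intros simp: field_simps power2_eq_square\<close>)
  also have "\<dots> = (1 - cos (A * x)) / (A * x\<^sup>2)"
    using A False by (simp add: field_simps)
  finally have *: "(LBINT t:{0..A}. (1 - t / A) * cos (t * x)) = (1 - cos (A * x)) / (A * x\<^sup>2)" .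
  show ?thesis unfolding * using A False by (simp add: fejer_eq field_simps)
qed

lemma fejer_prim_has_derivative:
  assumes "x \<noteq> 0" "A > 0"
  shows "(fejer_prim A has_real_derivative fejer A x) (at x)"
proof -
  have 1: "((\<lambda>x. Si (A * x)) has_real_derivative sinc (A * x) * A) (at x)"
    by (rule DERIV_chain2[OF DERIV_Si]) (auto intro!: derivative_eq_intros)
  have 3: "((\<lambda>x. (1 - cos (A * x)) / (A * x)) has_real_derivative
      (sin (A * x) * A * (A * x) - (1 - cos (A * x)) * A) / (A * x * (A * x))) (at x)"
    by (rule derivative_eq_intros refl | use assms in simp)+
  have 2: "((\<lambda>x. 1 / pi * (Si (A * x) - (1 - cos (A * x)) / (A * x))) has_real_derivative fejer A x) (at x)"
    by (rule DERIV_cong[OF DERIV_cmult[OF DERIV_diff[OF 1 3]]])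
      (use assms in \<open>auto simp: fejer_eq field_simps power2_eq_square\<close>)
  show ?thesis
  proof (rule has_field_derivative_transform_within_open[OF 2])
    show "open (- {0::real})" "x \<in> - {0}" using assms by auto
    fix y :: real assume y: "y \<in> - {0}"
    have "cos (A * y) = 1 - 2 * (sin (A * y / 2))\<^sup>2"
      using cos_double_sin[of "A * y / 2"] by simp
    then show "1 / pi * (Si (A * y) - (1 - cos (A * y)) / (A * y)) = fejer_prim A y"
      using y assms by (simp add: fejer_prim_def field_simps power2_eq_square)
  qed
qed

lemma continuous_on_fejer_prim: "continuous_on S (fejer_prim A)"
proof -
  have "continuous_on UNIV Si" by (simp add: continuous_at_imp_continuous_on isCont_Si)
  then have "continuous_on S (\<lambda>x. Si (A * x))"
    by (rule continuous_on_compose2) (auto intro: continuous_intros)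
  then show ?thesis
    unfolding fejer_prim_def by (intro continuous_intros) auto
qed

lemma fejer_integral:
  assumes A: "A > 0" and ab: "a \<le> b"
  shows "(LBINT v:{a..b}. fejer A (v - s)) = fejer_prim A (b - s) - fejer_prim A (a - s)"
proof -
  have "((\<lambda>v. fejer A (v - s)) has_integral (fejer_prim A (b - s) - fejer_prim A (a - s))) {a..b}"
  proof (rule fundamental_theorem_of_calculus_interior_strong[where S = "{s}"])
    show "continuous_on {a..b} (\<lambda>v. fejer_prim A (v - s))"
      by (rule continuous_on_compose2[OF continuous_on_fejer_prim[of UNIV]]) (auto intro: continuous_intros)
    fix v assume "v \<in> {a<..<b} - {s}"
    then have "(fejer_prim A has_real_derivative fejer A (v - s)) (at (v - s))"
      by (intro fejer_prim_has_derivative A) auto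
    then have "((\<lambda>v. fejer_prim A (v - s)) has_real_derivative fejer A (v - s) * 1) (at v)"
      by (rule DERIV_chain2) (auto intro!: derivative_eq_intros)
    then show "((\<lambda>v. fejer_prim A (v - s)) has_vector_derivative fejer A (v - s)) (at v)"
      by (simp add: has_real_derivative_iff_has_vector_derivative)
  qed (use ab in auto)
  moreover have "set_integrable lborel {a..b} (\<lambda>v. fejer A (v - s))"
    by (rule borel_integrable_atLeastAtMost', intro continuous_on_fejer continuous_intros)
  ultimately show ?thesis
    using set_borel_integral_eq_integral(2) integral_unique by metis
qed

lemma fejer_prim_scale: "fejer_prim A x = fejer_prim 1 (A * x)"
  by (simp add: fejer_prim_def)

lemma fejer_prim_mono: "A > 0 \<Longrightarrow> a \<le> b \<Longrightarrow> fejer_prim A a \<le> fejer_prim A b"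
proof -
  assume *: "A > 0" "a \<le> b"
  have "0 \<le> (LBINT v:{a..b}. fejer A (v - 0))"
    unfolding set_lebesgue_integral_def
    by (rule integral_nonneg_AE) (simp add: fejer_nonneg *)
  then show ?thesis using fejer_integral[OF *, of 0] by simp
qed

lemma fejer_prim_at_top: "(fejer_prim 1 \<longlongrightarrow> 1 / 2) at_top"
proof -
  have "((\<lambda>x. sin (x / 2) * sinc (x / 2)) \<longlongrightarrow> 0) at_top"
  proof (rule Lim_null_comparison)
    show "\<forall>\<^sub>F x in at_top. norm (sin (x / 2) * sinc (x / 2)) \<le> 2 / x"
      using eventually_gt_at_top[of "0::real"]
    proof eventually_elim
      case (elim x)
      have "\<bar>sin (x / 2) * sinc (x / 2)\<bar> = (sin (x / 2))\<^sup>2 * (2 / x)"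
        using elim by (simp add: abs_mult power2_eq_square)
      also have "\<dots> \<le> 1 * (2 / x)"
        using elim by (intro mult_right_mono) (auto simp: abs_square_le_1)
      finally show ?case by simp
    qed
    show "((\<lambda>x. 2 / x) \<longlongrightarrow> (0::real)) at_top" by real_asymp
  qed
  then have "((\<lambda>x. (Si x - sin (x / 2) * sinc (x / 2)) / pi) \<longlongrightarrow> (pi / 2 - 0) / pi) at_top"
    by (intro tendsto_intros Si_at_top) auto
  moreover have "fejer_prim 1 = (\<lambda>x. (Si x - sin (x / 2) * sinc (x / 2)) / pi)"
    by (simp only: fejer_prim_def[abs_def] mult_1)
  ultimately show ?thesis by simp
qed

lemma fejer_prim_minus: "fejer_prim A (- x) = - fejer_prim A x"
proof -
  have *: "Si (- y) = - Si y" for y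
    using Si_neg[of y] Si_neg[of "- y"] by (cases "y \<ge> 0") auto
  have "fejer_prim A (- x) = (Si (- (A * x)) - sin (- (A * x / 2)) * sinc (- (A * x / 2))) / pi"
    by (simp add: fejer_prim_def)
  also have "\<dots> = - fejer_prim A x"
  proof -
    have "(- a - (- b) * c) / pi = - ((a - b * c) / pi)" for a b c
      by (simp add: field_simps)
    then show ?thesis unfolding fejer_prim_def * sinc_neg unfolding sin_minus .
  qed
  finally show ?thesis .
qed

lemma fejer_prim_le_half: "A > 0 \<Longrightarrow> \<bar>fejer_prim A x\<bar> \<le> 1 / 2"
proof -
  have *: "fejer_prim 1 x \<le> 1 / 2" for x
  proof (rule tendsto_lowerbound[OF fejer_prim_at_top])
    show "\<forall>\<^sub>F y in at_top. fejer_prim 1 x \<le> fejer_prim 1 y"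
      using eventually_ge_at_top[of x] by eventually_elim (simp add: fejer_prim_mono)
  qed simp
  show ?thesis
    using *[of "A * x"] *[of "- (A * x)"] by (simp add: fejer_prim_scale[of A] fejer_prim_minus)
qed

lemma fejer_prim_ge:
  assumes "e > 0"
  obtains R where "R > 0" "\<And>A x. A > 0 \<Longrightarrow> A * x \<ge> R \<Longrightarrow> fejer_prim A x \<ge> 1 / 2 - e"
proof -
  have "\<forall>\<^sub>F x in at_top. fejer_prim 1 x > 1 / 2 - e"
    by (rule order_tendstoD[OF fejer_prim_at_top]) (use assms in auto)
  then obtain R where R: "\<And>x. x \<ge> R \<Longrightarrow> fejer_prim 1 x > 1 / 2 - e"
    by (auto simp: eventually_at_top_linorder)
  show ?thesis
  proof (rule that[of "max R 1"])
    fix A x :: real assume "A > 0" "max R 1 \<le> A * x"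
    then show "1 / 2 - e \<le> fejer_prim A x"
      using R[of "A * x"] by (subst fejer_prim_scale) simp
  qed simp
qed

text \<open>The zeros of the kernels of width one centred at \<open>0\<close> and at \<open>- 1\<close> are disjoint, so that away from the
  origin their sum dominates \<open>1 / x\<^sup>2\<close>, hence also the tail of a narrow kernel, with a factor \<open>1 / A\<close>.\<close>

lemma fejer_far:
  assumes r: "r > 0"
  obtains C where "C > 0"
    "\<And>A x. A > 0 \<Longrightarrow> \<bar>x\<bar> \<ge> r \<Longrightarrow> fejer A x \<le> C / A * (fejer 1 x + fejer 1 (x + 1))"
proof -
  define c where "c = 1 - cos (1 / 2 :: real)"
  have "cos (1 / 2 :: real) < cos 0"
    using pi_gt3 by (intro cos_monotone_0_pi) auto
  then have c: "c > 0" by (simp add: c_def)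
  define D where "D = (1 + 1 / r)\<^sup>2"
  have D: "D \<ge> 1" using r by (simp add: D_def)
  have main: "fejer A x \<le> D / c / A * (fejer 1 x + fejer 1 (x + 1))"
    if A: "A > 0" and x: "\<bar>x\<bar> \<ge> r" for A x
  proof -
    have x0: "x \<noteq> 0" using x r by auto
    have 1: "fejer A x \<le> 2 / (pi * A * x\<^sup>2)"
      using A x0 cos_ge_minus_one[of "A * x"] by (simp add: fejer_eq divide_right_mono)
    have 2: "(1 - cos x) / (pi * D * x\<^sup>2) \<le> fejer 1 x"
      using D x0 mult_right_mono[of 1 D "(1 - cos x) / (pi * x\<^sup>2)"] cos_le_one[of x]
      by (simp add: fejer_eq field_simps)
    have 3: "(1 - cos (x + 1)) / (pi * D * x\<^sup>2) \<le> fejer 1 (x + 1)"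
    proof (cases "x + 1 = 0")
      case False
      have "\<bar>x + 1\<bar> \<le> \<bar>x\<bar> + 1" by simp
      also have "\<dots> \<le> \<bar>x\<bar> * (1 + 1 / r)" using x r by (simp add: field_simps)
      finally have "\<bar>x + 1\<bar>\<^sup>2 \<le> (\<bar>x\<bar> * (1 + 1 / r))\<^sup>2" by (intro power_mono) auto
      then have *: "(x + 1)\<^sup>2 \<le> D * x\<^sup>2" by (simp add: D_def power_mult_distrib mult.commute)
      have "(1 - cos (x + 1)) / (pi * (D * x\<^sup>2)) \<le> (1 - cos (x + 1)) / (pi * (x + 1)\<^sup>2)"
        using * False by (intro divide_left_mono mult_left_mono mult_pos_pos) (use D x0 in auto)
      then show ?thesis using False by (simp add: fejer_eq mult.assoc)
    next
      case True
      then show ?thesis by (simp add: fejer_def)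
    qed
    have "cos x + cos (x + 1) = 2 * cos (x + 1 / 2) * cos (1 / 2)"
      using cos_plus_cos[of "x + 1" x] by (simp add: add_divide_distrib add.commute)
    also have "\<dots> \<le> 2 * 1 * cos (1 / 2)"
      using pi_gt3 by (intro mult_right_mono mult_left_mono cos_ge_zero) auto
    finally have "2 * c \<le> (1 - cos x) + (1 - cos (x + 1))" by (simp add: c_def)
    then have "2 * c / (pi * D * x\<^sup>2) \<le> (1 - cos x) / (pi * D * x\<^sup>2) + (1 - cos (x + 1)) / (pi * D * x\<^sup>2)"
      using D x0 by (simp add: add_divide_distrib[symmetric] divide_right_mono)
    also have "\<dots> \<le> fejer 1 x + fejer 1 (x + 1)" using 2 3 by simp
    finally have "D / c / A * (2 * c / (pi * D * x\<^sup>2)) \<le> D / c / A * (fejer 1 x + fejer 1 (x + 1))"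
      using D c A by (intro mult_left_mono) auto
    moreover have "D / c / A * (2 * c / (pi * D * x\<^sup>2)) = 2 / (pi * A * x\<^sup>2)"
      using D c A by (simp add: field_simps)
    ultimately show ?thesis using 1 by simp
  qed
  show ?thesis by (rule that[of "D / c"]) (use main D c in auto)
qed

section \<open>Convolution powers\<close>

text \<open>The m-fold convolution power: for a probability law, the law of a sum of m independent steps.\<close>

primrec cpow :: "real measure \<Rightarrow> nat \<Rightarrow> real measure" where
  "cpow \<nu> 0 = return borel 0"
| "cpow \<nu> (Suc m) = convolution \<nu> (cpow \<nu> m)"

text \<open>Step laws are Borel measures on the line of total mass at most one. Defective laws are included because
  truncating the steps simply discards mass.\<close>

locale step_law = subprob_space \<nu> for \<nu> :: "real measure" +
  assumes sets_eq [measurable_cong, simp]: "sets \<nu> = sets borel"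
begin

lemma space_eq [simp]: "space \<nu> = UNIV"
  using sets_eq_imp_space_eq[OF sets_eq] by simp

lemma integrable_bounded:
  fixes f :: "real \<Rightarrow> 'b::{banach,second_countable_topology}"
  assumes "f \<in> borel_measurable borel" "\<And>x. norm (f x) \<le> B"
  shows "integrable \<nu> f"
  by (rule integrable_const_bound[of _ B]) (use assms in auto)

lemma measure_le_1: "measure \<nu> A \<le> 1"
  by (rule subprob_measure_le_1)

lemma integral_le_const:
  fixes f :: "real \<Rightarrow> real"
  assumes "\<And>x. f x \<le> B" "B \<ge> 0"
  shows "(LINT x|\<nu>. f x) \<le> B"
proof (cases "integrable \<nu> f")
  case True
  have "(LINT x|\<nu>. f x) \<le> (LINT x|\<nu>. B)"
    by (rule integral_mono) (use assms True in auto)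
  also have "\<dots> = measure \<nu> UNIV * B" by simp
  also have "\<dots> \<le> 1 * B" by (intro mult_right_mono measure_le_1 assms)
  finally show ?thesis by simp
qed (use assms in \<open>simp add: not_integrable_integral_eq\<close>)

end

lemma step_law_convolution:
  assumes "step_law M" "step_law N"
  shows "step_law (convolution M N)"
proof -
  interpret M: step_law M by fact
  interpret N: step_law N by fact
  have "emeasure (convolution M N) UNIV = \<integral>\<^sup>+x. emeasure N {a. a + x \<in> UNIV} \<partial>M"
    by (subst convolution_emeasure) (auto simp: M.finite_measure_axioms N.finite_measure_axioms)
  also have "\<dots> \<le> \<integral>\<^sup>+x. 1 \<partial>M"
    using N.emeasure_space_le_1 by (intro nn_integral_mono) auto
  also have "\<dots> \<le> 1" using M.emeasure_space_le_1 by simp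
  finally have *: "emeasure (convolution M N) UNIV \<le> 1" .
  show ?thesis
  proof (rule step_law.intro)
    show "subprob_space (convolution M N)"
      by (rule subprob_spaceI) (simp_all add: *)
    show "step_law_axioms (convolution M N)"
      by (rule step_law_axioms.intro) simp
  qed
qed

lemma step_law_return: "step_law (return borel 0)"
proof (rule step_law.intro)
  show "subprob_space (return borel (0::real))"
    by (rule subprob_spaceI) (simp_all add: emeasure_return)
  show "step_law_axioms (return borel (0::real))"
    by (rule step_law_axioms.intro) simp
qed

context step_law
begin

lemma step_law_cpow: "step_law (cpow \<nu> m)"
proof (induction m)
  case 0
  show ?case by (simp add: step_law_return)
next
  case (Suc m)
  then show ?case by (simp add: step_law_convolution[OF step_law_axioms])
qed

lemma sets_cpow [simp, measurable_cong]: "sets (cpow \<nu> m) = sets borel"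
  by (rule step_law.sets_eq[OF step_law_cpow])

lemma integral_cpow_Suc:
  fixes f :: "real \<Rightarrow> 'b::{banach,second_countable_topology}"
  assumes [measurable]: "f \<in> borel_measurable borel" and B: "\<And>x. norm (f x) \<le> B"
  shows "(LINT s|cpow \<nu> (Suc m). f s) = (LINT w|\<nu>. LINT s|cpow \<nu> m. f (w + s))"
proof -
  interpret N: step_law "cpow \<nu> m" by (rule step_law_cpow)
  interpret P: pair_sigma_finite \<nu> "cpow \<nu> m" ..
  interpret PF: finite_measure "\<nu> \<Otimes>\<^sub>M cpow \<nu> m"
    by (rule finite_measure_pair_measure) (simp_all add: finite_measure_axioms N.finite_measure_axioms)
  have "(LINT s|cpow \<nu> (Suc m). f s) = (LINT p|(\<nu> \<Otimes>\<^sub>M cpow \<nu> m). f (case p of (x, y) \<Rightarrow> x + y))"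
    unfolding cpow.simps convolution_def by (subst integral_distr) auto
  also have "\<dots> = (LINT p|(\<nu> \<Otimes>\<^sub>M cpow \<nu> m). (case p of (x, y) \<Rightarrow> f (x + y)))"
    by (intro Bochner_Integration.integral_cong) auto
  also have "\<dots> = (LINT w|\<nu>. LINT s|cpow \<nu> m. f (w + s))"
  proof (rule P.integral_fst'[symmetric, of "\<lambda>p. case p of (x, y) \<Rightarrow> f (x + y)", simplified])
    show "integrable (\<nu> \<Otimes>\<^sub>M cpow \<nu> m) (\<lambda>p. case p of (x, y) \<Rightarrow> f (x + y))"
      by (rule PF.integrable_const_bound[of _ B]) (use B in auto)
  qed
  finally show ?thesis .
qed

lemma char_cpow: "char (cpow \<nu> m) t = char \<nu> t ^ m"
proof (induction m)
  case 0
  then show ?case by (simp add: char_def integral_return)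
next
  case (Suc m)
  have "char (cpow \<nu> (Suc m)) t = (LINT w|\<nu>. LINT s|cpow \<nu> m. iexp (t * (w + s)))"
    unfolding char_def by (rule integral_cpow_Suc[of _ 1]) auto
  also have "\<dots> = (LINT w|\<nu>. iexp (t * w) * char (cpow \<nu> m) t)"
    unfolding char_def
    by (intro Bochner_Integration.integral_cong) (simp_all add: distrib_left exp_add)
  also have "\<dots> = char \<nu> t * char (cpow \<nu> m) t"
    unfolding char_def by (subst integral_mult_left_zero) auto
  finally show ?case using Suc by simp
qed

text \<open>Smoothing by the Fejer kernel only sees the characteristic function on the compact interval \<open>[- A, A]\<close>;
  by symmetry the half \<open>[0, A]\<close> suffices.\<close>

lemma integral_fejer_char:
  assumes A: "A > 0"
  shows "(LINT s|\<nu>. fejer A (v - s)) = (LBINT t:{0..A}. (1 - t / A) * Re (iexp (- t * v) * char \<nu> t)) / pi"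
proof -
  interpret P: pair_sigma_finite \<nu> lborel ..
  let ?g = "\<lambda>s t. indicator {0..A} t * ((1 - t / A) * cos (t * (v - s)))"
  have int: "integrable (\<nu> \<Otimes>\<^sub>M lborel) (\<lambda>(s, t). ?g s t)"
  proof (rule P.Fubini_integrable)
    show "(\<lambda>(s, t). ?g s t) \<in> borel_measurable (\<nu> \<Otimes>\<^sub>M lborel)" by measurable
    have i: "integrable lborel (\<lambda>t. ?g s t)" for s
    proof -
      have "set_integrable lborel {0..A} (\<lambda>t. (1 - t / A) * cos (t * (v - s)))"
        by (rule borel_integrable_atLeastAtMost') (use A in \<open>auto intro!: continuous_intros\<close>)
      then show ?thesis unfolding set_integrable_def by simp
    qed
    then show "AE s in \<nu>. integrable lborel (\<lambda>t. (case (s, t) of (s, t) \<Rightarrow> ?g s t))" by simp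
    show "integrable \<nu> (\<lambda>s. LINT t|lborel. norm (case (s, t) of (s, t) \<Rightarrow> ?g s t))"
    proof (rule integrable_bounded)
      show "(\<lambda>s. LINT t|lborel. norm (case (s, t) of (s, t) \<Rightarrow> ?g s t)) \<in> borel_measurable borel"
        by measurable
      fix s
      have "(LINT t|lborel. norm (case (s, t) of (s, t) \<Rightarrow> ?g s t)) \<le> (LINT t|lborel. indicator {0..A} t)"
      proof (rule integral_mono)
        show "integrable lborel (\<lambda>t. norm (case (s, t) of (s, t) \<Rightarrow> ?g s t))"
          unfolding prod.case using i[of s] by (rule integrable_norm)
        show "integrable lborel (indicat_real {0..A})"
          by (rule integrable_real_indicator) (auto simp: emeasure_lborel_Icc_eq)
        fix t
        show "norm (case (s, t) of (s, t) \<Rightarrow> ?g s t) \<le> indicator {0..A} t"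
        proof (cases "t \<in> {0..A}")
          case True
          then have "\<bar>1 - t / A\<bar> \<le> 1" using A by (auto simp: abs_le_iff)
          then have "\<bar>1 - t / A\<bar> * \<bar>cos (t * (v - s))\<bar> \<le> 1" by (intro mult_le_one) auto
          then show ?thesis using True by (simp add: abs_mult)
        qed simp
      qed
      also have "\<dots> = A" using A by simp
      finally show "norm (LINT t|lborel. norm (case (s, t) of (s, t) \<Rightarrow> ?g s t)) \<le> A"
        by (simp add: integral_nonneg_AE)
    qed
  qed
  have "(LINT s|\<nu>. fejer A (v - s)) = (LINT s|\<nu>. (LINT t|lborel. ?g s t)) / pi"
    by (simp add: fejer_cos[OF A] set_lebesgue_integral_def)
  also have "(LINT s|\<nu>. (LINT t|lborel. ?g s t)) = (LINT t|lborel. (LINT s|\<nu>. ?g s t))"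
    using P.Fubini_integral[OF int] by simp
  also have "\<dots> = (LBINT t:{0..A}. (1 - t / A) * Re (iexp (- t * v) * char \<nu> t))"
    unfolding set_lebesgue_integral_def
  proof (rule Bochner_Integration.integral_cong)
    fix t
    have i: "integrable \<nu> (\<lambda>s. iexp (- t * v) * iexp (t * s))"
      by (rule integrable_bounded[of _ 1]) (auto simp: norm_mult)
    have "Re (iexp (- t * v) * char \<nu> t) = Re (LINT s|\<nu>. iexp (- t * v) * iexp (t * s))"
      by (simp add: char_def)
    also have "\<dots> = (LINT s|\<nu>. Re (iexp (- t * v) * iexp (t * s)))"
      using i by (rule integral_Re[symmetric])
    also have "\<dots> = (LINT s|\<nu>. cos (t * (v - s)))"
    proof (rule Bochner_Integration.integral_cong)
      fix s
      have "iexp (- t * v) * iexp (t * s) = iexp (- (t * (v - s)))"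
        by (simp add: exp_add[symmetric] algebra_simps)
      then show "Re (iexp (- t * v) * iexp (t * s)) = cos (t * (v - s))"
        by (simp add: Re_exp)
    qed simp
    finally show "(LINT s|\<nu>. ?g s t) = indicator {0..A} t *\<^sub>R ((1 - t / A) * Re (iexp (- t * v) * char \<nu> t))"
      by simp
  qed simp
  finally show ?thesis .
qed

end

section \<open>Characteristic function of a centred non-lattice law\<close>

text \<open>The reference law of a single step, with standard deviation \<open>\<sigma>\<close>.\<close>

locale centred_law = real_distribution \<mu> for \<mu> :: "real measure" +
  fixes \<sigma> :: real
  assumes int1: "integrable \<mu> (\<lambda>x. x)" and mean0: "(LINT x|\<mu>. x) = 0"
    and int2: "integrable \<mu> (\<lambda>x. x\<^sup>2)" and var: "(LINT x|\<mu>. x\<^sup>2) = \<sigma>\<^sup>2"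
    and \<sigma>_pos: "\<sigma> > 0" and nonlat: "non_lattice \<mu> (\<lambda>x. x)"

sublocale centred_law \<subseteq> step_law \<mu>
proof (rule step_law.intro)
  show "subprob_space \<mu>" by (rule prob_space_imp_subprob_space) unfold_locales
  show "step_law_axioms \<mu>" by (rule step_law_axioms.intro) simp
qed

context centred_law
begin

text \<open>If the characteristic function has modulus one at \<open>t \<noteq> 0\<close>, then \<open>cos (t X - \<alpha>) = 1\<close> almost surely for some
  phase \<open>\<alpha>\<close>, which confines the step to a lattice of span \<open>2 \<pi> / \<bar>t\<bar>\<close>.\<close>

lemma char_less_1:
  assumes t: "t \<noteq> 0"
  shows "cmod (char \<mu> t) < 1"
proof (rule ccontr)
  assume "\<not> ?thesis"
  then have 1: "cmod (char \<mu> t) = 1" using cmod_char_le_1[of t] by simp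
  define \<alpha> where "\<alpha> = Arg (char \<mu> t)"
  have \<alpha>: "char \<mu> t = iexp \<alpha>"
  proof -
    have "char \<mu> t \<noteq> 0" using 1 by auto
    from cis_Arg[OF this] show ?thesis
      using 1 by (simp add: \<alpha>_def cis_conv_exp sgn_div_norm)
  qed
  have i: "integrable \<mu> (\<lambda>s. iexp (- \<alpha>) * iexp (t * s))"
    by (rule integrable_bounded[of _ 1]) (auto simp: norm_mult)
  have "(LINT s|\<mu>. Re (iexp (- \<alpha>) * iexp (t * s))) = Re (LINT s|\<mu>. iexp (- \<alpha>) * iexp (t * s))"
    using i by (rule integral_Re)
  also have "\<dots> = Re (iexp (- \<alpha>) * char \<mu> t)"
    by (simp add: char_def)
  also have "iexp (- \<alpha>) * char \<mu> t = 1"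
    unfolding \<alpha> by (simp add: exp_add[symmetric])
  also have "(\<lambda>s. Re (iexp (- \<alpha>) * iexp (t * s))) = (\<lambda>s. cos (t * s - \<alpha>))"
  proof
    fix s
    have "iexp (- \<alpha>) * iexp (t * s) = iexp (t * s - \<alpha>)"
      by (simp add: exp_add[symmetric] algebra_simps)
    then show "Re (iexp (- \<alpha>) * iexp (t * s)) = cos (t * s - \<alpha>)" by (simp add: Re_exp)
  qed
  finally have 2: "(LINT s|\<mu>. cos (t * s - \<alpha>)) = 1" by simp
  have i2: "integrable \<mu> (\<lambda>s. cos (t * s - \<alpha>))"
    by (rule integrable_bounded[of _ 1]) auto
  have "(LINT s|\<mu>. 1 - cos (t * s - \<alpha>)) = 0"
    using i2 2 prob_space by simp
  then have "AE s in \<mu>. 1 - cos (t * s - \<alpha>) = 0"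
    by (subst (asm) integral_nonneg_eq_0_iff_AE) (use i2 in auto)
  \<comment> \<open>the offset of the lattice is reduced modulo its span\<close>
  moreover define h where "h = 2 * pi / \<bar>t\<bar>"
  moreover define a where "a = \<alpha> / t - h * of_int \<lfloor>\<alpha> / t / h\<rfloor>"
  ultimately have AE: "AE s in \<mu>. s \<in> {h * of_int k + a | k. True}"
  proof (elim AE_mp, intro AE_I2 impI)
    fix s assume "1 - cos (t * s - \<alpha>) = 0"
    then obtain n :: int where n: "t * s - \<alpha> = of_int n * 2 * pi"
      using cos_one_2pi_int[of "t * s - \<alpha>"] by auto
    have "s = \<alpha> / t + of_int n * (2 * pi / t)"
      using n t by (simp add: field_simps)
    also have "2 * pi / t = of_int (if t > 0 then 1 else - 1) * h"
      using t by (simp add: h_def)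
    also have "\<alpha> / t + of_int n * (of_int (if t > 0 then 1 else - 1) * h) =
      h * of_int (n * (if t > 0 then 1 else - 1) + \<lfloor>\<alpha> / t / h\<rfloor>) + a"
      by (simp add: a_def algebra_simps)
    finally show "s \<in> {h * of_int k + a | k. True}" by blast
  qed
  have h: "h > 0" using t by (simp add: h_def)
  have "a \<in> {0..<h}"
  proof -
    have "a = h * (\<alpha> / t / h - of_int \<lfloor>\<alpha> / t / h\<rfloor>)"
      using h by (simp add: a_def field_simps)
    moreover have "0 \<le> \<alpha> / t / h - of_int \<lfloor>\<alpha> / t / h\<rfloor>" "\<alpha> / t / h - of_int \<lfloor>\<alpha> / t / h\<rfloor> < 1"
      by linarith+
    ultimately show ?thesis
      using h mult_strict_left_mono[of "\<alpha> / t / h - of_int \<lfloor>\<alpha> / t / h\<rfloor>" 1 h] by auto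
  qed
  moreover have "{h * of_int k + a | k. True} \<in> sets borel"
  proof (rule sets.countable)
    show "countable {h * of_int k + a | k. True}"
      using countable_image[of "UNIV :: int set" "\<lambda>k. h * of_int k + a"] by (simp add: full_SetCompr_eq)
  qed auto
  then have "measure \<mu> {\<omega> \<in> space \<mu>. \<omega> \<in> {h * of_int k + a | k. True}} = 1"
    using AE by (subst prob_Collect_eq_1) auto
  ultimately show False
    using nonlat h unfolding non_lattice_def by blast
qed

lemma char_remainder_tendsto:
  "(\<lambda>n. LINT x|\<mu>. min (6 * x\<^sup>2) (inverse (real (Suc n)) * \<bar>x\<bar> ^ 3)) \<longlonglongrightarrow> 0"
proof -
  have "(\<lambda>n. LINT x|\<mu>. min (6 * x\<^sup>2) (inverse (real (Suc n)) * \<bar>x\<bar> ^ 3)) \<longlonglongrightarrow> (LINT x|\<mu>. 0)"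
  proof (rule integral_dominated_convergence[where w = "\<lambda>x. 6 * x\<^sup>2"])
    show "integrable \<mu> (\<lambda>x. 6 * x\<^sup>2)" using int2 by simp
    show "AE x in \<mu>. (\<lambda>n. min (6 * x\<^sup>2) (inverse (real (Suc n)) * \<bar>x\<bar> ^ 3)) \<longlonglongrightarrow> 0"
    proof (rule AE_I2)
      fix x :: real
      have "(\<lambda>n. min (6 * x\<^sup>2) (inverse (real (Suc n)) * \<bar>x\<bar> ^ 3)) \<longlonglongrightarrow> min (6 * x\<^sup>2) (0 * \<bar>x\<bar> ^ 3)"
        by (intro tendsto_intros LIMSEQ_inverse_real_of_nat)
      then show "(\<lambda>n. min (6 * x\<^sup>2) (inverse (real (Suc n)) * \<bar>x\<bar> ^ 3)) \<longlonglongrightarrow> 0"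
        by (simp add: min_absorb2)
    qed
    show "AE x in \<mu>. norm (min (6 * x\<^sup>2) (inverse (real (Suc n)) * \<bar>x\<bar> ^ 3)) \<le> 6 * x\<^sup>2" for n
      by (rule AE_I2) auto
  qed auto
  then show ?thesis by simp
qed

lemma char_quadratic:
  assumes "e > 0"
  obtains t0 where "t0 > 0" "\<And>t. \<bar>t\<bar> \<le> t0 \<Longrightarrow> cmod (char \<mu> t - (1 - t\<^sup>2 * \<sigma>\<^sup>2 / 2)) \<le> e * t\<^sup>2"
proof -
  let ?R = "\<lambda>t. LINT x|\<mu>. min (6 * x\<^sup>2) (\<bar>t\<bar> * \<bar>x\<bar> ^ 3)"
  have "\<forall>\<^sub>F n in sequentially. (LINT x|\<mu>. min (6 * x\<^sup>2) (inverse (real (Suc n)) * \<bar>x\<bar> ^ 3)) < 6 * e"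
    by (rule order_tendstoD[OF char_remainder_tendsto]) (use assms in auto)
  then obtain n where n: "(LINT x|\<mu>. min (6 * x\<^sup>2) (inverse (real (Suc n)) * \<bar>x\<bar> ^ 3)) < 6 * e"
    by (auto simp: eventually_sequentially)
  have i: "integrable \<mu> (\<lambda>x. min (6 * x\<^sup>2) (c * \<bar>x\<bar> ^ 3))" if "c \<ge> 0" for c
    by (rule Bochner_Integration.integrable_bound[of _ "\<lambda>x. 6 * x\<^sup>2"]) (use int2 that in auto)
  show ?thesis
  proof (rule that[of "inverse (real (Suc n))"])
    fix t :: real assume t: "\<bar>t\<bar> \<le> inverse (real (Suc n))"
    have "?R t \<le> (LINT x|\<mu>. min (6 * x\<^sup>2) (inverse (real (Suc n)) * \<bar>x\<bar> ^ 3))"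
    proof (rule integral_mono[OF i i])
      fix x :: real
      have "\<bar>t\<bar> * \<bar>x\<bar> ^ 3 \<le> inverse (real (Suc n)) * \<bar>x\<bar> ^ 3"
        using t by (intro mult_right_mono) auto
      then show "min (6 * x\<^sup>2) (\<bar>t\<bar> * \<bar>x\<bar> ^ 3) \<le> min (6 * x\<^sup>2) (inverse (real (Suc n)) * \<bar>x\<bar> ^ 3)"
        by (rule min.mono[OF order_refl])
    qed auto
    with n have "?R t \<le> 6 * e" by simp
    then have "t\<^sup>2 / 6 * ?R t \<le> t\<^sup>2 / 6 * (6 * e)" by (intro mult_left_mono) auto
    moreover have "cmod (char \<mu> t - (1 - t\<^sup>2 * \<sigma>\<^sup>2 / 2)) \<le> t\<^sup>2 / 6 * ?R t"
      using char_approx3[of "\<sigma>\<^sup>2" t] int1 mean0 int2 var by simp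
    ultimately show "cmod (char \<mu> t - (1 - t\<^sup>2 * \<sigma>\<^sup>2 / 2)) \<le> e * t\<^sup>2" by (simp add: mult.commute)
  qed simp
qed

text \<open>Near the origin the bound comes from the second order expansion, elsewhere from compactness and
  the non-lattice property.\<close>

lemma char_decay:
  assumes A: "A > 0"
  obtains c where "c > 0" "\<And>t. \<bar>t\<bar> \<le> A \<Longrightarrow> cmod (char \<mu> t) \<le> 1 - c * t\<^sup>2"
proof -
  have "\<sigma>\<^sup>2 / 4 > 0" using \<sigma>_pos by simp
  then obtain t1 where t1: "t1 > 0" "\<And>t. \<bar>t\<bar> \<le> t1 \<Longrightarrow> cmod (char \<mu> t - (1 - t\<^sup>2 * \<sigma>\<^sup>2 / 2)) \<le> \<sigma>\<^sup>2 / 4 * t\<^sup>2"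
    using char_quadratic by blast
  define t0 where "t0 = min t1 (1 / \<sigma>)"
  have t0: "t0 > 0" using t1 \<sigma>_pos by (simp add: t0_def)
  have near: "cmod (char \<mu> t) \<le> 1 - \<sigma>\<^sup>2 / 4 * t\<^sup>2" if t: "\<bar>t\<bar> \<le> t0" for t
  proof -
    have "\<bar>t\<bar> * \<sigma> \<le> 1" using t \<sigma>_pos by (simp add: t0_def field_simps)
    then have "(\<bar>t\<bar> * \<sigma>)\<^sup>2 \<le> 1" using \<sigma>_pos by (simp add: abs_square_le_1)
    then have *: "t\<^sup>2 * \<sigma>\<^sup>2 \<le> 1" by (simp add: power_mult_distrib)
    let ?x = "1 - t\<^sup>2 * \<sigma>\<^sup>2 / 2"
    have "cmod (char \<mu> t) \<le> cmod (complex_of_real ?x) + cmod (char \<mu> t - complex_of_real ?x)"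
      using norm_triangle_ineq[of "complex_of_real ?x" "char \<mu> t - complex_of_real ?x"] by simp
    moreover have "cmod (complex_of_real ?x) = ?x" unfolding norm_of_real using * by simp
    moreover have "cmod (char \<mu> t - complex_of_real ?x) \<le> \<sigma>\<^sup>2 / 4 * t\<^sup>2"
      using t t1(2)[of t] by (simp add: t0_def)
    ultimately show ?thesis by (simp add: mult.commute)
  qed
  show ?thesis
  proof (cases "A \<le> t0")
    case True
    show ?thesis by (rule that[of "\<sigma>\<^sup>2 / 4"]) (use near True \<sigma>_pos in auto)
  next
    case False
    define K where "K = {-A..-t0} \<union> {t0..A}"
    have K: "compact K" "K \<noteq> {}" using False by (auto simp: K_def)
    have "continuous_on K (\<lambda>t. cmod (char \<mu> t))"
      by (intro continuous_intros continuous_at_imp_continuous_on ballI isCont_char)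
    from continuous_attains_sup[OF K this] obtain s where
      s: "s \<in> K" "\<And>t. t \<in> K \<Longrightarrow> cmod (char \<mu> t) \<le> cmod (char \<mu> s)" by blast
    have "s \<noteq> 0" using s(1) t0 by (auto simp: K_def)
    then have s1: "cmod (char \<mu> s) < 1" by (rule char_less_1)
    define c where "c = min (\<sigma>\<^sup>2 / 4) ((1 - cmod (char \<mu> s)) / A\<^sup>2)"
    have c: "c > 0" using s1 A \<sigma>_pos by (simp add: c_def)
    show ?thesis
    proof (rule that[OF c])
      fix t assume t: "\<bar>t\<bar> \<le> A"
      show "cmod (char \<mu> t) \<le> 1 - c * t\<^sup>2"
      proof (cases "\<bar>t\<bar> \<le> t0")
        case True
        have "c * t\<^sup>2 \<le> \<sigma>\<^sup>2 / 4 * t\<^sup>2" unfolding c_def by (intro mult_right_mono min.cobounded1) simp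
        then show ?thesis using near[OF True] by simp
      next
        case False
        then have "t \<in> K" using t by (auto simp: K_def)
        moreover have "\<bar>t\<bar>\<^sup>2 \<le> A\<^sup>2" using t A by (intro power_mono) auto
        then have "c * t\<^sup>2 \<le> (1 - cmod (char \<mu> s)) / A\<^sup>2 * A\<^sup>2"
          using s1 A by (intro mult_mono) (auto simp: c_def)
        then have "c * t\<^sup>2 \<le> 1 - cmod (char \<mu> s)" using A by simp
        ultimately show ?thesis using s(2)[of t] by simp
      qed
    qed
  qed
qed

lemma char_power_tendsto:
  "(\<lambda>m. char \<mu> (s / sqrt (real m)) ^ m) \<longlonglongrightarrow> complex_of_real (exp (- (\<sigma>\<^sup>2 * s\<^sup>2 / 2)))"
proof -
  have "(\<lambda>m. complex_of_real ((1 + (- (\<sigma>\<^sup>2 * s\<^sup>2 / 2)) / real m) ^ m)) \<longlonglongrightarrow>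
      complex_of_real (exp (- (\<sigma>\<^sup>2 * s\<^sup>2 / 2)))"
    by (rule isCont_tendsto_compose [OF _ tendsto_exp_limit_sequentially]) auto
  moreover have "(\<lambda>m. char \<mu> (s / sqrt (real m)) ^ m -
      complex_of_real ((1 + (- (\<sigma>\<^sup>2 * s\<^sup>2 / 2)) / real m) ^ m)) \<longlonglongrightarrow> 0"
  proof (rule tendstoI)
    fix e :: real assume e: "e > 0"
    define d where "d = e / (1 + s\<^sup>2) / 2"
    have d: "d > 0" using e by (simp add: d_def add_pos_nonneg)
    obtain t0 where t0: "t0 > 0"
      "\<And>t. \<bar>t\<bar> \<le> t0 \<Longrightarrow> cmod (char \<mu> t - (1 - t\<^sup>2 * \<sigma>\<^sup>2 / 2)) \<le> d * t\<^sup>2"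
      using char_quadratic[OF d] by blast
    have "(\<lambda>m. \<bar>s\<bar> / sqrt (real m)) \<longlonglongrightarrow> 0" by real_asymp
    then have ev: "\<forall>\<^sub>F m in sequentially. \<bar>s\<bar> / sqrt (real m) < t0"
      using t0(1) by (rule order_tendstoD)
    have "(\<lambda>m. \<sigma>\<^sup>2 * s\<^sup>2 / real m) \<longlonglongrightarrow> 0" by real_asymp
    then have ev2: "\<forall>\<^sub>F m in sequentially. \<sigma>\<^sup>2 * s\<^sup>2 / real m < 1"
      by (rule order_tendstoD) simp
    show "\<forall>\<^sub>F m in sequentially. dist (char \<mu> (s / sqrt (real m)) ^ m -
      complex_of_real ((1 + (- (\<sigma>\<^sup>2 * s\<^sup>2 / 2)) / real m) ^ m)) 0 < e"
      using ev ev2 eventually_gt_at_top[of 0]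
    proof eventually_elim
      case (elim m)
      let ?t = "s / sqrt (real m)"
      have t2: "?t\<^sup>2 = s\<^sup>2 / real m" by (simp add: power_divide)
      have "1 + (- (\<sigma>\<^sup>2 * s\<^sup>2 / 2)) / real m = 1 - ?t\<^sup>2 * \<sigma>\<^sup>2 / 2"
        unfolding t2 by (simp add: mult.commute)
      then have "cmod (char \<mu> ?t - complex_of_real (1 + (- (\<sigma>\<^sup>2 * s\<^sup>2 / 2)) / real m)) \<le> d * ?t\<^sup>2"
        using t0(2)[of ?t] elim by (simp only: abs_divide) simp
      moreover have "cmod (char \<mu> ?t ^ m - complex_of_real (1 + (- (\<sigma>\<^sup>2 * s\<^sup>2 / 2)) / real m) ^ m) \<le>
         m * cmod (char \<mu> ?t - complex_of_real (1 + (- (\<sigma>\<^sup>2 * s\<^sup>2 / 2)) / real m))"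
      proof (rule norm_power_diff)
        show "cmod (char \<mu> ?t) \<le> 1" by (rule cmod_char_le_1)
        show "cmod (complex_of_real (1 + (- (\<sigma>\<^sup>2 * s\<^sup>2 / 2)) / real m)) \<le> 1"
          unfolding norm_of_real using elim by (simp add: abs_le_iff)
      qed
      ultimately have "cmod (char \<mu> ?t ^ m - complex_of_real (1 + (- (\<sigma>\<^sup>2 * s\<^sup>2 / 2)) / real m) ^ m) \<le>
         m * (d * ?t\<^sup>2)"
        by (meson mult_left_mono of_nat_0_le_iff order_trans)
      also have "\<dots> = d * s\<^sup>2" using elim by (simp add: t2)
      also have "\<dots> \<le> d * (1 + s\<^sup>2)" using d by simp
      also have "\<dots> = e / 2"
      proof -
        have "1 + s\<^sup>2 \<noteq> 0" by (simp add: add_nonneg_eq_0_iff)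
        then show ?thesis unfolding d_def by (metis nonzero_eq_divide_eq times_divide_eq_left)
      qed
      also have "\<dots> < e" using e by simp
      finally show ?case by simp
    qed
  qed
  ultimately show ?thesis using tendsto_add by fastforce
qed

end

section \<open>The smoothed local limit theorem\<close>

lemma gauss_half_line:
  assumes "\<sigma> > 0"
  shows "(LINT s|lborel. indicator {0..} s * exp (- (\<sigma>\<^sup>2 * s\<^sup>2 / 2))) = sqrt (pi / 2) / \<sigma>"
proof -
  have c: "sqrt 2 / \<sigma> \<noteq> 0" using assms by simp
  have "(LINT s|lborel. indicator {0..} s * exp (- (\<sigma>\<^sup>2 * s\<^sup>2 / 2))) =
    \<bar>sqrt 2 / \<sigma>\<bar> *\<^sub>R (LINT u|lborel. indicator {0..} (0 + sqrt 2 / \<sigma> * u) * exp (- (\<sigma>\<^sup>2 * (0 + sqrt 2 / \<sigma> * u)\<^sup>2 / 2)))"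
    by (rule lborel_integral_real_affine[OF c])
  also have "(\<lambda>u. indicator {0..} (0 + sqrt 2 / \<sigma> * u) * exp (- (\<sigma>\<^sup>2 * (0 + sqrt 2 / \<sigma> * u)\<^sup>2 / 2))) =
      (\<lambda>u. indicator {0..} u *\<^sub>R exp (- u\<^sup>2))"
  proof
    fix u :: real
    have "(0 + sqrt 2 / \<sigma> * u \<in> {0..}) = (u \<in> {0..})"
      using assms by (simp add: zero_le_mult_iff zero_le_divide_iff)
    moreover have "\<sigma>\<^sup>2 * (0 + sqrt 2 / \<sigma> * u)\<^sup>2 / 2 = u\<^sup>2"
      using assms by (simp add: power_mult_distrib power_divide)
    ultimately show "indicator {0..} (0 + sqrt 2 / \<sigma> * u) * exp (- (\<sigma>\<^sup>2 * (0 + sqrt 2 / \<sigma> * u)\<^sup>2 / 2)) =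
      indicator {0..} u *\<^sub>R exp (- u\<^sup>2)"
      by (simp only: indicator_def) simp
  qed
  also have "(LINT u|lborel. indicator {0..} u *\<^sub>R exp (- u\<^sup>2)) = sqrt pi / 2"
    by (rule has_bochner_integral_integral_eq[OF gaussian_moment_0])
  also have "\<bar>sqrt 2 / \<sigma>\<bar> *\<^sub>R (sqrt pi / 2) = sqrt (pi / 2) / \<sigma>"
    using assms by (simp add: real_sqrt_divide field_simps)
  finally show ?thesis .
qed

lemma triangle_integral_bound:
  fixes f :: "real \<Rightarrow> real"
  assumes A: "A > 0" and r: "r > 0" and K: "K \<ge> 0"
    and f: "\<And>t. 0 \<le> t \<Longrightarrow> t \<le> A \<Longrightarrow> \<bar>f t\<bar> \<le> K * exp (- (r * t))"
  shows "\<bar>r * (LBINT t:{0..A}. (1 - t / A) * f t)\<bar> \<le> K"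
proof -
  let ?g = "\<lambda>t. K * exp (- (r * t)) * indicator {0..A} t"
  have "\<bar>LBINT t:{0..A}. (1 - t / A) * f t\<bar> \<le> (LINT t|lborel. ?g t)"
    unfolding set_lebesgue_integral_def
  proof (rule order_trans[OF integral_abs_bound], rule integral_mono_AE')
    have "set_integrable lborel {0..A} (\<lambda>t. K * exp (- (r * t)))"
      by (rule borel_integrable_atLeastAtMost') (intro continuous_intros)
    then show "integrable lborel ?g" by (simp add: set_integrable_def mult.commute)
    show "AE t in lborel. \<bar>indicat_real {0..A} t *\<^sub>R ((1 - t / A) * f t)\<bar> \<le> ?g t"
    proof (rule AE_I2)
      fix t
      show "\<bar>indicat_real {0..A} t *\<^sub>R ((1 - t / A) * f t)\<bar> \<le> ?g t"
      proof (cases "t \<in> {0..A}")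
        case True
        then have "\<bar>1 - t / A\<bar> \<le> 1" using A by (auto simp: abs_le_iff)
        then have "\<bar>1 - t / A\<bar> * \<bar>f t\<bar> \<le> 1 * (K * exp (- (r * t)))"
          using True f[of t] by (intro mult_mono) auto
        then show ?thesis using True by (simp add: abs_mult)
      qed simp
    qed
    show "AE t in lborel. 0 \<le> ?g t" using K by simp
  qed
  also have "(LINT t|lborel. ?g t) = - K / r * exp (- (r * A)) - (- K / r * exp (- (r * 0)))"
    by (rule integral_FTC_Icc_real) (use A r in \<open>auto intro!: derivative_eq_intros continuous_intros\<close>)
  also have "\<dots> \<le> K / r" using K r by simp
  finally have "r * \<bar>LBINT t:{0..A}. (1 - t / A) * f t\<bar> \<le> r * (K / r)"
    using r by (intro mult_left_mono) auto
  then show ?thesis using r by (simp add: abs_mult)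
qed

lemma quadratic_exp_bound:
  fixes c s k :: real
  assumes "c > 0"
  shows "k * s - c * s\<^sup>2 \<le> k\<^sup>2 / (4 * c)"
proof -
  have "0 \<le> (2 * c * s - k)\<^sup>2 / (4 * c)" using assms by simp
  also have "\<dots> = k\<^sup>2 / (4 * c) - (k * s - c * s\<^sup>2)"
    using assms by (simp add: field_simps power2_eq_square)
  finally show ?thesis by simp
qed

context centred_law
begin

text \<open>The local limit theorem for the reference law itself, smoothed and at the origin: rescale the Fourier
  integral by \<open>sqrt m\<close> and pass to the limit under the integral sign.\<close>

lemma smooth_limit:
  assumes A: "A > 0"
  shows "(\<lambda>m. sqrt (real m) * (LINT s|cpow \<mu> m. fejer A (0 - s))) \<longlonglongrightarrow> 1 / (\<sigma> * sqrt (2 * pi))"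
proof -
  obtain c where c: "c > 0" "\<And>t. \<bar>t\<bar> \<le> A \<Longrightarrow> cmod (char \<mu> t) \<le> 1 - c * t\<^sup>2"
    using char_decay[OF A] by blast
  define F where "F m s = indicator {0..A * sqrt (real m)} s *
     ((1 - s / (A * sqrt (real m))) * Re (char \<mu> (s / sqrt (real m)) ^ m))" for m s
  have eq: "sqrt (real m) * (LINT s|cpow \<mu> m. fejer A (0 - s)) = (LINT s|lborel. F m s) / pi"
    if m: "m > 0" for m
  proof -
    interpret N: step_law "cpow \<mu> m" by (rule step_law_cpow)
    have "(LINT s|lborel. F m s) = \<bar>sqrt (real m)\<bar> *\<^sub>R (LINT t|lborel. F m (0 + sqrt (real m) * t))"
      by (rule lborel_integral_real_affine) (use m in auto)
    also have "(\<lambda>t. F m (0 + sqrt (real m) * t)) =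
      (\<lambda>t. indicator {0..A} t *\<^sub>R ((1 - t / A) * Re (iexp (- t * 0) * char (cpow \<mu> m) t)))"
    proof
      fix t
      have "(0 + sqrt (real m) * t \<in> {0..A * sqrt (real m)}) = (t \<in> {0..A})"
        using m by (simp add: mult.commute[of A] zero_le_mult_iff)
      then show "F m (0 + sqrt (real m) * t) =
        indicator {0..A} t *\<^sub>R ((1 - t / A) * Re (iexp (- t * 0) * char (cpow \<mu> m) t))"
        using m A unfolding F_def char_cpow by (simp only: indicator_def) (simp add: field_simps)
    qed
    finally show ?thesis
      unfolding N.integral_fejer_char[OF A] set_lebesgue_integral_def by simp
  qed
  have "(\<lambda>m. LINT s|lborel. F m s) \<longlonglongrightarrow> (LINT s|lborel. indicator {0..} s * exp (- (\<sigma>\<^sup>2 * s\<^sup>2 / 2)))"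
  proof (rule integral_dominated_convergence[where w = "\<lambda>s. exp (1 / (4 * c)) * (exp (- s) * indicator {0..} s)"])
    show "(\<lambda>s. indicator {0..} s * exp (- (\<sigma>\<^sup>2 * s\<^sup>2 / 2))) \<in> borel_measurable lborel" by measurable
    show "F m \<in> borel_measurable lborel" for m unfolding F_def by measurable
    have "integrable lborel (\<lambda>s. exp (- s) * indicator {0::real..} s)"
      using has_bochner_integral_I0i_power_exp_m'[of 0] by (simp add: has_bochner_integral_iff)
    then show "integrable lborel (\<lambda>s. exp (1 / (4 * c)) * (exp (- s) * indicator {0..} s))"
      by (rule integrable_mult_right)
    show "AE s in lborel. (\<lambda>m. F m s) \<longlonglongrightarrow> indicator {0..} s * exp (- (\<sigma>\<^sup>2 * s\<^sup>2 / 2))"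
    proof (rule AE_I2)
      fix s :: real
      show "(\<lambda>m. F m s) \<longlonglongrightarrow> indicator {0..} s * exp (- (\<sigma>\<^sup>2 * s\<^sup>2 / 2))"
      proof (cases "s \<ge> 0")
        case True
        have "filterlim (\<lambda>m. A * sqrt (real m)) at_top sequentially"
          using A by real_asymp
        then have "\<forall>\<^sub>F m in sequentially. s \<le> A * sqrt (real m)"
          unfolding filterlim_at_top by blast
        then have ev: "\<forall>\<^sub>F m in sequentially. (1 - s / (A * sqrt (real m))) * Re (char \<mu> (s / sqrt (real m)) ^ m) = F m s"
          by eventually_elim (use True in \<open>simp add: F_def\<close>)
        have "(\<lambda>m. 1 - s / (A * sqrt (real m))) \<longlonglongrightarrow> 1" using A by real_asymp
        then have "(\<lambda>m. (1 - s / (A * sqrt (real m))) * Re (char \<mu> (s / sqrt (real m)) ^ m)) \<longlonglongrightarrow>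
          1 * Re (complex_of_real (exp (- (\<sigma>\<^sup>2 * s\<^sup>2 / 2))))"
          by (intro tendsto_mult tendsto_Re char_power_tendsto)
        then show ?thesis using True by (simp add: Lim_transform_eventually[OF _ ev])
      next
        case False
        then have "F m s = 0" for m by (simp add: F_def)
        then show ?thesis using False by simp
      qed
    qed
    show "AE s in lborel. norm (F m s) \<le> exp (1 / (4 * c)) * (exp (- s) * indicator {0..} s)" for m
    proof (rule AE_I2)
      fix s :: real
      show "norm (F m s) \<le> exp (1 / (4 * c)) * (exp (- s) * indicator {0..} s)"
      proof (cases "s \<in> {0..A * sqrt (real m)} \<and> m > 0")
        case True
        then have s: "0 \<le> s" "s \<le> A * sqrt (real m)" and m: "m > 0" by auto
        let ?t = "s / sqrt (real m)"
        have t: "\<bar>?t\<bar> \<le> A" "s / (A * sqrt (real m)) \<le> 1" using s m A by (simp_all add: field_simps)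
        have "cmod (char \<mu> ?t) \<le> 1 - c * ?t\<^sup>2" by (rule c(2)[OF t(1)])
        also have "\<dots> \<le> exp (- c * ?t\<^sup>2)" using exp_ge_add_one_self[of "- c * ?t\<^sup>2"] by simp
        finally have "cmod (char \<mu> ?t) ^ m \<le> exp (- c * ?t\<^sup>2) ^ m" by (intro power_mono) auto
        also have "\<dots> = exp (- c * s\<^sup>2)"
          using m by (simp add: exp_of_nat_mult[symmetric] power_divide)
        also have "\<dots> = exp (1 * s - c * s\<^sup>2) * exp (- s)" by (simp add: exp_add[symmetric])
        also have "\<dots> \<le> exp (1\<^sup>2 / (4 * c)) * exp (- s)"
          using quadratic_exp_bound[OF c(1), of 1 s] by simp
        finally have 1: "cmod (char \<mu> ?t ^ m) \<le> exp (1 / (4 * c)) * exp (- s)" by (simp add: norm_power)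
        have "\<bar>1 - s / (A * sqrt (real m))\<bar> * \<bar>Re (char \<mu> ?t ^ m)\<bar> \<le> 1 * cmod (char \<mu> ?t ^ m)"
          using t(2) s A by (intro mult_mono abs_Re_le_cmod) (auto simp: abs_le_iff)
        then show ?thesis using 1 s by (simp add: F_def abs_mult)
      next
        case False
        then show ?thesis using c(1) by (auto simp: F_def indicator_def)
      qed
    qed
  qed
  then have "(\<lambda>m. (LINT s|lborel. F m s) / pi) \<longlonglongrightarrow> sqrt (pi / 2) / \<sigma> / pi"
    unfolding gauss_half_line[OF \<sigma>_pos] by (intro tendsto_intros) auto
  moreover have "sqrt (pi / 2) / \<sigma> / pi = 1 / (\<sigma> * sqrt (2 * pi))"
  proof -
    have "sqrt (pi / 2) * sqrt (2 * pi) = sqrt (pi\<^sup>2)" by (simp add: real_sqrt_mult[symmetric] power2_eq_square)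
    then have "sqrt (pi / 2) * sqrt (2 * pi) = pi" by simp
    then show ?thesis using \<sigma>_pos by (simp add: field_simps)
  qed
  moreover have "\<forall>\<^sub>F m in sequentially. (LINT s|lborel. F m s) / pi = sqrt (real m) * (LINT s|cpow \<mu> m. fejer A (0 - s))"
    using eventually_gt_at_top[of 0] by eventually_elim (rule eq[symmetric])
  ultimately show ?thesis by (simp add: Lim_transform_eventually)
qed

text \<open>Closeness on the Fourier side of a law \<open>\<rho>\<close> to the reference law shifted by \<open>a\<close>. The two terms of the
  tolerance are a relative error in the second moment and an error of order \<open>1 / sqrt m\<close> in the mean: after
  m steps both are small in comparison with the Gaussian limit.\<close>

definition char_close :: "real measure \<Rightarrow> real \<Rightarrow> real \<Rightarrow> nat \<Rightarrow> real \<Rightarrow> bool" where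
  "char_close \<rho> A \<theta> m a \<longleftrightarrow> (\<forall>t\<in>{0..A}. cmod (char \<rho> t - iexp (t * a) * char \<mu> t) \<le> \<theta> * (t\<^sup>2 + t / sqrt (real m)))"

lemma char_close_decay:
  assumes c: "c > 0" "\<And>t. \<bar>t\<bar> \<le> A \<Longrightarrow> cmod (char \<mu> t) \<le> 1 - c * t\<^sup>2"
    and \<theta>: "\<theta> \<le> 1" "\<theta> \<le> c / 2" and close: "char_close \<rho> A \<theta> m a" and t: "0 \<le> t" "t \<le> A"
  shows "cmod (char \<rho> t) \<le> exp (- (c / 2) * t\<^sup>2 + t / sqrt (real m))"
proof -
  have "cmod (char \<rho> t) \<le> cmod (iexp (t * a) * char \<mu> t) + cmod (char \<rho> t - iexp (t * a) * char \<mu> t)"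
    using norm_triangle_ineq[of "iexp (t * a) * char \<mu> t" "char \<rho> t - iexp (t * a) * char \<mu> t"] by simp
  also have "cmod (iexp (t * a) * char \<mu> t) = cmod (char \<mu> t)" by (simp add: norm_mult)
  also have "cmod (char \<rho> t - iexp (t * a) * char \<mu> t) \<le> \<theta> * (t\<^sup>2 + t / sqrt (real m))"
    using close t by (auto simp: char_close_def)
  also have "cmod (char \<mu> t) \<le> 1 - c * t\<^sup>2" using c(2) t by simp
  also have "\<theta> * (t\<^sup>2 + t / sqrt (real m)) \<le> c / 2 * t\<^sup>2 + 1 * (t / sqrt (real m))"
    unfolding distrib_left using t \<theta> by (intro add_mono mult_right_mono) auto
  finally have "cmod (char \<rho> t) \<le> 1 + (- (c / 2) * t\<^sup>2 + t / sqrt (real m))" by simp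
  also have "\<dots> \<le> exp (- (c / 2) * t\<^sup>2 + t / sqrt (real m))" by (rule exp_ge_add_one_self)
  finally show ?thesis .
qed

lemma fejer_uniform_bound:
  assumes A: "A > 0"
  obtains K \<theta> where "K > 0" "\<theta> > 0"
    "\<And>\<rho> m a v. step_law \<rho> \<Longrightarrow> m > 0 \<Longrightarrow> char_close \<rho> A \<theta> m a \<Longrightarrow>
       sqrt (real m) * (LINT s|cpow \<rho> m. fejer A (v - s)) \<le> K"
proof -
  obtain c where c: "c > 0" "\<And>t. \<bar>t\<bar> \<le> A \<Longrightarrow> cmod (char \<mu> t) \<le> 1 - c * t\<^sup>2"
    using char_decay[OF A] by blast
  define K where "K = exp (2\<^sup>2 / (4 * (c / 2)))"
  define \<theta> where "\<theta> = min 1 (c / 2)"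
  show ?thesis
  proof (rule that[of K \<theta>])
    fix \<rho> m a v
    assume \<rho>: "step_law \<rho>" and m: "m > (0::nat)" and close: "char_close \<rho> A \<theta> m a"
    interpret R: step_law \<rho> by fact
    interpret N: step_law "cpow \<rho> m" by (rule R.step_law_cpow)
    have "\<bar>sqrt (real m) * (LBINT t:{0..A}. (1 - t / A) * Re (iexp (- t * v) * char (cpow \<rho> m) t))\<bar> \<le> K"
    proof (rule triangle_integral_bound[OF A])
      fix t assume t: "0 \<le> t" "t \<le> A"
      define s where "s = sqrt (real m) * t"
      have "\<bar>Re (iexp (- t * v) * char (cpow \<rho> m) t)\<bar> \<le> cmod (iexp (- t * v) * char (cpow \<rho> m) t)"
        by (rule abs_Re_le_cmod)
      also have "\<dots> = cmod (char \<rho> t) ^ m" by (simp add: norm_mult norm_power R.char_cpow)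
      also have "\<dots> \<le> exp (- (c / 2) * t\<^sup>2 + t / sqrt (real m)) ^ m"
        by (intro power_mono char_close_decay[OF c _ _ close t]) (auto simp: \<theta>_def)
      also have "\<dots> = exp (s - c / 2 * s\<^sup>2)"
        using m by (simp add: exp_of_nat_mult[symmetric] s_def field_simps power_mult_distrib real_div_sqrt)
      also have "\<dots> = exp (2 * s - c / 2 * s\<^sup>2) * exp (- s)" by (simp add: exp_add[symmetric])
      also have "\<dots> \<le> K * exp (- s)"
        unfolding K_def using quadratic_exp_bound[of "c / 2" 2 s] c by simp
      finally show "\<bar>Re (iexp (- t * v) * char (cpow \<rho> m) t)\<bar> \<le> K * exp (- (sqrt (real m) * t))"
        by (simp add: s_def)
    qed (use m in \<open>auto simp: K_def\<close>)
    then have "sqrt (real m) * (LBINT t:{0..A}. (1 - t / A) * Re (iexp (- t * v) * char (cpow \<rho> m) t)) / pi \<le> K / 1"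
      using pi_gt3 by (intro frac_le) (auto simp: K_def)
    then show "sqrt (real m) * (LINT s|cpow \<rho> m. fejer A (v - s)) \<le> K"
      unfolding N.integral_fejer_char[OF A] by simp
  qed (use c in \<open>auto simp: K_def \<theta>_def\<close>)
qed

text \<open>For a law close to a shift of the reference law, the smoothed density after m steps differs from
  that of the reference walk at the origin by a multiple of the tolerance, uniformly in all parameters.\<close>

lemma fejer_compare:
  assumes A: "A > 0"
  obtains K \<theta>\<^sub>0 where "K > 0" "\<theta>\<^sub>0 > 0"
    "\<And>\<rho> \<theta> m a v. step_law \<rho> \<Longrightarrow> m > 0 \<Longrightarrow> 0 < \<theta> \<Longrightarrow> \<theta> \<le> \<theta>\<^sub>0 \<Longrightarrow> char_close \<rho> A \<theta> m a \<Longrightarrow>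
       \<bar>v - real m * a\<bar> \<le> \<theta> * sqrt (real m) \<Longrightarrow>
       \<bar>sqrt (real m) * (LINT s|cpow \<rho> m. fejer A (v - s)) - sqrt (real m) * (LINT s|cpow \<mu> m. fejer A (0 - s))\<bar> \<le> \<theta> * K"
proof -
  obtain c where c: "c > 0" "\<And>t. \<bar>t\<bar> \<le> A \<Longrightarrow> cmod (char \<mu> t) \<le> 1 - c * t\<^sup>2"
    using char_decay[OF A] by blast
  define K where "K = exp (c / 2 * A\<^sup>2) * 3 * exp (3\<^sup>2 / (4 * (c / 2))) + exp (2\<^sup>2 / (4 * c))"
  define \<theta>\<^sub>0 where "\<theta>\<^sub>0 = min 1 (c / 2)"
  have K: "K > 0" by (auto simp: K_def intro!: add_pos_pos)
  show ?thesis
  proof (rule that[of K \<theta>\<^sub>0])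
    fix \<rho> \<theta> m a v
    assume \<rho>: "step_law \<rho>" and m: "m > (0::nat)" and \<theta>: "0 < \<theta>" "\<theta> \<le> \<theta>\<^sub>0"
      and close: "char_close \<rho> A \<theta> m a" and v: "\<bar>v - real m * a\<bar> \<le> \<theta> * sqrt (real m)"
    have \<theta>': "\<theta> \<le> 1" "\<theta> \<le> c / 2" using \<theta> by (auto simp: \<theta>\<^sub>0_def)
    interpret R: step_law \<rho> by fact
    interpret N: step_law "cpow \<rho> m" by (rule R.step_law_cpow)
    interpret N0: step_law "cpow \<mu> m" by (rule step_law_cpow)
    let ?f = "\<lambda>t. Re (iexp (- t * v) * char (cpow \<rho> m) t) - Re (iexp (- t * 0) * char (cpow \<mu> m) t)"
    have "\<bar>sqrt (real m) * (LBINT t:{0..A}. (1 - t / A) * ?f t)\<bar> \<le> \<theta> * K"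
    proof (rule triangle_integral_bound[OF A])
      fix t assume t: "0 \<le> t" "t \<le> A"
      define s where "s = sqrt (real m) * t"
      have s: "s \<ge> 0" using t by (simp add: s_def)
      define z where "z = char \<rho> t"
      define w where "w = iexp (t * a) * char \<mu> t"
      define B where "B = exp (- (c / 2) * t\<^sup>2 + t / sqrt (real m))"
      have B: "B > 0" by (simp add: B_def)
      have Bm: "B ^ m = exp (s - c / 2 * s\<^sup>2)"
        unfolding B_def using m
        by (simp add: exp_of_nat_mult[symmetric] s_def field_simps power_mult_distrib real_div_sqrt)
      have muc: "cmod (char \<mu> t) \<le> exp (- c * t\<^sup>2)"
        using c(2)[of t] t exp_ge_add_one_self[of "- c * t\<^sup>2"] by simp
      have zB: "cmod z \<le> B"
        unfolding z_def B_def by (rule char_close_decay[OF c \<theta>' close t])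
      have "- c * t\<^sup>2 \<le> - (c / 2) * t\<^sup>2 + t / sqrt (real m)"
      proof -
        have "0 \<le> c / 2 * t\<^sup>2 + t / sqrt (real m)" using c(1) t by (intro add_nonneg_nonneg) auto
        then show ?thesis by simp
      qed
      then have wB: "cmod w \<le> B"
        using muc unfolding w_def B_def norm_mult by (simp add: order_trans)
      have zw: "cmod (z - w) \<le> \<theta> * (t\<^sup>2 + t / sqrt (real m))"
        using close t by (auto simp: char_close_def z_def w_def)
      \<comment> \<open>dividing by the common bound B reduces the telescoping estimate to numbers of modulus at most one\<close>
      have "cmod ((z / B) ^ m - (w / B) ^ m) \<le> m * cmod (z / B - w / B)"
        by (rule norm_power_diff) (use zB wB B in \<open>auto simp: norm_divide\<close>)
      then have "cmod (z ^ m - w ^ m) / B ^ m \<le> m * (cmod (z - w) / B)"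
        using B by (simp add: power_divide diff_divide_distrib[symmetric] norm_divide norm_power)
      then have "cmod (z ^ m - w ^ m) \<le> m * (cmod (z - w) / B) * B ^ m"
        using B by (simp add: divide_le_eq)
      also have "\<dots> \<le> m * (\<theta> * (t\<^sup>2 + t / sqrt (real m)) / B) * B ^ m"
        using B zw by (intro mult_right_mono mult_left_mono divide_right_mono) auto
      also have "\<dots> = \<theta> * (s\<^sup>2 + s) * (1 / B) * exp (s - c / 2 * s\<^sup>2)"
      proof -
        have "real m * (t / sqrt (real m)) = t * (real m / sqrt (real m))" by simp
        also have "\<dots> = s" by (subst real_div_sqrt) (simp_all add: s_def mult.commute)
        finally have *: "real m * (t\<^sup>2 + t / sqrt (real m)) = s\<^sup>2 + s"
          by (simp add: distrib_left s_def power_mult_distrib)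
        have "m * (\<theta> * (t\<^sup>2 + t / sqrt (real m)) / B) * B ^ m =
          \<theta> * (real m * (t\<^sup>2 + t / sqrt (real m))) * (1 / B) * B ^ m" by simp
        then show ?thesis unfolding * Bm .
      qed
      also have "\<dots> \<le> \<theta> * (3 * exp s) * exp (c / 2 * A\<^sup>2) * exp (s - c / 2 * s\<^sup>2)"
      proof (intro mult_right_mono mult_mono)
        have "1 + s + s\<^sup>2 / 2 \<le> exp s" by (rule exp_lower_Taylor_quadratic[OF s])
        then show "s\<^sup>2 + s \<le> 3 * exp s" using s zero_le_power2[of s] by linarith
        have "1 / B = exp (c / 2 * t\<^sup>2 - t / sqrt (real m))" by (simp add: B_def exp_minus[symmetric] inverse_eq_divide[symmetric])
        also have "\<dots> \<le> exp (c / 2 * A\<^sup>2)"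
        proof -
          have "c / 2 * t\<^sup>2 \<le> c / 2 * A\<^sup>2" using c t by (intro mult_left_mono power_mono) auto
          moreover have "0 \<le> t / sqrt (real m)" using t by simp
          ultimately show ?thesis by simp
        qed
        finally show "1 / B \<le> exp (c / 2 * A\<^sup>2)" .
      qed (use \<theta> B s in auto)
      also have "\<dots> = \<theta> * (exp (c / 2 * A\<^sup>2) * 3 * exp (3 * s - c / 2 * s\<^sup>2)) * exp (- s)"
        by (simp add: exp_add[symmetric] mult_ac)
      also have "\<dots> \<le> \<theta> * (exp (c / 2 * A\<^sup>2) * 3 * exp (3\<^sup>2 / (4 * (c / 2)))) * exp (- s)"
        using quadratic_exp_bound[of "c / 2" 3 s] c \<theta> by (intro mult_right_mono mult_left_mono) auto
      finally have first: "cmod (z ^ m - w ^ m) \<le> \<theta> * (exp (c / 2 * A\<^sup>2) * 3 * exp (3\<^sup>2 / (4 * (c / 2)))) * exp (- s)" .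
      have "iexp (- t * v) * w ^ m = iexp (- t * (v - real m * a)) * char \<mu> t ^ m"
        unfolding w_def power_mult_distrib exp_of_nat_mult[symmetric] mult.assoc[symmetric] exp_add[symmetric]
        by (simp add: algebra_simps)
      then have "cmod (iexp (- t * v) * w ^ m - char \<mu> t ^ m) = cmod (iexp (- t * (v - real m * a)) - 1) * cmod (char \<mu> t) ^ m"
        by (simp add: norm_mult[symmetric] norm_power[symmetric] algebra_simps)
      also have "\<dots> \<le> \<bar>- t * (v - real m * a)\<bar> * cmod (char \<mu> t) ^ m"
        using iexp_approx1[of "- t * (v - real m * a)" 0] by (intro mult_right_mono) auto
      also have "\<dots> \<le> (t * (\<theta> * sqrt (real m))) * exp (- c * t\<^sup>2) ^ m"
        using v muc t by (intro mult_mono power_mono) (auto simp: abs_mult intro!: mult_left_mono)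
      also have "\<dots> = \<theta> * s * exp (- c * s\<^sup>2)"
        by (simp add: exp_of_nat_mult[symmetric] s_def power_mult_distrib mult_ac)
      also have "\<dots> \<le> \<theta> * exp s * exp (- c * s\<^sup>2)"
        using \<theta> order_trans[OF less_imp_le[OF less_add_one[of s]] exp_ge_add_one_self[of s, unfolded add.commute[of 1]]] by (intro mult_right_mono mult_left_mono) auto
      also have "\<dots> = \<theta> * exp (2 * s - c * s\<^sup>2) * exp (- s)"
        by (simp add: exp_add[symmetric] mult.assoc)
      also have "\<dots> \<le> \<theta> * exp (2\<^sup>2 / (4 * c)) * exp (- s)"
        using quadratic_exp_bound[OF c(1), of 2 s] \<theta> by (intro mult_right_mono mult_left_mono) auto
      finally have second: "cmod (iexp (- t * v) * w ^ m - char \<mu> t ^ m) \<le> \<theta> * exp (2\<^sup>2 / (4 * c)) * exp (- s)" .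
      have "?f t = Re (iexp (- t * v) * (z ^ m - w ^ m) + (iexp (- t * v) * w ^ m - char \<mu> t ^ m))"
        by (simp add: z_def R.char_cpow char_cpow algebra_simps)
      then have "\<bar>?f t\<bar> \<le> cmod (iexp (- t * v) * (z ^ m - w ^ m) + (iexp (- t * v) * w ^ m - char \<mu> t ^ m))"
        by (simp only: abs_Re_le_cmod)
      also have "\<dots> \<le> cmod (iexp (- t * v) * (z ^ m - w ^ m)) + cmod (iexp (- t * v) * w ^ m - char \<mu> t ^ m)"
        by (rule norm_triangle_ineq)
      also have "cmod (iexp (- t * v) * (z ^ m - w ^ m)) = cmod (z ^ m - w ^ m)" by (simp add: norm_mult)
      finally show "\<bar>?f t\<bar> \<le> \<theta> * K * exp (- (sqrt (real m) * t))"
        using first second by (simp add: K_def s_def algebra_simps)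
    qed (use m \<theta> K in auto)
    then have "\<bar>sqrt (real m) * (LBINT t:{0..A}. (1 - t / A) * ?f t)\<bar> / pi \<le> \<theta> * K / 1"
      using pi_gt3 \<theta> K by (intro frac_le) auto
    moreover have "(LBINT t:{0..A}. (1 - t / A) * ?f t) =
      (LBINT t:{0..A}. (1 - t / A) * Re (iexp (- t * v) * char (cpow \<rho> m) t)) -
      (LBINT t:{0..A}. (1 - t / A) * Re (iexp (- t * 0) * char (cpow \<mu> m) t))"
    proof -
      have i: "set_integrable lborel {0..A} (\<lambda>t. (1 - t / A) * Re (iexp (- t * v) * char (cpow M m) t))"
        if "step_law M" for M v
      proof -
        interpret M: step_law M by fact
        have "isCont (char M) t" for t
          unfolding continuous_at_sequentially
        proof safe
          fix X assume X: "X \<longlonglongrightarrow> t"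
          show "(char M \<circ> X) \<longlonglongrightarrow> char M t"
            unfolding comp_def char_def
            by (rule integral_dominated_convergence[where w="\<lambda>_. 1"]) (auto intro!: tendsto_intros X)
        qed
        then have "continuous_on {0..A} (char M)" by (simp add: continuous_at_imp_continuous_on)
        then show ?thesis unfolding M.char_cpow
          by (intro borel_integrable_atLeastAtMost' continuous_intros) (use A in auto)
      qed
      show ?thesis
        unfolding right_diff_distrib
        by (rule set_integral_diff(2)[OF i[OF \<rho>] i[OF step_law_axioms]])
    qed
    ultimately show "\<bar>sqrt (real m) * (LINT s|cpow \<rho> m. fejer A (v - s)) - sqrt (real m) * (LINT s|cpow \<mu> m. fejer A (0 - s))\<bar> \<le> \<theta> * K"
      unfolding N.integral_fejer_char[OF A] N0.integral_fejer_char[OF A]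
      by (simp add: right_diff_distrib diff_divide_distrib abs_divide[symmetric] del: abs_divide)
        (simp add: abs_div_pos diff_divide_distrib)
  qed (use c K in \<open>auto simp: \<theta>\<^sub>0_def\<close>)
qed

lemma smooth_local_limit:
  assumes A: "A > 0" and e: "e > 0"
  obtains \<theta> where "\<theta> > 0"
    "\<forall>\<^sub>F m in sequentially. \<forall>\<rho> a v. step_law \<rho> \<longrightarrow> char_close \<rho> A \<theta> m a \<longrightarrow>
       \<bar>v - real m * a\<bar> \<le> \<theta> * sqrt (real m) \<longrightarrow>
       \<bar>sqrt (real m) * (LINT s|cpow \<rho> m. fejer A (v - s)) - 1 / (\<sigma> * sqrt (2 * pi))\<bar> \<le> e"
proof -
  obtain K \<theta>\<^sub>0 where K: "K > 0" "\<theta>\<^sub>0 > 0"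
    "\<And>\<rho> \<theta> m a v. step_law \<rho> \<Longrightarrow> m > 0 \<Longrightarrow> 0 < \<theta> \<Longrightarrow> \<theta> \<le> \<theta>\<^sub>0 \<Longrightarrow> char_close \<rho> A \<theta> m a \<Longrightarrow>
       \<bar>v - real m * a\<bar> \<le> \<theta> * sqrt (real m) \<Longrightarrow>
       \<bar>sqrt (real m) * (LINT s|cpow \<rho> m. fejer A (v - s)) - sqrt (real m) * (LINT s|cpow \<mu> m. fejer A (0 - s))\<bar> \<le> \<theta> * K"
    using fejer_compare[OF A] by blast
  define \<theta> where "\<theta> = min \<theta>\<^sub>0 (e / 2 / K)"
  have \<theta>: "\<theta> > 0" "\<theta> \<le> \<theta>\<^sub>0" "\<theta> * K \<le> e / 2" using K e by (auto simp: \<theta>_def min_def field_simps)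
  have "\<forall>\<^sub>F m in sequentially. dist (sqrt (real m) * (LINT s|cpow \<mu> m. fejer A (0 - s))) (1 / (\<sigma> * sqrt (2 * pi))) < e / 2"
    using smooth_limit[OF A] by (rule tendstoD) (use e in simp)
  then have "\<forall>\<^sub>F m in sequentially. \<forall>\<rho> a v. step_law \<rho> \<longrightarrow> char_close \<rho> A \<theta> m a \<longrightarrow>
       \<bar>v - real m * a\<bar> \<le> \<theta> * sqrt (real m) \<longrightarrow>
       \<bar>sqrt (real m) * (LINT s|cpow \<rho> m. fejer A (v - s)) - 1 / (\<sigma> * sqrt (2 * pi))\<bar> \<le> e"
    using eventually_gt_at_top[of 0]
  proof eventually_elim
    case (elim m)
    show ?case
    proof (intro allI impI)
      fix \<rho> a v assume "step_law \<rho>" "char_close \<rho> A \<theta> m a" "\<bar>v - real m * a\<bar> \<le> \<theta> * sqrt (real m)"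
      from K(3)[OF this(1) elim(2) \<theta>(1,2) this(2,3)] elim(1) \<theta>(3)
      show "\<bar>sqrt (real m) * (LINT s|cpow \<rho> m. fejer A (v - s)) - 1 / (\<sigma> * sqrt (2 * pi))\<bar> \<le> e"
        unfolding dist_real_def by linarith
    qed
  qed
  then show ?thesis using that \<theta> by blast
qed

end

section \<open>From smoothed to sharp intervals\<close>

lemma set_integrable_const_Icc: "set_integrable lborel {a..b :: real} (\<lambda>v. M :: real)"
  by (rule borel_integrable_atLeastAtMost') simp

context step_law
begin

lemma smoothed_set_integrable:
  assumes A: "A > 0"
  shows "set_integrable lborel {a..b} (\<lambda>v. LINT s|\<nu>. fejer A (v - s))"
  unfolding set_integrable_def
proof (rule integrableI_bounded_set_indicator[where B = "A / (2 * pi)"])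
  show "(\<lambda>v. LINT s|\<nu>. fejer A (v - s)) \<in> borel_measurable lborel" by measurable
  show "emeasure lborel {a..b} < \<infinity>" by (auto simp: emeasure_lborel_Icc_eq)
  show "AE v in lborel. v \<in> {a..b} \<longrightarrow> norm (LINT s|\<nu>. fejer A (v - s)) \<le> A / (2 * pi)"
  proof (intro AE_I2 impI)
    fix v
    have "0 \<le> (LINT s|\<nu>. fejer A (v - s))" by (simp add: fejer_nonneg A integral_nonneg_AE)
    moreover have "(LINT s|\<nu>. fejer A (v - s)) \<le> A / (2 * pi)"
      by (rule integral_le_const[OF fejer_le[OF A]]) (use A in auto)
    ultimately show "norm (LINT s|\<nu>. fejer A (v - s)) \<le> A / (2 * pi)" by simp
  qed
qed simp

lemma integrable_fejer_prim_diff: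
  assumes A: "A > 0"
  shows "integrable \<nu> (\<lambda>s. fejer_prim A (b - s) - fejer_prim A (a - s))"
proof (rule integrable_bounded[of _ 1])
  have [measurable]: "fejer_prim A \<in> borel_measurable borel"
    by (rule borel_measurable_continuous_onI[OF continuous_on_fejer_prim])
  show "(\<lambda>s. fejer_prim A (b - s) - fejer_prim A (a - s)) \<in> borel_measurable borel" by measurable
  show "norm (fejer_prim A (b - s) - fejer_prim A (a - s)) \<le> 1" for s
    using fejer_prim_le_half[OF A, of "b - s"] fejer_prim_le_half[OF A, of "a - s"] by simp
qed

lemma fejer_Fubini:
  assumes A: "A > 0" and ab: "a \<le> b"
  shows "(LINT s|\<nu>. fejer_prim A (b - s) - fejer_prim A (a - s)) = (LBINT v:{a..b}. LINT s|\<nu>. fejer A (v - s))"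
proof -
  interpret P: pair_sigma_finite \<nu> lborel ..
  let ?g = "\<lambda>s v. indicator {a..b} v * fejer A (v - s)"
  have g: "(LINT v|lborel. ?g s v) = fejer_prim A (b - s) - fejer_prim A (a - s)" for s
    using fejer_integral[OF A ab, of s] by (simp add: set_lebesgue_integral_def)
  have int: "integrable (\<nu> \<Otimes>\<^sub>M lborel) (\<lambda>(s, v). ?g s v)"
  proof (rule P.Fubini_integrable)
    show "(\<lambda>(s, v). ?g s v) \<in> borel_measurable (\<nu> \<Otimes>\<^sub>M lborel)" by measurable
    have "integrable lborel (?g s)" for s
    proof -
      have "set_integrable lborel {a..b} (\<lambda>v. fejer A (v - s))"
        by (rule borel_integrable_atLeastAtMost', intro continuous_on_fejer continuous_intros)
      then show ?thesis by (simp add: set_integrable_def)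
    qed
    then show "AE s in \<nu>. integrable lborel (\<lambda>v. (case (s, v) of (s, v) \<Rightarrow> ?g s v))" by simp
    have "(LINT v|lborel. norm (case (s, v) of (s, v) \<Rightarrow> ?g s v)) = fejer_prim A (b - s) - fejer_prim A (a - s)" for s
      using fejer_nonneg[OF A] unfolding g[symmetric] by (simp add: abs_mult)
    moreover have "integrable \<nu> (\<lambda>s. fejer_prim A (b - s) - fejer_prim A (a - s))"
      by (rule integrable_fejer_prim_diff[OF A])
    ultimately show "integrable \<nu> (\<lambda>s. LINT v|lborel. norm (case (s, v) of (s, v) \<Rightarrow> ?g s v))" by simp
  qed
  have "(LINT s|\<nu>. fejer_prim A (b - s) - fejer_prim A (a - s)) = (LINT s|\<nu>. LINT v|lborel. ?g s v)"
    unfolding g ..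
  also have "\<dots> = (LINT v|lborel. LINT s|\<nu>. ?g s v)"
    using P.Fubini_integral[OF int] by simp
  also have "\<dots> = (LBINT v:{a..b}. LINT s|\<nu>. fejer A (v - s))"
    by (simp add: set_lebesgue_integral_def)
  finally show ?thesis .
qed

text \<open>Upper bound for the mass of an interval through a slightly larger smoothed one.\<close>

lemma interval_le_smoothed:
  assumes A: "A > 0" and r: "r \<ge> 0" and \<Delta>: "\<Delta> \<ge> 0"
    and W: "\<And>x. x \<ge> r \<Longrightarrow> fejer_prim A x \<ge> 1 / 2 - \<eta>"
    and M: "\<And>v. u - r \<le> v \<Longrightarrow> v \<le> u + \<Delta> + r \<Longrightarrow> (LINT s|\<nu>. fejer A (v - s)) \<le> M"
  shows "(1 - 2 * \<eta>) * measure \<nu> {u..u + \<Delta>} \<le> M * (\<Delta> + 2 * r)"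
proof -
  have ab: "u - r \<le> u + \<Delta> + r" using r \<Delta> by simp
  have "(1 - 2 * \<eta>) * measure \<nu> {u..u + \<Delta>} = (LINT s|\<nu>. (1 - 2 * \<eta>) * indicator {u..u + \<Delta>} s)"
    by simp
  also have "\<dots> \<le> (LINT s|\<nu>. fejer_prim A (u + \<Delta> + r - s) - fejer_prim A (u - r - s))"
  proof (rule integral_mono)
    show "integrable \<nu> (\<lambda>s. (1 - 2 * \<eta>) * indicator {u..u + \<Delta>} s)"
      by (intro integrable_mult_right integrable_bounded[of _ 1]) (auto simp: indicator_def)
    show "integrable \<nu> (\<lambda>s. fejer_prim A (u + \<Delta> + r - s) - fejer_prim A (u - r - s))"
      by (rule integrable_fejer_prim_diff[OF A])
    fix s
    show "(1 - 2 * \<eta>) * indicator {u..u + \<Delta>} s \<le> fejer_prim A (u + \<Delta> + r - s) - fejer_prim A (u - r - s)"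
    proof (cases "s \<in> {u..u + \<Delta>}")
      case True
      then have "fejer_prim A (u + \<Delta> + r - s) \<ge> 1 / 2 - \<eta>" "fejer_prim A (- (u - r - s)) \<ge> 1 / 2 - \<eta>"
        by (intro W; simp)+
      then show ?thesis using True unfolding fejer_prim_minus by simp
    next
      case False
      then show ?thesis using fejer_prim_mono[OF A, of "u - r - s" "u + \<Delta> + r - s"] ab by simp
    qed
  qed
  also have "\<dots> = (LBINT v:{u - r..u + \<Delta> + r}. LINT s|\<nu>. fejer A (v - s))"
    by (rule fejer_Fubini[OF A ab])
  also have "\<dots> \<le> (LBINT v:{u - r..u + \<Delta> + r}. M)"
    by (rule set_integral_mono[OF smoothed_set_integrable[OF A] set_integrable_const_Icc]) (use M in auto)
  also have "\<dots> = M * (\<Delta> + 2 * r)"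
    using ab by (simp add: set_lebesgue_integral_def mult.commute)
  finally show ?thesis .
qed

text \<open>Lower bound through a slightly smaller smoothed interval; the tails of the kernel are
  dominated by kernels of unit width.\<close>

lemma smoothed_le_interval:
  assumes A: "A > 0" and r: "r > 0" and \<Delta>: "\<Delta> \<ge> 2 * r" and C: "C \<ge> 0"
    and far: "\<And>x. \<bar>x\<bar> \<ge> r \<Longrightarrow> fejer A x \<le> C * (fejer 1 x + fejer 1 (x + 1))"
    and M: "\<And>v. u + r \<le> v \<Longrightarrow> v \<le> u + \<Delta> - r \<Longrightarrow> M \<le> (LINT s|\<nu>. fejer A (v - s))"
    and K: "\<And>v. (LINT s|\<nu>. fejer 1 (v - s)) \<le> K" "K \<ge> 0"
  shows "M * (\<Delta> - 2 * r) \<le> measure \<nu> {u..u + \<Delta>} + C * (2 * K * \<Delta>)"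
proof -
  let ?a = "u + r" and ?b = "u + \<Delta> - r"
  have ab: "?a \<le> ?b" using \<Delta> by simp
  have "M * (\<Delta> - 2 * r) = (LBINT v:{?a..?b}. M)"
    using ab by (simp add: set_lebesgue_integral_def mult.commute)
  also have "\<dots> \<le> (LBINT v:{?a..?b}. LINT s|\<nu>. fejer A (v - s))"
    by (rule set_integral_mono[OF set_integrable_const_Icc smoothed_set_integrable[OF A]]) (use M in auto)
  also have "\<dots> = (LINT s|\<nu>. fejer_prim A (?b - s) - fejer_prim A (?a - s))"
    by (rule fejer_Fubini[OF A ab, symmetric])
  also have "\<dots> \<le> (LINT s|\<nu>. indicator {u..u + \<Delta>} s + C * ((fejer_prim 1 (?b - s) - fejer_prim 1 (?a - s)) +
      (fejer_prim 1 (?b + 1 - s) - fejer_prim 1 (?a + 1 - s))))"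
  proof (rule integral_mono)
    show "integrable \<nu> (\<lambda>s. fejer_prim A (?b - s) - fejer_prim A (?a - s))"
      by (rule integrable_fejer_prim_diff[OF A])
    show "integrable \<nu> (\<lambda>s. indicator {u..u + \<Delta>} s + C * ((fejer_prim 1 (?b - s) - fejer_prim 1 (?a - s)) +
      (fejer_prim 1 (?b + 1 - s) - fejer_prim 1 (?a + 1 - s))))"
      by (intro Bochner_Integration.integrable_add integrable_mult_right integrable_fejer_prim_diff
          integrable_bounded[of _ 1]) (auto simp: indicator_def)
    fix s
    have i: "set_integrable lborel {?a..?b} (\<lambda>v. fejer B (v + d - s))" for B d
      by (rule borel_integrable_atLeastAtMost', intro continuous_on_fejer continuous_intros)
    have s1: "(LBINT v:{?a..?b}. fejer 1 (v - s)) = fejer_prim 1 (?b - s) - fejer_prim 1 (?a - s)"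
      by (rule fejer_integral) (use ab in auto)
    have s2: "(LBINT v:{?a..?b}. fejer 1 (v + 1 - s)) = fejer_prim 1 (?b + 1 - s) - fejer_prim 1 (?a + 1 - s)"
      using fejer_integral[of 1 ?a ?b "s - 1"] ab by (simp add: algebra_simps)
    have nn: "0 \<le> fejer_prim 1 (?b - s) - fejer_prim 1 (?a - s)"
        "0 \<le> fejer_prim 1 (?b + 1 - s) - fejer_prim 1 (?a + 1 - s)"
      using fejer_prim_mono[of 1 "?a - s" "?b - s"] fejer_prim_mono[of 1 "?a + 1 - s" "?b + 1 - s"] ab by auto
    show "fejer_prim A (?b - s) - fejer_prim A (?a - s) \<le> indicator {u..u + \<Delta>} s +
      C * ((fejer_prim 1 (?b - s) - fejer_prim 1 (?a - s)) + (fejer_prim 1 (?b + 1 - s) - fejer_prim 1 (?a + 1 - s)))"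
    proof (cases "s \<in> {u..u + \<Delta>}")
      case True
      have "fejer_prim A (?b - s) - fejer_prim A (?a - s) \<le> 1"
        using fejer_prim_le_half[OF A, of "?b - s"] fejer_prim_le_half[OF A, of "?a - s"] by simp
      then show ?thesis using True C nn by (simp add: add_increasing2)
    next
      case False
      have "(LBINT v:{?a..?b}. fejer A (v - s)) \<le> (LBINT v:{?a..?b}. C * (fejer 1 (v - s) + fejer 1 (v + 1 - s)))"
      proof (rule set_integral_mono)
        show "set_integrable lborel {?a..?b} (\<lambda>v. fejer A (v - s))" using i[of A 0] by simp
        show "set_integrable lborel {?a..?b} (\<lambda>v. C * (fejer 1 (v - s) + fejer 1 (v + 1 - s)))"
          using i[of 1 0] i[of 1 1] by (intro set_integrable_mult_right set_integral_add(1)) auto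
        fix v assume v: "v \<in> {?a..?b}"
        then have "\<bar>v - s\<bar> \<ge> r" using False by auto
        then show "fejer A (v - s) \<le> C * (fejer 1 (v - s) + fejer 1 (v + 1 - s))"
          using far[of "v - s"] by (simp add: algebra_simps)
      qed
      also have "\<dots> = C * ((LBINT v:{?a..?b}. fejer 1 (v - s)) + (LBINT v:{?a..?b}. fejer 1 (v + 1 - s)))"
        using i[of 1 0] i[of 1 1] by (subst set_integral_add(2)[symmetric]) auto
      finally show ?thesis using False fejer_integral[OF A ab, of s] s1 s2 by simp
    qed
  qed
  also have "\<dots> = measure \<nu> {u..u + \<Delta>} + C * ((LINT s|\<nu>. fejer_prim 1 (?b - s) - fejer_prim 1 (?a - s)) +
      (LINT s|\<nu>. fejer_prim 1 (?b + 1 - s) - fejer_prim 1 (?a + 1 - s)))"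
  proof -
    have i1: "integrable \<nu> (\<lambda>s. indicator {u..u + \<Delta>} s :: real)"
      by (rule integrable_bounded[of _ 1]) (auto simp: indicator_def)
    have i2: "integrable \<nu> (\<lambda>s. fejer_prim 1 (b - s) - fejer_prim 1 (a - s))" for a b
      by (rule integrable_fejer_prim_diff) simp
    show ?thesis
      by (subst Bochner_Integration.integral_add[OF i1 integrable_mult_right[OF Bochner_Integration.integrable_add[OF i2 i2]]],
          subst integral_mult_right_zero, subst Bochner_Integration.integral_add[OF i2 i2]) simp
  qed
  also have "\<dots> \<le> measure \<nu> {u..u + \<Delta>} + C * (K * \<Delta> + K * \<Delta>)"
  proof (intro add_left_mono mult_left_mono add_mono C)
    have *: "(LINT s|\<nu>. fejer_prim 1 (b - s) - fejer_prim 1 (a - s)) \<le> K * \<Delta>"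
      if "a \<le> b" "b - a \<le> \<Delta>" for a b
    proof -
      have "(LINT s|\<nu>. fejer_prim 1 (b - s) - fejer_prim 1 (a - s)) = (LBINT v:{a..b}. LINT s|\<nu>. fejer 1 (v - s))"
        by (rule fejer_Fubini) (use that in auto)
      also have "\<dots> \<le> (LBINT v:{a..b}. K)"
        by (rule set_integral_mono[OF smoothed_set_integrable set_integrable_const_Icc]) (use K in auto)
      also have "\<dots> = K * (b - a)"
        using that by (simp add: set_lebesgue_integral_def mult.commute)
      also have "\<dots> \<le> K * \<Delta>" using that K by (intro mult_left_mono) auto
      finally show ?thesis .
    qed
    show "(LINT s|\<nu>. fejer_prim 1 (?b - s) - fejer_prim 1 (?a - s)) \<le> K * \<Delta>"
      by (rule *) (use ab r in auto)
    show "(LINT s|\<nu>. fejer_prim 1 (?b + 1 - s) - fejer_prim 1 (?a + 1 - s)) \<le> K * \<Delta>"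
      by (rule *) (use ab r in auto)
  qed
  finally show ?thesis by (simp add: algebra_simps)
qed

end

context centred_law
begin

lemma char_close_mono:
  "char_close \<rho> A \<theta> m a \<Longrightarrow> B \<le> A \<Longrightarrow> \<theta> \<le> \<theta>' \<Longrightarrow> char_close \<rho> B \<theta>' m a"
  unfolding char_close_def by (auto intro!: order_trans[OF _ mult_right_mono[of \<theta> \<theta>']])

text \<open>Concentration bound for the reference walk: an interval of length \<open>\<Delta>\<close> has mass of order \<open>(1 + \<Delta>) / sqrt m\<close>,
  wherever it lies.\<close>

lemma concentration:
  obtains K where "K > 0"
    "\<And>m u \<Delta>. m > 0 \<Longrightarrow> \<Delta> \<ge> 0 \<Longrightarrow> sqrt (real m) * measure (cpow \<mu> m) {u..u + \<Delta>} \<le> K * (1 + \<Delta>)"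
proof -
  obtain K \<theta> where K: "K > 0" "\<theta> > 0"
    "\<And>\<rho> m a v. step_law \<rho> \<Longrightarrow> m > 0 \<Longrightarrow> char_close \<rho> 1 \<theta> m a \<Longrightarrow>
       sqrt (real m) * (LINT s|cpow \<rho> m. fejer 1 (v - s)) \<le> K"
    using fejer_uniform_bound[of 1] by auto
  obtain R where R: "R > 0" "\<And>A x. A > 0 \<Longrightarrow> A * x \<ge> R \<Longrightarrow> fejer_prim A x \<ge> 1 / 2 - 1 / 4"
    using fejer_prim_ge[of "1 / 4"] by auto
  show ?thesis
  proof (rule that[of "2 * K * (1 + 2 * R)"])
    fix m :: nat and u \<Delta> :: real assume m: "m > 0" and \<Delta>: "\<Delta> \<ge> 0"
    interpret N: step_law "cpow \<mu> m" by (rule step_law_cpow)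
    have close: "char_close \<mu> 1 \<theta> m 0"
      using K by (simp add: char_close_def)
    have "(1 - 2 * (1 / 4)) * measure (cpow \<mu> m) {u..u + \<Delta>} \<le> K / sqrt (real m) * (\<Delta> + 2 * R)"
    proof (rule N.interval_le_smoothed[where A = 1])
      fix x assume "x \<ge> R" then show "1 / 2 - 1 / 4 \<le> fejer_prim 1 x" using R(2)[of 1 x] by simp
    next
      fix v
      show "(LINT s|cpow \<mu> m. fejer 1 (v - s)) \<le> K / sqrt (real m)"
        using K(3)[OF step_law_axioms m close, of v] m by (simp add: field_simps)
    qed (use R \<Delta> in auto)
    then have "sqrt (real m) * measure (cpow \<mu> m) {u..u + \<Delta>} \<le> 2 * K * (\<Delta> + 2 * R)"
      using m by (simp add: field_simps)
    also have "\<dots> \<le> 2 * K * ((1 + 2 * R) * (1 + \<Delta>))"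
      using K R \<Delta> by (intro mult_left_mono) (auto simp: algebra_simps)
    finally show "sqrt (real m) * measure (cpow \<mu> m) {u..u + \<Delta>} \<le> 2 * K * (1 + 2 * R) * (1 + \<Delta>)" by (simp add: mult.assoc)
  qed (use K R in auto)
qed

text \<open>The local limit theorem on intervals of length at least \<open>\<Delta>\<^sub>0\<close>, uniformly over all laws that are close
  to a shift of the reference law, and for intervals near the centre \<open>m a\<close>.\<close>

lemma interval_local_limit:
  assumes \<Delta>0: "\<Delta>\<^sub>0 > 0" and e: "e > 0"
  obtains A \<theta> where "A > 0" "\<theta> > 0"
    "\<forall>\<^sub>F m in sequentially. \<forall>\<rho> a u \<Delta>. step_law \<rho> \<longrightarrow> char_close \<rho> A \<theta> m a \<longrightarrow> \<Delta> \<ge> \<Delta>\<^sub>0 \<longrightarrow>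
       \<Delta> \<le> \<theta> * sqrt (real m) \<longrightarrow> \<bar>u - real m * a\<bar> \<le> \<theta> * sqrt (real m) \<longrightarrow>
       \<bar>sqrt (real m) * measure (cpow \<rho> m) {u..u + \<Delta>} - \<Delta> / (\<sigma> * sqrt (2 * pi))\<bar> \<le> e * \<Delta>"
proof -
  define c where "c = 1 / (\<sigma> * sqrt (2 * pi))"
  have c: "c > 0" using \<sigma>_pos by (simp add: c_def)
  define \<eta> where "\<eta> = min (1 / 4) (min c (e / (3 + 8 * c)))"
  have \<eta>: "\<eta> > 0" "\<eta> \<le> 1 / 4" "\<eta> \<le> c" "\<eta> * (3 + 8 * c) \<le> e"
  proof -
    have c8: "3 + 8 * c > 0" using c by simp
    show "\<eta> > 0" "\<eta> \<le> 1 / 4" "\<eta> \<le> c" using c c8 e by (auto simp: \<eta>_def min.coboundedI1 min.coboundedI2 simp del: divide_le_eq_numeral1 le_divide_eq_numeral1)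
    have "\<eta> \<le> e / (3 + 8 * c)" by (simp add: \<eta>_def)
    then show "\<eta> * (3 + 8 * c) \<le> e" using c8 by (simp add: pos_le_divide_eq)
  qed
  \<comment> \<open>enlarging or shrinking the interval by r changes its length by a relative amount of order \<open>\<eta>\<close>\<close>
  define r where "r = \<eta> * \<Delta>\<^sub>0"
  have r: "r > 0" using \<eta> \<Delta>0 by (simp add: r_def)
  obtain C where C: "C > 0"
    "\<And>A x. A > 0 \<Longrightarrow> \<bar>x\<bar> \<ge> r \<Longrightarrow> fejer A x \<le> C / A * (fejer 1 x + fejer 1 (x + 1))"
    using fejer_far[OF r] by blast
  obtain K \<theta>1 where K: "K > 0" "\<theta>1 > 0"
    "\<And>\<rho> m a v. step_law \<rho> \<Longrightarrow> m > 0 \<Longrightarrow> char_close \<rho> 1 \<theta>1 m a \<Longrightarrow>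
       sqrt (real m) * (LINT s|cpow \<rho> m. fejer 1 (v - s)) \<le> K"
    using fejer_uniform_bound[of 1] by auto
  obtain R where R: "R > 0" "\<And>A x. A > 0 \<Longrightarrow> A * x \<ge> R \<Longrightarrow> fejer_prim A x \<ge> 1 / 2 - \<eta>"
    using fejer_prim_ge[OF \<eta>(1)] by blast
  \<comment> \<open>at this scale the kernel has mass almost one within distance r, and its tail costs at most \<open>\<eta>\<close>\<close>
  define A where "A = max 1 (max (R / r) (2 * C * K / \<eta>))"
  have A: "A \<ge> 1" "A \<ge> R / r" "A \<ge> 2 * C * K / \<eta>" by (auto simp: A_def)
  then have A0: "A > 0" by simp
  have Ar: "A * r \<ge> R" using A(2) r by (simp add: field_simps)
  have AC: "C / A * (2 * K) \<le> \<eta>" using A(3) A0 \<eta>(1) by (simp add: field_simps)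
  obtain \<theta>2 where \<theta>2: "\<theta>2 > 0"
    "\<forall>\<^sub>F m in sequentially. \<forall>\<rho> a v. step_law \<rho> \<longrightarrow> char_close \<rho> A \<theta>2 m a \<longrightarrow>
       \<bar>v - real m * a\<bar> \<le> \<theta>2 * sqrt (real m) \<longrightarrow>
       \<bar>sqrt (real m) * (LINT s|cpow \<rho> m. fejer A (v - s)) - 1 / (\<sigma> * sqrt (2 * pi))\<bar> \<le> \<eta>"
    using smooth_local_limit[OF A0 \<eta>(1)] by blast
  define \<theta> where "\<theta> = min \<theta>1 (\<theta>2 / 3)"
  have \<theta>: "\<theta> > 0" "\<theta> \<le> \<theta>1" "3 * \<theta> \<le> \<theta>2" using K \<theta>2 by (auto simp: \<theta>_def)
  have "filterlim (\<lambda>m. \<theta> * sqrt (real m)) at_top sequentially" using \<theta> by real_asymp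
  then have "\<forall>\<^sub>F m in sequentially. r \<le> \<theta> * sqrt (real m)" unfolding filterlim_at_top by blast
  with \<theta>2(2) have "\<forall>\<^sub>F m in sequentially. \<forall>\<rho> a u \<Delta>. step_law \<rho> \<longrightarrow> char_close \<rho> A \<theta> m a \<longrightarrow> \<Delta> \<ge> \<Delta>\<^sub>0 \<longrightarrow>
       \<Delta> \<le> \<theta> * sqrt (real m) \<longrightarrow> \<bar>u - real m * a\<bar> \<le> \<theta> * sqrt (real m) \<longrightarrow>
       \<bar>sqrt (real m) * measure (cpow \<rho> m) {u..u + \<Delta>} - \<Delta> / (\<sigma> * sqrt (2 * pi))\<bar> \<le> e * \<Delta>"
    using eventually_gt_at_top[of 0]
  proof eventually_elim
    case (elim m)
    show ?case
    proof (intro allI impI)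
      fix \<rho> a u \<Delta>
      assume \<rho>: "step_law \<rho>" and close: "char_close \<rho> A \<theta> m a" and \<Delta>: "\<Delta> \<ge> \<Delta>\<^sub>0"
        "\<Delta> \<le> \<theta> * sqrt (real m)" and u: "\<bar>u - real m * a\<bar> \<le> \<theta> * sqrt (real m)"
      interpret R: step_law \<rho> by fact
      interpret N: step_law "cpow \<rho> m" by (rule R.step_law_cpow)
      have m: "m > 0" "sqrt (real m) > 0" using elim by auto
      have close1: "char_close \<rho> 1 \<theta>1 m a" using close A \<theta> by (auto intro: char_close_mono)
      have close2: "char_close \<rho> A \<theta>2 m a" using close A \<theta> by (auto intro: char_close_mono)
      have r\<Delta>: "r \<le> \<eta> * \<Delta>" using \<eta> \<Delta> by (simp add: r_def)
      have \<Delta>pos: "\<Delta> > 0" using \<Delta> \<Delta>0 by simp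
      have F: "\<bar>sqrt (real m) * (LINT s|cpow \<rho> m. fejer A (v - s)) - c\<bar> \<le> \<eta>"
        if "u - r \<le> v" "v \<le> u + \<Delta> + r" for v
      proof -
        have "\<bar>v - real m * a\<bar> \<le> 3 * \<theta> * sqrt (real m)"
          using that u \<Delta> elim by (simp add: abs_le_iff)
        also have "\<dots> \<le> \<theta>2 * sqrt (real m)" using \<theta> by (intro mult_right_mono) auto
        finally show ?thesis using elim \<rho> close2 by (simp add: c_def)
      qed
      have up: "(1 - 2 * \<eta>) * measure (cpow \<rho> m) {u..u + \<Delta>} \<le> (c + \<eta>) / sqrt (real m) * (\<Delta> + 2 * r)"
      proof (rule N.interval_le_smoothed[OF A0])
        fix x assume "x \<ge> r"
        then have "A * x \<ge> A * r" using A0 by simp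
        then show "1 / 2 - \<eta> \<le> fejer_prim A x" using R(2)[OF A0, of x] Ar by linarith
      next
        fix v assume "u - r \<le> v" "v \<le> u + \<Delta> + r"
        from F[OF this] have "sqrt (real m) * (LINT s|cpow \<rho> m. fejer A (v - s)) \<le> c + \<eta>" by linarith
        then show "(LINT s|cpow \<rho> m. fejer A (v - s)) \<le> (c + \<eta>) / sqrt (real m)"
          using m by (simp add: field_simps)
      qed (use r \<Delta>pos in auto)
      define p where "p = sqrt (real m) * measure (cpow \<rho> m) {u..u + \<Delta>}"
      have p0: "p \<ge> 0" by (simp add: p_def)
      have "(1 - 2 * \<eta>) * p = sqrt (real m) * ((1 - 2 * \<eta>) * measure (cpow \<rho> m) {u..u + \<Delta>})"
        by (simp add: p_def)
      also have "\<dots> \<le> sqrt (real m) * ((c + \<eta>) / sqrt (real m) * (\<Delta> + 2 * r))"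
        using up by (intro mult_left_mono) auto
      also have "\<dots> = (c + \<eta>) * (\<Delta> + 2 * r)" using m by simp
      also have "\<dots> \<le> (c + \<eta>) * ((1 + 2 * \<eta>) * \<Delta>)"
        using c \<eta> r\<Delta> by (intro mult_left_mono) (auto simp: algebra_simps)
      also have "\<dots> \<le> (c + \<eta>) * ((1 + 8 * \<eta>) * (1 - 2 * \<eta>) * \<Delta>)"
      proof -
        have "0 \<le> 4 * \<eta> * (1 - 4 * \<eta>)" using \<eta> by simp
        then have "1 + 2 * \<eta> \<le> (1 + 8 * \<eta>) * (1 - 2 * \<eta>)" by (simp add: algebra_simps)
        then show ?thesis using c \<eta> \<Delta>pos by (intro mult_left_mono mult_right_mono) auto
      qed
      finally have "(1 - 2 * \<eta>) * p \<le> (1 - 2 * \<eta>) * ((c + \<eta>) * (1 + 8 * \<eta>) * \<Delta>)" by (simp add: mult_ac)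
      then have "p \<le> (c + \<eta>) * (1 + 8 * \<eta>) * \<Delta>" using \<eta> by simp
      also have "(c + \<eta>) * (1 + 8 * \<eta>) \<le> c + e"
      proof -
        have "\<eta> * (8 * \<eta>) \<le> \<eta> * 2" using \<eta> by (intro mult_left_mono) auto
        then show ?thesis using \<eta>(4) by (simp add: algebra_simps)
      qed
      finally have upper: "p \<le> (c + e) * \<Delta>" using \<Delta>pos by simp
      have low: "(c - \<eta>) / sqrt (real m) * (\<Delta> - 2 * r) \<le> measure (cpow \<rho> m) {u..u + \<Delta>} + C / A * (2 * (K / sqrt (real m)) * \<Delta>)"
      proof (rule N.smoothed_le_interval[OF A0 r])
        have "\<eta> * \<Delta> \<le> 1 / 4 * \<Delta>" using \<eta>(2) \<Delta>pos by (intro mult_right_mono) auto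
        then show "\<Delta> \<ge> 2 * r" using r\<Delta> \<Delta>pos by linarith
        show "C / A \<ge> 0" using C A0 by simp
        show "fejer A x \<le> C / A * (fejer 1 x + fejer 1 (x + 1))" if "\<bar>x\<bar> \<ge> r" for x
          by (rule C(2)[OF A0 that])
        show "(c - \<eta>) / sqrt (real m) \<le> (LINT s|cpow \<rho> m. fejer A (v - s))" if "u + r \<le> v" "v \<le> u + \<Delta> - r" for v
        proof -
          have "c - \<eta> \<le> sqrt (real m) * (LINT s|cpow \<rho> m. fejer A (v - s))"
            using F[of v] that r by linarith
          then show ?thesis using m by (simp add: field_simps)
        qed
        show "(LINT s|cpow \<rho> m. fejer 1 (v - s)) \<le> K / sqrt (real m)" for v
          using K(3)[OF \<rho> m(1) close1, of v] m by (simp add: field_simps)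
        show "0 \<le> K / sqrt (real m)" using K by simp
      qed
      have "(c - \<eta>) * (1 - 2 * \<eta>) * \<Delta> \<le> (c - \<eta>) * (\<Delta> - 2 * r)"
        unfolding mult.assoc using r\<Delta> \<eta> by (intro mult_left_mono) (auto simp: algebra_simps)
      also have "\<dots> = sqrt (real m) * ((c - \<eta>) / sqrt (real m) * (\<Delta> - 2 * r))" using m by simp
      also have "\<dots> \<le> sqrt (real m) * (measure (cpow \<rho> m) {u..u + \<Delta>} + C / A * (2 * (K / sqrt (real m)) * \<Delta>))"
        using low by (intro mult_left_mono) auto
      also have "\<dots> = p + C / A * (2 * K) * \<Delta>" using m by (simp add: p_def distrib_left)
      also have "\<dots> \<le> p + \<eta> * \<Delta>" using AC \<Delta>pos by (intro add_left_mono mult_right_mono) auto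
      finally have "((c - \<eta>) * (1 - 2 * \<eta>) - \<eta>) * \<Delta> \<le> p" by (simp add: algebra_simps)
      moreover have "(c - e) * \<Delta> \<le> ((c - \<eta>) * (1 - 2 * \<eta>) - \<eta>) * \<Delta>"
      proof (rule mult_right_mono)
        have "0 \<le> \<eta> * \<eta>" "0 \<le> \<eta> * c" using \<eta> c by simp_all
        moreover have "(c - \<eta>) * (1 - 2 * \<eta>) - \<eta> = c - 2 * \<eta> - 2 * (\<eta> * c) + 2 * (\<eta> * \<eta>)"
          by (simp add: algebra_simps)
        moreover have "3 * \<eta> + 8 * (\<eta> * c) \<le> e" using \<eta>(4) by (simp add: algebra_simps)
        ultimately show "c - e \<le> (c - \<eta>) * (1 - 2 * \<eta>) - \<eta>" using \<eta>(1) by linarith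
      qed (use \<Delta>pos in auto)
      ultimately have "\<bar>p - c * \<Delta>\<bar> \<le> e * \<Delta>"
        using upper by (simp add: abs_le_iff algebra_simps)
      then show "\<bar>sqrt (real m) * measure (cpow \<rho> m) {u..u + \<Delta>} - \<Delta> / (\<sigma> * sqrt (2 * pi))\<bar> \<le> e * \<Delta>"
        by (simp add: p_def c_def)
    qed
  qed
  then show ?thesis using that A0 \<theta>(1) by blast
qed

end

section \<open>Truncation and exponential tilting\<close>

text \<open>Steps larger than b in modulus are discarded together with their mass, so that the result may be defective.\<close>

definition trunc :: "real measure \<Rightarrow> real \<Rightarrow> real measure" where
  "trunc \<mu> b = density \<mu> (indicator {- b..b})"

text \<open>The Laplace transform of the truncated law: the normalisation of the tilted law.\<close>

definition tilt_mass :: "real measure \<Rightarrow> real \<Rightarrow> real \<Rightarrow> real" where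
  "tilt_mass \<mu> b \<beta> = (LINT w|\<mu>. indicator {- b..b} w * exp (\<beta> * w))"

text \<open>The Cramer transform of the truncated law, a probability law whenever the normalisation is positive.\<close>

definition tilt :: "real measure \<Rightarrow> real \<Rightarrow> real \<Rightarrow> real measure" where
  "tilt \<mu> b \<beta> = density \<mu> (\<lambda>w. ennreal (indicator {- b..b} w * exp (\<beta> * w) / tilt_mass \<mu> b \<beta>))"

context step_law
begin

lemma step_law_trunc: "step_law (trunc \<nu> b)"
proof (rule step_law.intro)
  show "step_law_axioms (trunc \<nu> b)" by (rule step_law_axioms.intro) (simp add: trunc_def)
  have "emeasure (trunc \<nu> b) UNIV = (\<integral>\<^sup>+w. indicator {- b..b} w \<partial>\<nu>)"
    unfolding trunc_def by (subst emeasure_density) auto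
  also have "\<dots> = emeasure \<nu> {- b..b}" by (rule nn_integral_indicator) simp
  also have "\<dots> \<le> 1" by (rule subprob_emeasure_le_1)
  finally have *: "emeasure (trunc \<nu> b) UNIV \<le> 1" .
  show "subprob_space (trunc \<nu> b)"
    by (rule subprob_spaceI) (use * in \<open>simp_all add: trunc_def\<close>)
qed

lemma integrable_tilt:
  "integrable \<nu> (\<lambda>w. indicator {- b..b} w * exp (\<beta> * w))"
proof (rule integrable_bounded[of _ "exp (\<bar>\<beta>\<bar> * \<bar>b\<bar>)"])
  fix w :: real
  have "\<beta> * w \<le> \<bar>\<beta>\<bar> * \<bar>b\<bar>" if "w \<in> {- b..b}"
  proof -
    have "\<beta> * w \<le> \<bar>\<beta>\<bar> * \<bar>w\<bar>" using abs_ge_self[of "\<beta> * w"] by (simp add: abs_mult)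
    also have "\<dots> \<le> \<bar>\<beta>\<bar> * \<bar>b\<bar>" using that by (intro mult_left_mono) auto
    finally show ?thesis .
  qed
  then show "norm (indicator {- b..b} w * exp (\<beta> * w)) \<le> exp (\<bar>\<beta>\<bar> * \<bar>b\<bar>)"
    by (auto simp: indicator_def)
qed measurable

lemma step_law_tilt:
  assumes Z: "tilt_mass \<nu> b \<beta> > 0"
  shows "step_law (tilt \<nu> b \<beta>)" "emeasure (tilt \<nu> b \<beta>) UNIV = 1"
proof -
  have "emeasure (tilt \<nu> b \<beta>) UNIV = (\<integral>\<^sup>+w. ennreal (indicator {- b..b} w * exp (\<beta> * w) / tilt_mass \<nu> b \<beta>) \<partial>\<nu>)"
    unfolding tilt_def by (subst emeasure_density) auto
  also have "\<dots> = ennreal (LINT w|\<nu>. indicator {- b..b} w * exp (\<beta> * w) / tilt_mass \<nu> b \<beta>)"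
    using Z by (intro nn_integral_eq_integral integrable_divide integrable_tilt) auto
  also have "\<dots> = 1" using Z by (simp add: tilt_mass_def)
  finally show *: "emeasure (tilt \<nu> b \<beta>) UNIV = 1" .
  show "step_law (tilt \<nu> b \<beta>)"
  proof (rule step_law.intro)
    show "step_law_axioms (tilt \<nu> b \<beta>)" by (rule step_law_axioms.intro) (simp add: tilt_def)
    show "subprob_space (tilt \<nu> b \<beta>)"
      by (rule subprob_spaceI) (use * in \<open>simp_all add: tilt_def\<close>)
  qed
qed

lemma nn_integral_tilt:
  assumes Z: "tilt_mass \<nu> b \<beta> > 0" and [measurable]: "h \<in> borel_measurable borel"
  shows "(\<integral>\<^sup>+w. h w \<partial>trunc \<nu> b) = ennreal (tilt_mass \<nu> b \<beta>) * (\<integral>\<^sup>+w. h w * ennreal (exp (- \<beta> * w)) \<partial>tilt \<nu> b \<beta>)"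
proof -
  have mult3: "ennreal x * ennreal y * ennreal z = ennreal (x * y * z)" if "x \<ge> 0" "y \<ge> 0" "z \<ge> 0" for x y z
    using that by (simp add: ennreal_mult)
  have comm: "x * (y * (u * v)) = u * (x * y * v)" for x y u v :: ennreal
    by (simp add: mult.assoc mult.left_commute)
  have "ennreal (tilt_mass \<nu> b \<beta>) * (\<integral>\<^sup>+w. h w * ennreal (exp (- \<beta> * w)) \<partial>tilt \<nu> b \<beta>) =
     ennreal (tilt_mass \<nu> b \<beta>) * (\<integral>\<^sup>+w. ennreal (indicator {- b..b} w * exp (\<beta> * w) / tilt_mass \<nu> b \<beta>) * (h w * ennreal (exp (- \<beta> * w))) \<partial>\<nu>)"
    unfolding tilt_def by (subst nn_integral_density) auto
  also have "\<dots> =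
     (\<integral>\<^sup>+w. ennreal (tilt_mass \<nu> b \<beta>) * (ennreal (indicator {- b..b} w * exp (\<beta> * w) / tilt_mass \<nu> b \<beta>) * (h w * ennreal (exp (- \<beta> * w)))) \<partial>\<nu>)"
    by (subst nn_integral_cmult) auto
  also have "\<dots> = (\<integral>\<^sup>+w. indicator {- b..b} w * h w \<partial>\<nu>)"
  proof (rule nn_integral_cong)
    fix w
    have "ennreal (tilt_mass \<nu> b \<beta>) * (ennreal (indicator {- b..b} w * exp (\<beta> * w) / tilt_mass \<nu> b \<beta>) * (h w * ennreal (exp (- \<beta> * w)))) =
      h w * (ennreal (tilt_mass \<nu> b \<beta>) * ennreal (indicator {- b..b} w * exp (\<beta> * w) / tilt_mass \<nu> b \<beta>) * ennreal (exp (- \<beta> * w)))"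
      by (rule comm)
    also have "ennreal (tilt_mass \<nu> b \<beta>) * ennreal (indicator {- b..b} w * exp (\<beta> * w) / tilt_mass \<nu> b \<beta>) * ennreal (exp (- \<beta> * w)) =
      ennreal (tilt_mass \<nu> b \<beta> * (indicator {- b..b} w * exp (\<beta> * w) / tilt_mass \<nu> b \<beta>) * exp (- \<beta> * w))"
      by (rule mult3) (use Z in auto)
    also have "tilt_mass \<nu> b \<beta> * (indicator {- b..b} w * exp (\<beta> * w) / tilt_mass \<nu> b \<beta>) * exp (- \<beta> * w) = indicator {- b..b} w"
      using Z by (simp add: exp_minus field_simps)
    finally show "ennreal (tilt_mass \<nu> b \<beta>) * (ennreal (indicator {- b..b} w * exp (\<beta> * w) / tilt_mass \<nu> b \<beta>) * (h w * ennreal (exp (- \<beta> * w)))) =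
      indicator {- b..b} w * h w" by (simp add: indicator_def mult.commute)
  qed
  also have "\<dots> = (\<integral>\<^sup>+w. h w \<partial>trunc \<nu> b)"
    unfolding trunc_def by (subst nn_integral_density) auto
  finally show ?thesis by simp
qed

text \<open>The exponential change of measure along m steps. Extended nonnegative integrals avoid any integrability
  condition on the unbounded exponential weight.\<close>

lemma nn_integral_cpow_tilt:
  assumes Z: "tilt_mass \<nu> b \<beta> > 0" and "h \<in> borel_measurable borel"
  shows "(\<integral>\<^sup>+s. h s \<partial>cpow (trunc \<nu> b) m) =
    ennreal (tilt_mass \<nu> b \<beta> ^ m) * (\<integral>\<^sup>+s. h s * ennreal (exp (- \<beta> * s)) \<partial>cpow (tilt \<nu> b \<beta>) m)"
  using assms(2)
proof (induction m arbitrary: h)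
  case 0
  then show ?case by (simp add: nn_integral_return)
next
  case (Suc m)
  note [measurable] = Suc.prems
  interpret T: step_law "trunc \<nu> b" by (rule step_law_trunc)
  interpret TC: step_law "cpow (trunc \<nu> b) m" by (rule T.step_law_cpow)
  interpret R: step_law "tilt \<nu> b \<beta>" by (rule step_law_tilt(1)[OF Z])
  interpret RC: step_law "cpow (tilt \<nu> b \<beta>) m" by (rule R.step_law_cpow)
  let ?Z = "tilt_mass \<nu> b \<beta>"
  have "(\<integral>\<^sup>+s. h s \<partial>cpow (trunc \<nu> b) (Suc m)) = (\<integral>\<^sup>+w. \<integral>\<^sup>+s. h (w + s) \<partial>cpow (trunc \<nu> b) m \<partial>trunc \<nu> b)"
    unfolding cpow.simps by (rule nn_integral_convolution) (auto simp: T.finite_measure_axioms TC.finite_measure_axioms)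
  also have "\<dots> = (\<integral>\<^sup>+w. ennreal (?Z ^ m) * (\<integral>\<^sup>+s. h (w + s) * ennreal (exp (- \<beta> * s)) \<partial>cpow (tilt \<nu> b \<beta>) m) \<partial>trunc \<nu> b)"
    by (intro nn_integral_cong Suc.IH) measurable
  also have "\<dots> = ennreal ?Z * (\<integral>\<^sup>+w. (ennreal (?Z ^ m) * (\<integral>\<^sup>+s. h (w + s) * ennreal (exp (- \<beta> * s)) \<partial>cpow (tilt \<nu> b \<beta>) m)) * ennreal (exp (- \<beta> * w)) \<partial>tilt \<nu> b \<beta>)"
    by (rule nn_integral_tilt[OF Z]) measurable
  also have "\<dots> = ennreal ?Z * (\<integral>\<^sup>+w. ennreal (?Z ^ m) * (\<integral>\<^sup>+s. h (w + s) * ennreal (exp (- \<beta> * (w + s))) \<partial>cpow (tilt \<nu> b \<beta>) m) \<partial>tilt \<nu> b \<beta>)"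
  proof (rule arg_cong[where f = "\<lambda>x. ennreal ?Z * x"], rule nn_integral_cong)
    fix w
    have "(\<integral>\<^sup>+s. h (w + s) * ennreal (exp (- \<beta> * (w + s))) \<partial>cpow (tilt \<nu> b \<beta>) m) =
       (\<integral>\<^sup>+s. h (w + s) * ennreal (exp (- \<beta> * s)) * ennreal (exp (- \<beta> * w)) \<partial>cpow (tilt \<nu> b \<beta>) m)"
      by (intro nn_integral_cong) (simp add: mult.assoc ennreal_mult[symmetric] exp_add[symmetric] algebra_simps)
    also have "\<dots> = (\<integral>\<^sup>+s. h (w + s) * ennreal (exp (- \<beta> * s)) \<partial>cpow (tilt \<nu> b \<beta>) m) * ennreal (exp (- \<beta> * w))"
      by (rule nn_integral_multc) measurable
    finally show "ennreal (?Z ^ m) * (\<integral>\<^sup>+s. h (w + s) * ennreal (exp (- \<beta> * s)) \<partial>cpow (tilt \<nu> b \<beta>) m) * ennreal (exp (- \<beta> * w)) =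
       ennreal (?Z ^ m) * (\<integral>\<^sup>+s. h (w + s) * ennreal (exp (- \<beta> * (w + s))) \<partial>cpow (tilt \<nu> b \<beta>) m)"
      by (simp add: mult.assoc)
  qed
  also have "\<dots> = ennreal ?Z * (ennreal (?Z ^ m) * (\<integral>\<^sup>+w. \<integral>\<^sup>+s. h (w + s) * ennreal (exp (- \<beta> * (w + s))) \<partial>cpow (tilt \<nu> b \<beta>) m \<partial>tilt \<nu> b \<beta>))"
    by (subst nn_integral_cmult) measurable
  also have "(\<integral>\<^sup>+w. \<integral>\<^sup>+s. h (w + s) * ennreal (exp (- \<beta> * (w + s))) \<partial>cpow (tilt \<nu> b \<beta>) m \<partial>tilt \<nu> b \<beta>) =
     (\<integral>\<^sup>+s. h s * ennreal (exp (- \<beta> * s)) \<partial>cpow (tilt \<nu> b \<beta>) (Suc m))"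
    unfolding cpow.simps by (rule nn_integral_convolution[symmetric]) (auto simp: R.finite_measure_axioms RC.finite_measure_axioms)
  finally show ?case using Z by (simp add: mult.assoc[symmetric] ennreal_mult[symmetric])
qed

lemma measure_cpow_trunc_le:
  assumes Z: "tilt_mass \<nu> b \<beta> > 0" and [measurable]: "S \<in> sets borel"
    and K: "\<And>s. s \<in> S \<Longrightarrow> exp (- \<beta> * s) \<le> K" "K \<ge> 0"
  shows "measure (cpow (trunc \<nu> b) m) S \<le> tilt_mass \<nu> b \<beta> ^ m * K * measure (cpow (tilt \<nu> b \<beta>) m) S"
proof -
  interpret T: step_law "trunc \<nu> b" by (rule step_law_trunc)
  interpret TC: step_law "cpow (trunc \<nu> b) m" by (rule T.step_law_cpow)
  interpret R: step_law "tilt \<nu> b \<beta>" by (rule step_law_tilt(1)[OF Z])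
  interpret RC: step_law "cpow (tilt \<nu> b \<beta>) m" by (rule R.step_law_cpow)
  have "emeasure (cpow (trunc \<nu> b) m) S = (\<integral>\<^sup>+s. indicator S s \<partial>cpow (trunc \<nu> b) m)" by simp
  also have "\<dots> = ennreal (tilt_mass \<nu> b \<beta> ^ m) * (\<integral>\<^sup>+s. indicator S s * ennreal (exp (- \<beta> * s)) \<partial>cpow (tilt \<nu> b \<beta>) m)"
    by (rule nn_integral_cpow_tilt[OF Z]) measurable
  also have "\<dots> \<le> ennreal (tilt_mass \<nu> b \<beta> ^ m) * (\<integral>\<^sup>+s. ennreal K * indicator S s \<partial>cpow (tilt \<nu> b \<beta>) m)"
    using K by (intro mult_left_mono nn_integral_mono) (auto simp: indicator_def ennreal_leI)
  also have "\<dots> = ennreal (tilt_mass \<nu> b \<beta> ^ m * K * measure (cpow (tilt \<nu> b \<beta>) m) S)"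
    using K Z by (simp add: nn_integral_cmult_indicator RC.emeasure_eq_measure ennreal_mult[symmetric] mult.assoc)
  finally show ?thesis
    using K Z by (simp add: TC.emeasure_eq_measure)
qed

lemma measure_cpow_trunc_ge:
  assumes Z: "tilt_mass \<nu> b \<beta> > 0" and [measurable]: "S \<in> sets borel"
    and K: "\<And>s. s \<in> S \<Longrightarrow> K \<le> exp (- \<beta> * s)" "K \<ge> 0"
  shows "tilt_mass \<nu> b \<beta> ^ m * K * measure (cpow (tilt \<nu> b \<beta>) m) S \<le> measure (cpow (trunc \<nu> b) m) S"
proof -
  interpret T: step_law "trunc \<nu> b" by (rule step_law_trunc)
  interpret TC: step_law "cpow (trunc \<nu> b) m" by (rule T.step_law_cpow)
  interpret R: step_law "tilt \<nu> b \<beta>" by (rule step_law_tilt(1)[OF Z])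
  interpret RC: step_law "cpow (tilt \<nu> b \<beta>) m" by (rule R.step_law_cpow)
  have "ennreal (tilt_mass \<nu> b \<beta> ^ m * K * measure (cpow (tilt \<nu> b \<beta>) m) S) =
      ennreal (tilt_mass \<nu> b \<beta> ^ m) * (\<integral>\<^sup>+s. ennreal K * indicator S s \<partial>cpow (tilt \<nu> b \<beta>) m)"
    using K Z by (simp add: nn_integral_cmult_indicator RC.emeasure_eq_measure ennreal_mult[symmetric] mult.assoc)
  also have "\<dots> \<le> ennreal (tilt_mass \<nu> b \<beta> ^ m) * (\<integral>\<^sup>+s. indicator S s * ennreal (exp (- \<beta> * s)) \<partial>cpow (tilt \<nu> b \<beta>) m)"
    using K by (intro mult_left_mono nn_integral_mono) (auto simp: indicator_def ennreal_leI)
  also have "\<dots> = (\<integral>\<^sup>+s. indicator S s \<partial>cpow (trunc \<nu> b) m)"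
    by (rule nn_integral_cpow_tilt[OF Z, symmetric]) measurable
  also have "\<dots> = ennreal (measure (cpow (trunc \<nu> b) m) S)" by (simp add: TC.emeasure_eq_measure)
  finally show ?thesis by simp
qed

end

section \<open>Quantitative estimates for the tilted law\<close>

lemma exp_remainder_bounds:
  fixes x :: real
  assumes "\<bar>x\<bar> \<le> 1"
  shows "\<bar>exp x - 1\<bar> \<le> 3 * \<bar>x\<bar>" "\<bar>exp x - 1 - x\<bar> \<le> 2 * x\<^sup>2" "\<bar>exp x - 1 - x - x\<^sup>2 / 2\<bar> \<le> \<bar>x\<bar> ^ 3"
proof -
  have *: "\<exists>t. 0 \<le> t \<and> t \<le> 3 \<and> exp x = (\<Sum>m<n. x ^ m / fact m) + t / fact n * x ^ n" for n
  proof -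
    obtain t where t: "\<bar>t\<bar> \<le> \<bar>x\<bar>" "exp x = (\<Sum>m<n. x ^ m / fact m) + exp t / fact n * x ^ n"
      using Maclaurin_exp_le[of x n] by blast
    have "exp t \<le> exp 1" using t(1) assms by simp
    then have "exp t \<le> 3" using exp_le by linarith
    then show ?thesis using t(2) by (intro exI[of _ "exp t"]) auto
  qed
  obtain t where "0 \<le> t" "t \<le> 3" "exp x = (\<Sum>m<1. x ^ m / fact m) + t / fact 1 * x ^ 1"
    using *[of 1] by blast
  then show "\<bar>exp x - 1\<bar> \<le> 3 * \<bar>x\<bar>" by (simp add: abs_mult mult_right_mono)
  obtain t where t: "0 \<le> t" "t \<le> 3" "exp x = (\<Sum>m<2. x ^ m / fact m) + t / fact 2 * x ^ 2"
    using *[of 2] by blast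
  then have eq: "exp x - 1 - x = t / 2 * x\<^sup>2" by (simp add: lessThan_nat_numeral fact_numeral)
  have "\<bar>exp x - 1 - x\<bar> = t / 2 * x\<^sup>2" unfolding eq using t(1) by (simp add: abs_mult)
  also have "\<dots> \<le> 2 * x\<^sup>2" using t by (intro mult_right_mono) auto
  finally show "\<bar>exp x - 1 - x\<bar> \<le> 2 * x\<^sup>2" .
  obtain t where t: "0 \<le> t" "t \<le> 3" "exp x = (\<Sum>m<3. x ^ m / fact m) + t / fact 3 * x ^ 3"
    using *[of 3] by blast
  then have eq: "exp x - 1 - x - x\<^sup>2 / 2 = t / 6 * x ^ 3" by (simp add: lessThan_nat_numeral fact_numeral)
  have "\<bar>exp x - 1 - x - x\<^sup>2 / 2\<bar> = t / 6 * \<bar>x\<bar> ^ 3" unfolding eq using t(1) by (simp add: abs_mult power_abs)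
  also have "\<dots> \<le> 1 * \<bar>x\<bar> ^ 3" using t by (intro mult_right_mono) auto
  finally show "\<bar>exp x - 1 - x - x\<^sup>2 / 2\<bar> \<le> \<bar>x\<bar> ^ 3" by simp
qed

context centred_law
begin

text \<open>For k at most 2, the part beyond the level b of the absolute moment of order k is at most \<open>t b ^ k\<close>.\<close>

definition tail_bound :: "real \<Rightarrow> real \<Rightarrow> bool" where
  "tail_bound b t \<longleftrightarrow> t \<ge> 0 \<and> (\<forall>k\<le>2. (LINT x|\<mu>. \<bar>x\<bar> ^ k * indicator (- {- b..b}) x) \<le> t * b ^ k)"

lemma integrable_power: "k \<le> 2 \<Longrightarrow> integrable \<mu> (\<lambda>x. x ^ k)"
  using int1 int2 by (auto simp: le_Suc_eq numeral_2_eq_2)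

lemma integrable_abs_power: "k \<le> 2 \<Longrightarrow> integrable \<mu> (\<lambda>x. \<bar>x\<bar> ^ k)"
  using integrable_abs[OF integrable_power] by (simp add: power_abs)

lemma integrable_tail: "k \<le> 2 \<Longrightarrow> integrable \<mu> (\<lambda>x. \<bar>x\<bar> ^ k * indicator (- {- b..b}) x)"
  by (rule Bochner_Integration.integrable_bound[OF integrable_abs_power[of k]]) (auto simp: indicator_def)

text \<open>Integrating a pointwise bound that is quadratic up to tail terms.\<close>

lemma integral_square_le:
  assumes "tail_bound b t" "f \<in> borel_measurable borel" "c0 \<ge> 0" "c1 \<ge> 0" "c2 \<ge> 0"
    and f: "\<And>x. \<bar>f x\<bar> \<le> A + B * x\<^sup>2 + c0 * (\<bar>x\<bar> ^ 0 * indicator (- {- b..b}) x)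
      + c1 * (\<bar>x\<bar> ^ 1 * indicator (- {- b..b}) x) + c2 * (\<bar>x\<bar> ^ 2 * indicator (- {- b..b}) x)"
  shows "integrable \<mu> f" "(LINT x|\<mu>. \<bar>f x\<bar>) \<le> A + B * \<sigma>\<^sup>2 + (c0 * t + c1 * (t * b) + c2 * (t * b\<^sup>2))"
    "\<bar>LINT x|\<mu>. f x\<bar> \<le> A + B * \<sigma>\<^sup>2 + (c0 * t + c1 * (t * b) + c2 * (t * b\<^sup>2))"
proof -
  let ?T = "\<lambda>k x. \<bar>x\<bar> ^ k * indicator (- {- b..b}) x :: real"
  let ?g = "\<lambda>x. A + B * x\<^sup>2 + c0 * ?T 0 x + c1 * ?T 1 x + c2 * ?T 2 x"
  have i: "integrable \<mu> (?T 0)" "integrable \<mu> (?T 1)" "integrable \<mu> (?T 2)"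
    by (rule integrable_tail; simp)+
  have ig: "integrable \<mu> ?g"
    by (intro Bochner_Integration.integrable_add integrable_mult_right int2 i) auto
  show "integrable \<mu> f"
  proof (rule Bochner_Integration.integrable_bound[OF ig])
    show "f \<in> borel_measurable \<mu>" using assms(2) by simp
    show "AE x in \<mu>. norm (f x) \<le> norm (?g x)"
      unfolding real_norm_def by (intro AE_I2 order_trans[OF f abs_ge_self])
  qed
  then have "integrable \<mu> (\<lambda>x. \<bar>f x\<bar>)" by simp
  then have "(LINT x|\<mu>. \<bar>f x\<bar>) \<le> (LINT x|\<mu>. ?g x)"
    by (rule integral_mono) (use ig f in auto)
  also have "\<dots> = A + B * \<sigma>\<^sup>2 + c0 * (LINT x|\<mu>. ?T 0 x) + c1 * (LINT x|\<mu>. ?T 1 x) + c2 * (LINT x|\<mu>. ?T 2 x)"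
  proof -
    have "has_bochner_integral \<mu> ?g (A + B * \<sigma>\<^sup>2 + c0 * (LINT x|\<mu>. ?T 0 x) + c1 * (LINT x|\<mu>. ?T 1 x) + c2 * (LINT x|\<mu>. ?T 2 x))"
    proof (intro has_bochner_integral_add has_bochner_integral_mult_right has_bochner_integral_integrable i)
      show "has_bochner_integral \<mu> (\<lambda>x. A) A" using prob_space by (simp add: has_bochner_integral_iff)
      show "has_bochner_integral \<mu> (\<lambda>x. x\<^sup>2) (\<sigma>\<^sup>2)" using int2 var by (simp add: has_bochner_integral_iff)
    qed
    then show ?thesis by (rule has_bochner_integral_integral_eq)
  qed
  also have "\<dots> \<le> A + B * \<sigma>\<^sup>2 + c0 * (t * b ^ 0) + c1 * (t * b ^ 1) + c2 * (t * b ^ 2)"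
  proof -
    have T: "(LINT x|\<mu>. ?T k x) \<le> t * b ^ k" if "k \<le> 2" for k
      using assms(1) that unfolding tail_bound_def by blast
    show ?thesis by (intro add_mono mult_left_mono T order_refl assms(3-5)) simp_all
  qed
  finally show *: "(LINT x|\<mu>. \<bar>f x\<bar>) \<le> A + B * \<sigma>\<^sup>2 + (c0 * t + c1 * (t * b) + c2 * (t * b\<^sup>2))" by simp
  show "\<bar>LINT x|\<mu>. f x\<bar> \<le> A + B * \<sigma>\<^sup>2 + (c0 * t + c1 * (t * b) + c2 * (t * b\<^sup>2))"
    by (rule order_trans[OF integral_abs_bound *])
qed

context
  fixes b \<beta> t :: real
  assumes b: "b \<ge> 1" and h: "\<bar>\<beta>\<bar> * b \<le> 1" and tb: "tail_bound b t"
begin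

lemma abs_tilt_le: "w \<in> {- b..b} \<Longrightarrow> \<bar>\<beta> * w\<bar> \<le> \<bar>\<beta>\<bar> * b"
  unfolding abs_mult by (rule mult_left_mono) auto

lemma tilt_mass_expansion:
  "\<bar>tilt_mass \<mu> b \<beta> - 1 - \<beta>\<^sup>2 * \<sigma>\<^sup>2 / 2\<bar> \<le> 3 * t + \<bar>\<beta>\<bar> * b * \<beta>\<^sup>2 * \<sigma>\<^sup>2"
proof -
  let ?f = "\<lambda>w. indicator {- b..b} w * exp (\<beta> * w) - 1 - \<beta> * w - \<beta>\<^sup>2 / 2 * w\<^sup>2"
  have "has_bochner_integral \<mu> ?f (tilt_mass \<mu> b \<beta> - 1 - \<beta> * 0 - \<beta>\<^sup>2 / 2 * \<sigma>\<^sup>2)"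
  proof (intro has_bochner_integral_diff has_bochner_integral_mult_right)
    show "has_bochner_integral \<mu> (\<lambda>w. indicator {- b..b} w * exp (\<beta> * w)) (tilt_mass \<mu> b \<beta>)"
      unfolding tilt_mass_def by (rule has_bochner_integral_integrable[OF integrable_tilt])
    show "has_bochner_integral \<mu> (\<lambda>x. 1 :: real) 1" using prob_space by (simp add: has_bochner_integral_iff)
    show "has_bochner_integral \<mu> (\<lambda>x. x) 0" using int1 mean0 by (simp add: has_bochner_integral_iff)
    show "has_bochner_integral \<mu> (\<lambda>x. x\<^sup>2) (\<sigma>\<^sup>2)" using int2 var by (simp add: has_bochner_integral_iff)
  qed
  from has_bochner_integral_integral_eq[OF this]
  have "tilt_mass \<mu> b \<beta> - 1 - \<beta>\<^sup>2 * \<sigma>\<^sup>2 / 2 = (LINT w|\<mu>. ?f w)" by simp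
  also have "\<bar>\<dots>\<bar> \<le> 0 + (\<bar>\<beta>\<bar> * b * \<beta>\<^sup>2) * \<sigma>\<^sup>2 + (1 * t + \<bar>\<beta>\<bar> * (t * b) + \<beta>\<^sup>2 / 2 * (t * b\<^sup>2))"
  proof (rule integral_square_le(3)[OF tb])
    fix w :: real
    show "\<bar>?f w\<bar> \<le> 0 + (\<bar>\<beta>\<bar> * b * \<beta>\<^sup>2) * w\<^sup>2 + 1 * (\<bar>w\<bar> ^ 0 * indicator (- {- b..b}) w)
      + \<bar>\<beta>\<bar> * (\<bar>w\<bar> ^ 1 * indicator (- {- b..b}) w) + \<beta>\<^sup>2 / 2 * (\<bar>w\<bar> ^ 2 * indicator (- {- b..b}) w)"
    proof (cases "w \<in> {- b..b}")
      case True
      have "\<bar>\<beta> * w\<bar> \<le> 1" using abs_tilt_le[OF True] h by linarith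
      then have "\<bar>exp (\<beta> * w) - 1 - \<beta> * w - (\<beta> * w)\<^sup>2 / 2\<bar> \<le> \<bar>\<beta> * w\<bar> ^ 3"
        by (rule exp_remainder_bounds)
      also have "\<dots> = \<bar>\<beta> * w\<bar> * (\<beta> * w)\<^sup>2" by (simp add: power3_eq_cube power2_eq_square)
      also have "\<dots> \<le> (\<bar>\<beta>\<bar> * b) * (\<beta> * w)\<^sup>2" by (rule mult_right_mono[OF abs_tilt_le[OF True]]) simp
      finally show ?thesis using True by (simp add: power_mult_distrib mult_ac)
    next
      case False
      have "\<bar>- 1 - \<beta> * w - \<beta>\<^sup>2 / 2 * w\<^sup>2\<bar> \<le> 1 + \<bar>\<beta>\<bar> * \<bar>w\<bar> + \<beta>\<^sup>2 / 2 * w\<^sup>2"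
        using abs_triangle_ineq4[of "- 1 - \<beta> * w" "\<beta>\<^sup>2 / 2 * w\<^sup>2"] abs_triangle_ineq4[of "- 1" "\<beta> * w"]
        by (simp add: abs_mult)
      moreover have "0 \<le> (\<bar>\<beta>\<bar> * b * \<beta>\<^sup>2) * w\<^sup>2" using b by simp
      ultimately show ?thesis using False by simp
    qed
  qed (use b in auto)
  also have "\<dots> \<le> 3 * t + \<bar>\<beta>\<bar> * b * \<beta>\<^sup>2 * \<sigma>\<^sup>2"
  proof -
    have t0: "t \<ge> 0" using tb by (simp add: tail_bound_def)
    have "\<bar>\<beta>\<bar> * (t * b) = t * (\<bar>\<beta>\<bar> * b)" by simp
    also have "\<dots> \<le> t * 1" by (rule mult_left_mono[OF h t0])
    finally have 1: "\<bar>\<beta>\<bar> * (t * b) \<le> t" by simp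
    have "(\<bar>\<beta>\<bar> * b)\<^sup>2 \<le> 1" using h b by (simp add: abs_square_le_1)
    then have "t * (\<bar>\<beta>\<bar> * b)\<^sup>2 \<le> t * 1" by (rule mult_left_mono[OF _ t0])
    then have 2: "\<beta>\<^sup>2 / 2 * (t * b\<^sup>2) \<le> t" using t0 by (simp add: power_mult_distrib mult_ac)
    show ?thesis using 1 2 by simp
  qed
  finally show ?thesis .
qed

lemma tilt_mass_near_1: "\<bar>tilt_mass \<mu> b \<beta> - 1\<bar> \<le> t + 3 * (\<bar>\<beta>\<bar> * b)"
proof -
  let ?f = "\<lambda>w. indicator {- b..b} w * exp (\<beta> * w) - 1"
  have "has_bochner_integral \<mu> ?f (tilt_mass \<mu> b \<beta> - 1)"
  proof (intro has_bochner_integral_diff)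
    show "has_bochner_integral \<mu> (\<lambda>w. indicator {- b..b} w * exp (\<beta> * w)) (tilt_mass \<mu> b \<beta>)"
      unfolding tilt_mass_def by (rule has_bochner_integral_integrable[OF integrable_tilt])
    show "has_bochner_integral \<mu> (\<lambda>x. 1 :: real) 1" using prob_space by (simp add: has_bochner_integral_iff)
  qed
  from has_bochner_integral_integral_eq[OF this]
  have "tilt_mass \<mu> b \<beta> - 1 = (LINT w|\<mu>. ?f w)" by simp
  also have "\<bar>\<dots>\<bar> \<le> 3 * (\<bar>\<beta>\<bar> * b) + 0 * \<sigma>\<^sup>2 + (1 * t + 0 * (t * b) + 0 * (t * b\<^sup>2))"
  proof (rule integral_square_le(3)[OF tb])
    fix w :: real
    show "\<bar>?f w\<bar> \<le> 3 * (\<bar>\<beta>\<bar> * b) + 0 * w\<^sup>2 + 1 * (\<bar>w\<bar> ^ 0 * indicator (- {- b..b}) w)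
      + 0 * (\<bar>w\<bar> ^ 1 * indicator (- {- b..b}) w) + 0 * (\<bar>w\<bar> ^ 2 * indicator (- {- b..b}) w)"
    proof (cases "w \<in> {- b..b}")
      case True
      have "\<bar>\<beta> * w\<bar> \<le> 1" using abs_tilt_le[OF True] h by linarith
      then have "\<bar>exp (\<beta> * w) - 1\<bar> \<le> 3 * \<bar>\<beta> * w\<bar>" by (rule exp_remainder_bounds)
      also have "\<dots> \<le> 3 * (\<bar>\<beta>\<bar> * b)" using abs_tilt_le[OF True] by simp
      finally show ?thesis using True by simp
    qed (use b in auto)
  qed (use b in auto)
  finally show ?thesis by simp
qed

lemma integrable_tilt_mean: "integrable \<mu> (\<lambda>w. indicator {- b..b} w * exp (\<beta> * w) * w)"
proof (rule Bochner_Integration.integrable_bound[of _ "\<lambda>w. exp 1 * w"])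
  show "integrable \<mu> (\<lambda>w. exp 1 * w)" using int1 by simp
  show "AE w in \<mu>. norm (indicator {- b..b} w * exp (\<beta> * w) * w) \<le> norm (exp 1 * w)"
  proof (rule AE_I2)
    fix w
    show "norm (indicator {- b..b} w * exp (\<beta> * w) * w) \<le> norm (exp 1 * w)"
    proof (cases "w \<in> {- b..b}")
      case True
      have "\<beta> * w \<le> 1" using abs_tilt_le[OF True] h by linarith
      then show ?thesis using True by (simp add: abs_mult mult_right_mono)
    qed simp
  qed
qed measurable

lemma tilt_mean_expansion:
  "\<bar>(LINT w|\<mu>. indicator {- b..b} w * exp (\<beta> * w) * w) - \<beta> * \<sigma>\<^sup>2\<bar> \<le>
     t * b + \<bar>\<beta>\<bar> * (t * b\<^sup>2) + 2 * (\<bar>\<beta>\<bar> * b) * \<bar>\<beta>\<bar> * \<sigma>\<^sup>2"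
proof -
  let ?f = "\<lambda>w. indicator {- b..b} w * exp (\<beta> * w) * w - w - \<beta> * w\<^sup>2"
  have "has_bochner_integral \<mu> ?f ((LINT w|\<mu>. indicator {- b..b} w * exp (\<beta> * w) * w) - 0 - \<beta> * \<sigma>\<^sup>2)"
  proof (intro has_bochner_integral_diff has_bochner_integral_mult_right)
    show "has_bochner_integral \<mu> (\<lambda>w. indicator {- b..b} w * exp (\<beta> * w) * w) (LINT w|\<mu>. indicator {- b..b} w * exp (\<beta> * w) * w)"
      by (rule has_bochner_integral_integrable[OF integrable_tilt_mean])
    show "has_bochner_integral \<mu> (\<lambda>x. x) 0" using int1 mean0 by (simp add: has_bochner_integral_iff)
    show "has_bochner_integral \<mu> (\<lambda>x. x\<^sup>2) (\<sigma>\<^sup>2)" using int2 var by (simp add: has_bochner_integral_iff)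
  qed
  from has_bochner_integral_integral_eq[OF this]
  have "(LINT w|\<mu>. indicator {- b..b} w * exp (\<beta> * w) * w) - \<beta> * \<sigma>\<^sup>2 = (LINT w|\<mu>. ?f w)" by simp
  also have "\<bar>\<dots>\<bar> \<le> 0 + (2 * (\<bar>\<beta>\<bar> * b) * \<bar>\<beta>\<bar>) * \<sigma>\<^sup>2 + (0 * t + 1 * (t * b) + \<bar>\<beta>\<bar> * (t * b\<^sup>2))"
  proof (rule integral_square_le(3)[OF tb])
    fix w :: real
    show "\<bar>?f w\<bar> \<le> 0 + (2 * (\<bar>\<beta>\<bar> * b) * \<bar>\<beta>\<bar>) * w\<^sup>2 + 0 * (\<bar>w\<bar> ^ 0 * indicator (- {- b..b}) w)
      + 1 * (\<bar>w\<bar> ^ 1 * indicator (- {- b..b}) w) + \<bar>\<beta>\<bar> * (\<bar>w\<bar> ^ 2 * indicator (- {- b..b}) w)"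
    proof (cases "w \<in> {- b..b}")
      case True
      have "\<bar>\<beta> * w\<bar> \<le> 1" using abs_tilt_le[OF True] h by linarith
      then have *: "\<bar>exp (\<beta> * w) - 1 - \<beta> * w\<bar> \<le> 2 * (\<beta> * w)\<^sup>2" by (rule exp_remainder_bounds)
      have "exp (\<beta> * w) * w - w - \<beta> * w\<^sup>2 = (exp (\<beta> * w) - 1 - \<beta> * w) * w"
        by (simp add: algebra_simps power2_eq_square)
      then have "\<bar>exp (\<beta> * w) * w - w - \<beta> * w\<^sup>2\<bar> \<le> 2 * (\<beta> * w)\<^sup>2 * \<bar>w\<bar>"
        using mult_right_mono[OF *, of "\<bar>w\<bar>"] by (simp add: abs_mult)
      also have "\<dots> = 2 * \<bar>\<beta> * w\<bar> * (\<bar>\<beta>\<bar> * w\<^sup>2)" by (simp add: abs_mult power2_eq_square)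
      also have "\<dots> \<le> 2 * (\<bar>\<beta>\<bar> * b) * (\<bar>\<beta>\<bar> * w\<^sup>2)"
        using abs_tilt_le[OF True] by (intro mult_right_mono) auto
      finally show ?thesis using True by (simp add: mult.assoc)
    next
      case False
      have "\<bar>- w - \<beta> * w\<^sup>2\<bar> \<le> \<bar>w\<bar> + \<bar>\<beta>\<bar> * w\<^sup>2"
        using abs_triangle_ineq4[of "- w" "\<beta> * w\<^sup>2"] by (simp add: abs_mult)
      moreover have "0 \<le> (2 * (\<bar>\<beta>\<bar> * b) * \<bar>\<beta>\<bar>) * w\<^sup>2" using b by simp
      ultimately have "\<bar>- w - \<beta> * w\<^sup>2\<bar> \<le> 2 * (\<bar>\<beta>\<bar> * b) * \<bar>\<beta>\<bar> * w\<^sup>2 + \<bar>w\<bar> + \<bar>\<beta>\<bar> * w\<^sup>2"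
        by linarith
      then show ?thesis using False by simp
    qed
  qed (use b in auto)
  finally show ?thesis by simp
qed

lemma tilt_density_distance:
  assumes Z: "tilt_mass \<mu> b \<beta> \<ge> 1 / 2"
  shows "integrable \<mu> (\<lambda>w. \<bar>indicator {- b..b} w * exp (\<beta> * w) / tilt_mass \<mu> b \<beta> - 1\<bar> * w\<^sup>2)"
    "(LINT w|\<mu>. \<bar>indicator {- b..b} w * exp (\<beta> * w) / tilt_mass \<mu> b \<beta> - 1\<bar> * w\<^sup>2) \<le>
      2 * (6 * (\<bar>\<beta>\<bar> * b) + t) * \<sigma>\<^sup>2 + t * b\<^sup>2"
proof -
  have Zp: "tilt_mass \<mu> b \<beta> > 0" using Z by simp
  let ?g = "\<lambda>w. indicator {- b..b} w * exp (\<beta> * w) / tilt_mass \<mu> b \<beta> - 1 :: real"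
  have t0: "t \<ge> 0" using tb by (simp add: tail_bound_def)
  have bd: "\<bar>\<bar>?g w\<bar> * w\<^sup>2\<bar> \<le> 0 + (2 * (6 * (\<bar>\<beta>\<bar> * b) + t)) * w\<^sup>2 + 0 * (\<bar>w\<bar> ^ 0 * indicator (- {- b..b}) w)
      + 0 * (\<bar>w\<bar> ^ 1 * indicator (- {- b..b}) w) + 1 * (\<bar>w\<bar> ^ 2 * indicator (- {- b..b}) w)" for w :: real
  proof (cases "w \<in> {- b..b}")
    case True
    have "\<bar>\<beta> * w\<bar> \<le> 1" using abs_tilt_le[OF True] h by linarith
    then have "\<bar>exp (\<beta> * w) - 1\<bar> \<le> 3 * \<bar>\<beta> * w\<bar>" by (rule exp_remainder_bounds)
    then have "\<bar>exp (\<beta> * w) - 1\<bar> \<le> 3 * (\<bar>\<beta>\<bar> * b)" using abs_tilt_le[OF True] by simp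
    then have "\<bar>exp (\<beta> * w) - tilt_mass \<mu> b \<beta>\<bar> \<le> 6 * (\<bar>\<beta>\<bar> * b) + t"
      using tilt_mass_near_1 by linarith
    moreover have "?g w = (exp (\<beta> * w) - tilt_mass \<mu> b \<beta>) / tilt_mass \<mu> b \<beta>"
      using Zp True by (simp add: diff_divide_distrib)
    ultimately have "\<bar>?g w\<bar> \<le> (6 * (\<bar>\<beta>\<bar> * b) + t) / (1 / 2)"
      using Z Zp by (simp only: abs_divide) (intro frac_le, auto)
    then have "\<bar>?g w\<bar> * w\<^sup>2 \<le> (2 * (6 * (\<bar>\<beta>\<bar> * b) + t)) * w\<^sup>2"
      by (intro mult_right_mono) auto
    then show ?thesis using True by (simp add: abs_mult)
  next
    case False
    have "0 \<le> (2 * (6 * (\<bar>\<beta>\<bar> * b) + t)) * w\<^sup>2" using b t0 by (intro mult_nonneg_nonneg add_nonneg_nonneg) auto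
    then show ?thesis using False by simp
  qed
  have m: "(\<lambda>w. \<bar>?g w\<bar> * w\<^sup>2) \<in> borel_measurable borel" by measurable
  show "integrable \<mu> (\<lambda>w. \<bar>?g w\<bar> * w\<^sup>2)"
    by (rule integral_square_le(1)[OF tb m _ _ _ bd]) auto
  show "(LINT w|\<mu>. \<bar>?g w\<bar> * w\<^sup>2) \<le> 2 * (6 * (\<bar>\<beta>\<bar> * b) + t) * \<sigma>\<^sup>2 + t * b\<^sup>2"
    using integral_square_le(2)[OF tb m _ _ _ bd] by simp
qed

end

text \<open>Since the density g has integral one and \<open>\<mu>\<close> is centred, the difference \<open>g - 1\<close> only meets the quadratic Taylor
  remainder of the exponential, up to the mean of the new law, which is compared with the shift a.\<close>

lemma char_density_compare:
  fixes g :: "real \<Rightarrow> real"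
  assumes [measurable]: "g \<in> borel_measurable borel" and g0: "\<And>w. 0 \<le> g w" and gB: "\<And>w. g w \<le> B"
    and g1: "(LINT w|\<mu>. g w) = 1" and int: "integrable \<mu> (\<lambda>w. \<bar>g w - 1\<bar> * w\<^sup>2)"
  shows "cmod (char (density \<mu> (\<lambda>w. ennreal (g w))) s - iexp (s * a) * char \<mu> s) \<le>
    s\<^sup>2 * ((LINT w|\<mu>. \<bar>g w - 1\<bar> * w\<^sup>2) / 2 + a\<^sup>2 / 2 + \<bar>a\<bar> * (LINT w|\<mu>. \<bar>w\<bar>)) + \<bar>s\<bar> * \<bar>(LINT w|\<mu>. g w * w) - a\<bar>"
proof -
  have B: "B \<ge> 0" using g0[of 0] gB[of 0] by linarith
  let ?G = "LINT w|\<mu>. \<bar>g w - 1\<bar> * w\<^sup>2" and ?m = "LINT w|\<mu>. g w * w"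
  have ig: "integrable \<mu> g" by (rule integrable_bounded[of _ B]) (use g0 gB in auto)
  have igw: "integrable \<mu> (\<lambda>w. g w * w)"
  proof (rule Bochner_Integration.integrable_bound[of _ "\<lambda>w. B * w"])
    show "integrable \<mu> (\<lambda>w. B * w)" using int1 by simp
    show "AE w in \<mu>. norm (g w * w) \<le> norm (B * w)"
    proof (rule AE_I2)
      fix w
      have "\<bar>g w\<bar> \<le> \<bar>B\<bar>" using g0[of w] gB[of w] by simp
      then show "norm (g w * w) \<le> norm (B * w)" by (simp add: abs_mult mult_right_mono)
    qed
  qed measurable
  have ige: "integrable \<mu> (\<lambda>w. g w *\<^sub>R iexp (s * w))"
    by (rule integrable_bounded[of _ B]) (use g0 gB in auto)
  have ie: "integrable \<mu> (\<lambda>w. iexp (s * w))" by (rule integrable_bounded[of _ 1]) auto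
  have 1: "char (density \<mu> (\<lambda>w. ennreal (g w))) s = (LINT w|\<mu>. g w *\<^sub>R iexp (s * w))"
    unfolding char_def by (rule integral_density) (use g0 in auto)
  have "has_bochner_integral \<mu> (\<lambda>w. g w *\<^sub>R iexp (s * w) - iexp (s * w) - complex_of_real (g w - 1) - \<i> * s * complex_of_real (g w * w - w))
    ((LINT w|\<mu>. g w *\<^sub>R iexp (s * w)) - char \<mu> s - complex_of_real (1 - 1) - \<i> * s * complex_of_real (?m - 0))"
  proof (intro has_bochner_integral_diff has_bochner_integral_mult_right has_bochner_integral_of_real)
    show "has_bochner_integral \<mu> (\<lambda>w. iexp (s * w)) (char \<mu> s)"
      unfolding char_def by (rule has_bochner_integral_integrable[OF ie])
    show "has_bochner_integral \<mu> g 1" using ig g1 by (simp add: has_bochner_integral_iff)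
    show "has_bochner_integral \<mu> (\<lambda>_. 1 :: real) 1" using prob_space by (simp add: has_bochner_integral_iff)
    show "has_bochner_integral \<mu> (\<lambda>x. x) 0" using int1 mean0 by (simp add: has_bochner_integral_iff)
  qed (rule has_bochner_integral_integrable ige igw)+
  from has_bochner_integral_integral_eq[OF this]
  have eq: "(LINT w|\<mu>. g w *\<^sub>R iexp (s * w)) - char \<mu> s - \<i> * s * ?m =
    (LINT w|\<mu>. g w *\<^sub>R iexp (s * w) - iexp (s * w) - complex_of_real (g w - 1) - \<i> * s * complex_of_real (g w * w - w))"
    by simp
  have "cmod ((LINT w|\<mu>. g w *\<^sub>R iexp (s * w)) - char \<mu> s - \<i> * s * ?m) \<le>
    (LINT w|\<mu>. s\<^sup>2 / 2 * (\<bar>g w - 1\<bar> * w\<^sup>2))"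
    unfolding eq
  proof (rule order_trans[OF integral_norm_bound], rule integral_mono_AE')
    show "integrable \<mu> (\<lambda>w. s\<^sup>2 / 2 * (\<bar>g w - 1\<bar> * w\<^sup>2))" using int by (rule integrable_mult_right)
    show "AE w in \<mu>. cmod (g w *\<^sub>R iexp (s * w) - iexp (s * w) - complex_of_real (g w - 1) - \<i> * s * complex_of_real (g w * w - w))
      \<le> s\<^sup>2 / 2 * (\<bar>g w - 1\<bar> * w\<^sup>2)"
    proof (rule AE_I2)
      fix w
      have "g w *\<^sub>R iexp (s * w) - iexp (s * w) - complex_of_real (g w - 1) - \<i> * s * complex_of_real (g w * w - w) =
        complex_of_real (g w - 1) * (iexp (s * w) - (1 + \<i> * complex_of_real (s * w)))"
        by (simp add: algebra_simps scaleR_conv_of_real)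
      moreover have "cmod (iexp (s * w) - (1 + \<i> * complex_of_real (s * w))) \<le> (s * w)\<^sup>2 / 2"
        using iexp_approx1[of "s * w" 1] by (simp add: numeral_2_eq_2)
      ultimately have "cmod (g w *\<^sub>R iexp (s * w) - iexp (s * w) - complex_of_real (g w - 1) - \<i> * s * complex_of_real (g w * w - w))
        \<le> \<bar>g w - 1\<bar> * ((s * w)\<^sup>2 / 2)"
        by (simp only: norm_mult norm_of_real) (rule mult_left_mono, auto)
      then show "cmod (g w *\<^sub>R iexp (s * w) - iexp (s * w) - complex_of_real (g w - 1) - \<i> * s * complex_of_real (g w * w - w))
      \<le> s\<^sup>2 / 2 * (\<bar>g w - 1\<bar> * w\<^sup>2)" by (simp add: power_mult_distrib mult_ac)
    qed
  qed simp
  also have "\<dots> = s\<^sup>2 / 2 * ?G" by (rule integral_mult_right_zero)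
  finally have A1: "cmod ((LINT w|\<mu>. g w *\<^sub>R iexp (s * w)) - char \<mu> s - \<i> * s * ?m) \<le> s\<^sup>2 / 2 * ?G" .
  have A2: "cmod (\<i> * s * complex_of_real (?m - a)) = \<bar>s\<bar> * \<bar>?m - a\<bar>"
    unfolding norm_mult norm_of_real by simp
  have A3: "cmod (iexp (s * a) - (1 + \<i> * complex_of_real (s * a))) \<le> s\<^sup>2 * (a\<^sup>2 / 2)"
  proof -
    have "cmod (iexp (s * a) - (1 + \<i> * complex_of_real (s * a))) \<le> (s * a)\<^sup>2 / 2"
      using iexp_approx1[of "s * a" 1] by (simp add: numeral_2_eq_2)
    then show ?thesis by (simp only: power_mult_distrib times_divide_eq_right)
  qed
  have "cmod (iexp (s * a) - 1) \<le> \<bar>s * a\<bar>" using iexp_approx1[of "s * a" 0] by simp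
  moreover have "cmod (char \<mu> s - 1) \<le> \<bar>s\<bar> * (LINT w|\<mu>. \<bar>w\<bar>)"
  proof -
    have "char \<mu> s - 1 = (LINT w|\<mu>. iexp (s * w) - 1)"
      unfolding char_def using ie prob_space by simp
    also have "cmod \<dots> \<le> (LINT w|\<mu>. \<bar>s\<bar> * \<bar>w\<bar>)"
    proof (rule order_trans[OF integral_norm_bound], rule integral_mono_AE')
      show "integrable \<mu> (\<lambda>w. \<bar>s\<bar> * \<bar>w\<bar>)" using int1 by simp
      show "AE w in \<mu>. cmod (iexp (s * w) - 1) \<le> \<bar>s\<bar> * \<bar>w\<bar>"
      proof (rule AE_I2)
        fix w show "cmod (iexp (s * w) - 1) \<le> \<bar>s\<bar> * \<bar>w\<bar>"
          using iexp_approx1[of "s * w" 0] by (simp add: abs_mult)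
      qed
    qed simp
    finally show ?thesis by simp
  qed
  ultimately have "cmod (iexp (s * a) - 1) * cmod (char \<mu> s - 1) \<le> \<bar>s * a\<bar> * (\<bar>s\<bar> * (LINT w|\<mu>. \<bar>w\<bar>))"
    by (intro mult_mono) auto
  moreover have "\<bar>s * a\<bar> * (\<bar>s\<bar> * c) = s\<^sup>2 * (\<bar>a\<bar> * c)" for c
  proof -
    have "\<bar>s * a\<bar> * (\<bar>s\<bar> * c) = (\<bar>s\<bar> * \<bar>s\<bar>) * (\<bar>a\<bar> * c)" by (simp only: abs_mult mult_ac)
    then show ?thesis by (simp only: abs_mult_self_eq power2_eq_square)
  qed
  ultimately have A4: "cmod ((iexp (s * a) - 1) * (char \<mu> s - 1)) \<le> s\<^sup>2 * (\<bar>a\<bar> * (LINT w|\<mu>. \<bar>w\<bar>))"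
    by (simp only: norm_mult)
  have "char (density \<mu> (\<lambda>w. ennreal (g w))) s - iexp (s * a) * char \<mu> s =
    ((LINT w|\<mu>. g w *\<^sub>R iexp (s * w)) - char \<mu> s - \<i> * s * ?m) + \<i> * s * complex_of_real (?m - a)
    - (iexp (s * a) - (1 + \<i> * complex_of_real (s * a))) - (iexp (s * a) - 1) * (char \<mu> s - 1)"
    unfolding 1 by (simp add: algebra_simps)
  also have "cmod \<dots> \<le> s\<^sup>2 / 2 * ?G + \<bar>s\<bar> * \<bar>?m - a\<bar> + s\<^sup>2 * (a\<^sup>2 / 2) + s\<^sup>2 * (\<bar>a\<bar> * (LINT w|\<mu>. \<bar>w\<bar>))"
    by (intro order_trans[OF norm_triangle_ineq4] order_trans[OF norm_triangle_ineq] add_mono A1 A3 A4)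
      (simp only: A2 order_refl)
  finally show ?thesis by (simp add: algebra_simps)
qed

end

context centred_law
begin

text \<open>A constant large enough for all the estimates of the next lemma; its value plays no role.\<close>

definition tilt_const :: real where
  "tilt_const = 27 + 30 * \<sigma>\<^sup>2 + \<sigma> ^ 4 + \<sigma>\<^sup>2 * (LINT w|\<mu>. \<bar>w\<bar>)"

lemma tilt_const_ge: "tilt_const \<ge> 27"
  unfolding tilt_const_def by (simp add: add_increasing2)

text \<open>If the displayed quantities are at most \<open>\<zeta>\<close>, then the law tilted by \<open>\<beta>\<close> is Fourier-close to the reference law
  shifted by \<open>\<beta> \<sigma>\<^sup>2\<close>, and its normalisation after m steps is that of the Gaussian law with variance \<open>\<sigma>\<^sup>2\<close>, up to
  a factor close to one. Because
  \<open>\<bar>\<beta>\<bar> b\<close> is small, the density of the tilted law with respect to the reference law is close to one on the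
  whole truncation interval.\<close>

lemma tilt_estimates:
  assumes \<zeta>: "0 < \<zeta>" "\<zeta> \<le> 1 / 16" and b: "b \<ge> 1" and m: "m > 0" and tb: "tail_bound b t"
    and h: "\<bar>\<beta>\<bar> * b \<le> \<zeta>" and hQ: "\<bar>\<beta>\<bar> * b * (real m * \<beta>\<^sup>2) \<le> \<zeta>"
    and mt: "real m * t \<le> \<zeta>" and t1: "sqrt (real m) * (t * b) \<le> \<zeta>" and t2: "t * b\<^sup>2 \<le> \<zeta>"
    and t3: "sqrt (real m) * \<bar>\<beta>\<bar> * (t * b\<^sup>2) \<le> \<zeta>"
  shows "tilt_mass \<mu> b \<beta> > 0"
    "char_close (tilt \<mu> b \<beta>) A (\<zeta> * tilt_const) m (\<beta> * \<sigma>\<^sup>2)"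
    "\<bar>real m * ln (tilt_mass \<mu> b \<beta>) - real m * \<beta>\<^sup>2 * \<sigma>\<^sup>2 / 2\<bar> \<le> \<zeta> * tilt_const"
proof -
  let ?Z = "tilt_mass \<mu> b \<beta>" and ?h = "\<bar>\<beta>\<bar> * b" and ?Q = "real m * \<beta>\<^sup>2" and ?r = "sqrt (real m)"
  have h1: "?h \<le> 1" using h \<zeta> by linarith
  have h0: "0 \<le> ?h" using b by simp
  have t0: "0 \<le> t" using tb by (simp add: tail_bound_def)
  have m1: "real m \<ge> 1" using m by simp
  have tz: "t \<le> \<zeta>" using mult_right_mono[OF m1 t0] mt by simp
  have \<beta>h: "\<bar>\<beta>\<bar> \<le> ?h" using b mult_left_mono[of 1 b "\<bar>\<beta>\<bar>"] by simp
  have Q0: "0 \<le> ?Q" by simp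
  have near: "\<bar>?Z - 1\<bar> \<le> t + 3 * ?h" by (rule tilt_mass_near_1[OF b h1 tb])
  then have near': "\<bar>?Z - 1\<bar> \<le> 4 * \<zeta>" using tz h by linarith
  then have Zh: "\<bar>?Z - 1\<bar> \<le> 1 / 4" using \<zeta> by linarith
  then have Zhalf: "?Z \<ge> 1 / 2" by linarith
  then show Zpos: "?Z > 0" by linarith
  have exp1: "\<bar>?Z - 1 - \<beta>\<^sup>2 * \<sigma>\<^sup>2 / 2\<bar> \<le> 3 * t + ?h * \<beta>\<^sup>2 * \<sigma>\<^sup>2"
    by (rule tilt_mass_expansion[OF b h1 tb])
  have m_exp1: "real m * \<bar>?Z - 1 - \<beta>\<^sup>2 * \<sigma>\<^sup>2 / 2\<bar> \<le> 3 * \<zeta> + \<zeta> * \<sigma>\<^sup>2"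
  proof -
    have "real m * \<bar>?Z - 1 - \<beta>\<^sup>2 * \<sigma>\<^sup>2 / 2\<bar> \<le> real m * (3 * t + ?h * \<beta>\<^sup>2 * \<sigma>\<^sup>2)"
      by (rule mult_left_mono[OF exp1]) simp
    also have "\<dots> = 3 * (real m * t) + (?h * ?Q) * \<sigma>\<^sup>2" by (simp add: algebra_simps)
    also have "\<dots> \<le> 3 * \<zeta> + \<zeta> * \<sigma>\<^sup>2"
      using mt hQ by (intro add_mono mult_right_mono) auto
    finally show ?thesis .
  qed
  have sq: "real m * (?Z - 1)\<^sup>2 \<le> \<zeta> * (12 + 6 * \<sigma>\<^sup>2)"
  proof -
    have "?h * \<beta>\<^sup>2 * \<sigma>\<^sup>2 \<le> 1 * \<beta>\<^sup>2 * \<sigma>\<^sup>2" by (intro mult_right_mono h1) auto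
    moreover have "0 \<le> \<beta>\<^sup>2 * \<sigma>\<^sup>2" by simp
    ultimately have "\<bar>?Z - 1\<bar> \<le> 3 * t + 3 / 2 * (\<beta>\<^sup>2 * \<sigma>\<^sup>2)" using exp1 by linarith
    then have "\<bar>?Z - 1\<bar> * \<bar>?Z - 1\<bar> \<le> (t + 3 * ?h) * (3 * t + 3 / 2 * (\<beta>\<^sup>2 * \<sigma>\<^sup>2))"
      using near t0 h0 by (intro mult_mono) auto
    then have "(?Z - 1)\<^sup>2 \<le> (t + 3 * ?h) * (3 * t + 3 / 2 * (\<beta>\<^sup>2 * \<sigma>\<^sup>2))"
      by (simp only: abs_mult_self_eq power2_eq_square)
    then have "real m * (?Z - 1)\<^sup>2 \<le> real m * ((t + 3 * ?h) * (3 * t + 3 / 2 * (\<beta>\<^sup>2 * \<sigma>\<^sup>2)))"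
      by (rule mult_left_mono) simp
    also have "\<dots> = 3 * ((t + 3 * ?h) * (real m * t)) + 3 / 2 * \<sigma>\<^sup>2 * (real m * t * \<beta>\<^sup>2) + 9 / 2 * \<sigma>\<^sup>2 * (?h * ?Q)"
      by (simp add: algebra_simps)
    also have "\<dots> \<le> 3 * (4 * \<zeta>) + 3 / 2 * \<sigma>\<^sup>2 * \<zeta> + 9 / 2 * \<sigma>\<^sup>2 * \<zeta>"
    proof (intro add_mono mult_left_mono hQ)
      have "(t + 3 * ?h) * (real m * t) \<le> (4 * \<zeta>) * 1"
        using tz h mt \<zeta> t0 h0 by (intro mult_mono) auto
      then show "(t + 3 * ?h) * (real m * t) \<le> 4 * \<zeta>" by simp
      have "\<bar>\<beta>\<bar>\<^sup>2 \<le> 1" using \<beta>h h1 by (simp add: abs_square_le_1)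
      then have "real m * t * \<beta>\<^sup>2 \<le> \<zeta> * 1" using mt \<zeta> by (intro mult_mono) auto
      then show "real m * t * \<beta>\<^sup>2 \<le> \<zeta>" by simp
    qed auto
    finally show ?thesis by (simp add: algebra_simps)
  qed
  have E0: "0 \<le> (LINT w|\<mu>. \<bar>w\<bar>)" by simp
  have s0: "0 \<le> \<sigma>\<^sup>2" "0 \<le> \<sigma> ^ 4" "0 \<le> \<sigma>\<^sup>2 * (LINT w|\<mu>. \<bar>w\<bar>)" by simp_all
  show "\<bar>real m * ln ?Z - real m * \<beta>\<^sup>2 * \<sigma>\<^sup>2 / 2\<bar> \<le> \<zeta> * tilt_const"
  proof -
    have "\<bar>ln (1 + (?Z - 1)) - (?Z - 1)\<bar> \<le> 2 * (?Z - 1)\<^sup>2"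
      by (rule abs_ln_one_plus_x_minus_x_bound) (use Zh in linarith)
    then have "real m * \<bar>ln ?Z - (?Z - 1)\<bar> \<le> real m * (2 * (?Z - 1)\<^sup>2)"
      by (intro mult_left_mono) auto
    then have 1: "real m * \<bar>ln ?Z - (?Z - 1)\<bar> \<le> 2 * (\<zeta> * (12 + 6 * \<sigma>\<^sup>2))" using sq by simp
    have "real m * ln ?Z - real m * \<beta>\<^sup>2 * \<sigma>\<^sup>2 / 2 =
      real m * (ln ?Z - (?Z - 1)) + real m * (?Z - 1 - \<beta>\<^sup>2 * \<sigma>\<^sup>2 / 2)" by (simp add: algebra_simps)
    also have "\<bar>\<dots>\<bar> \<le> real m * \<bar>ln ?Z - (?Z - 1)\<bar> + real m * \<bar>?Z - 1 - \<beta>\<^sup>2 * \<sigma>\<^sup>2 / 2\<bar>"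
      by (rule order_trans[OF abs_triangle_ineq]) (simp add: abs_mult)
    also have "\<dots> \<le> \<zeta> * (27 + 13 * \<sigma>\<^sup>2)" using 1 m_exp1 by (simp add: algebra_simps)
    also have "\<dots> \<le> \<zeta> * tilt_const"
      unfolding tilt_const_def using \<zeta>(1) s0 by (intro mult_left_mono) linarith+
    finally show ?thesis .
  qed
  define g where "g w = indicator {- b..b} w * exp (\<beta> * w) / ?Z" for w
  let ?m = "LINT w|\<mu>. g w * w" and ?a = "\<beta> * \<sigma>\<^sup>2" and ?G = "LINT w|\<mu>. \<bar>g w - 1\<bar> * w\<^sup>2"
  have hr: "?h * (?r * \<bar>\<beta>\<bar>) \<le> 2 * \<zeta>"
  proof -
    have "?r * \<bar>\<beta>\<bar> = sqrt ?Q" by (simp add: real_sqrt_mult)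
    also have "\<dots> \<le> 1 + ?Q"
    proof (rule real_le_lsqrt)
      show "0 \<le> 1 + ?Q" using Q0 by linarith
      have "(1 + ?Q)\<^sup>2 = 1 + 2 * ?Q + ?Q\<^sup>2" by (simp add: power2_eq_square algebra_simps)
      then show "?Q \<le> (1 + ?Q)\<^sup>2" using Q0 zero_le_power2[of ?Q] by linarith
    qed
    finally have "?h * (?r * \<bar>\<beta>\<bar>) \<le> ?h * (1 + ?Q)" by (rule mult_left_mono[OF _ h0])
    then show ?thesis using h hQ by (simp add: distrib_left)
  qed
  have mean: "?r * \<bar>?m - ?a\<bar> \<le> \<zeta> * (4 + 22 * \<sigma>\<^sup>2)"
  proof -
    let ?N = "LINT w|\<mu>. indicator {- b..b} w * exp (\<beta> * w) * w"
    have "g w * w = (indicator {- b..b} w * exp (\<beta> * w) * w) / ?Z" for w by (simp add: g_def)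
    then have mN: "?m = ?N / ?Z" by simp
    have "?r * \<bar>?N - ?a\<bar> \<le> ?r * (t * b + \<bar>\<beta>\<bar> * (t * b\<^sup>2) + 2 * ?h * \<bar>\<beta>\<bar> * \<sigma>\<^sup>2)"
      by (rule mult_left_mono[OF tilt_mean_expansion[OF b h1 tb]]) simp
    also have "\<dots> = ?r * (t * b) + ?r * \<bar>\<beta>\<bar> * (t * b\<^sup>2) + 2 * \<sigma>\<^sup>2 * (?h * (?r * \<bar>\<beta>\<bar>))"
      by (simp add: algebra_simps)
    also have "\<dots> \<le> \<zeta> + \<zeta> + 2 * \<sigma>\<^sup>2 * (2 * \<zeta>)"
      by (intro add_mono t1 t3 mult_left_mono hr) simp
    finally have N: "?r * \<bar>?N - ?a\<bar> \<le> 2 * \<zeta> + 4 * \<sigma>\<^sup>2 * \<zeta>" by simp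
    have "?r * (\<bar>?Z - 1\<bar> * \<bar>?a\<bar>) \<le> ?r * ((t + 3 * ?h) * \<bar>?a\<bar>)"
      by (intro mult_left_mono mult_right_mono near) auto
    also have "\<dots> = \<sigma>\<^sup>2 * (?r * \<bar>\<beta>\<bar> * t + 3 * (?h * (?r * \<bar>\<beta>\<bar>)))" by (simp add: abs_mult algebra_simps)
    also have "\<dots> \<le> \<sigma>\<^sup>2 * (\<zeta> + 3 * (2 * \<zeta>))"
    proof (intro mult_left_mono add_mono hr)
      have "1 \<le> b\<^sup>2" using b by simp
      then have "t * 1 \<le> t * b\<^sup>2" by (rule mult_left_mono[OF _ t0])
      then have "?r * \<bar>\<beta>\<bar> * t \<le> ?r * \<bar>\<beta>\<bar> * (t * b\<^sup>2)" by (intro mult_left_mono) auto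
      then show "?r * \<bar>\<beta>\<bar> * t \<le> \<zeta>" using t3 by linarith
    qed auto
    finally have Za: "?r * (\<bar>?Z - 1\<bar> * \<bar>?a\<bar>) \<le> 7 * \<sigma>\<^sup>2 * \<zeta>" by (simp add: algebra_simps)
    have "?m - ?a = ((?N - ?a) - (?Z - 1) * ?a) / ?Z"
      unfolding mN using Zpos by (simp add: field_simps)
    then have "\<bar>?m - ?a\<bar> = \<bar>(?N - ?a) - (?Z - 1) * ?a\<bar> / ?Z" using Zpos by simp
    also have "\<dots> \<le> (\<bar>?N - ?a\<bar> + \<bar>?Z - 1\<bar> * \<bar>?a\<bar>) / (1 / 2)"
      using Zhalf abs_triangle_ineq4[of "?N - ?a" "(?Z - 1) * ?a"] by (intro frac_le) (auto simp: abs_mult)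
    finally have "\<bar>?m - ?a\<bar> \<le> 2 * (\<bar>?N - ?a\<bar> + \<bar>?Z - 1\<bar> * \<bar>?a\<bar>)" by simp
    then have "?r * \<bar>?m - ?a\<bar> \<le> ?r * (2 * (\<bar>?N - ?a\<bar> + \<bar>?Z - 1\<bar> * \<bar>?a\<bar>))" by (rule mult_left_mono) simp
    also have "\<dots> = 2 * (?r * \<bar>?N - ?a\<bar>) + 2 * (?r * (\<bar>?Z - 1\<bar> * \<bar>?a\<bar>))" by (simp only: algebra_simps)
    also have "\<dots> \<le> \<zeta> * (4 + 22 * \<sigma>\<^sup>2)" using N Za by (simp add: algebra_simps)
    finally show ?thesis .
  qed
  have Gint: "integrable \<mu> (\<lambda>w. \<bar>g w - 1\<bar> * w\<^sup>2)"
    unfolding g_def by (rule tilt_density_distance(1)[OF b h1 tb Zhalf])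
  have "?G \<le> 2 * (6 * ?h + t) * \<sigma>\<^sup>2 + t * b\<^sup>2"
    unfolding g_def by (rule tilt_density_distance(2)[OF b h1 tb Zhalf])
  also have "\<dots> \<le> 2 * (7 * \<zeta>) * \<sigma>\<^sup>2 + \<zeta>"
    using h tz t2 by (intro add_mono mult_right_mono mult_left_mono) auto
  finally have G: "?G \<le> \<zeta> * (14 * \<sigma>\<^sup>2 + 1)" by (simp add: algebra_simps)
  have quad: "?G / 2 + ?a\<^sup>2 / 2 + \<bar>?a\<bar> * (LINT w|\<mu>. \<bar>w\<bar>) \<le> \<zeta> * tilt_const"
  proof -
    have a: "\<bar>?a\<bar> \<le> \<zeta> * \<sigma>\<^sup>2" using \<beta>h h by (simp add: abs_mult mult_right_mono)
    have "?a\<^sup>2 = \<bar>?a\<bar> * \<bar>?a\<bar>" by (simp add: power2_eq_square)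
    also have "\<dots> \<le> (\<zeta> * \<sigma>\<^sup>2) * (1 * \<sigma>\<^sup>2)"
      using a \<zeta> by (intro mult_mono order_trans[OF a mult_right_mono[of \<zeta> 1 "\<sigma>\<^sup>2"]]) auto
    finally have "?a\<^sup>2 \<le> \<zeta> * \<sigma> ^ 4" by (simp add: power2_eq_square power4_eq_xxxx mult_ac)
    moreover have "\<bar>?a\<bar> * (LINT w|\<mu>. \<bar>w\<bar>) \<le> \<zeta> * \<sigma>\<^sup>2 * (LINT w|\<mu>. \<bar>w\<bar>)"
      by (rule mult_right_mono[OF a E0])
    ultimately have "?G / 2 + ?a\<^sup>2 / 2 + \<bar>?a\<bar> * (LINT w|\<mu>. \<bar>w\<bar>) \<le>
      \<zeta> * (14 * \<sigma>\<^sup>2 + 1) / 2 + \<zeta> * \<sigma> ^ 4 / 2 + \<zeta> * \<sigma>\<^sup>2 * (LINT w|\<mu>. \<bar>w\<bar>)"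
      using G by linarith
    also have "\<dots> = \<zeta> * (7 * \<sigma>\<^sup>2 + 1 / 2 + \<sigma> ^ 4 / 2 + \<sigma>\<^sup>2 * (LINT w|\<mu>. \<bar>w\<bar>))" by (simp add: algebra_simps)
    also have "\<dots> \<le> \<zeta> * tilt_const"
      unfolding tilt_const_def using \<zeta>(1) s0 by (intro mult_left_mono) linarith+
    finally show ?thesis .
  qed
  show "char_close (tilt \<mu> b \<beta>) A (\<zeta> * tilt_const) m ?a"
    unfolding char_close_def
  proof
    fix s assume s: "s \<in> {0..A}"
    have gm: "g \<in> borel_measurable borel" unfolding g_def by measurable
    have g1: "(LINT w|\<mu>. g w) = 1" using Zpos unfolding g_def by (simp add: tilt_mass_def)
    have gB: "g w \<le> exp 1 / ?Z" for w
    proof (cases "w \<in> {- b..b}")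
      case True
      have "\<beta> * w \<le> 1" using abs_tilt_le[OF b h1 tb True] h1 by linarith
      then show ?thesis using True Zpos by (simp add: g_def divide_right_mono)
    next
      case False
      then show ?thesis using Zpos by (simp add: g_def)
    qed
    have "cmod (char (density \<mu> (\<lambda>w. ennreal (g w))) s - iexp (s * ?a) * char \<mu> s) \<le>
      s\<^sup>2 * (?G / 2 + ?a\<^sup>2 / 2 + \<bar>?a\<bar> * (LINT w|\<mu>. \<bar>w\<bar>)) + \<bar>s\<bar> * \<bar>?m - ?a\<bar>"
      by (rule char_density_compare[OF gm _ gB g1 Gint]) (use Zpos in \<open>simp add: g_def\<close>)
    also have "\<dots> \<le> s\<^sup>2 * (\<zeta> * tilt_const) + \<bar>s\<bar> * (\<zeta> * tilt_const / ?r)"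
    proof (intro add_mono mult_left_mono quad)
      have "?r * \<bar>?m - ?a\<bar> \<le> \<zeta> * tilt_const"
      proof (rule order_trans[OF mean])
        show "\<zeta> * (4 + 22 * \<sigma>\<^sup>2) \<le> \<zeta> * tilt_const"
          unfolding tilt_const_def using \<zeta>(1) s0 by (intro mult_left_mono) linarith+
      qed
      then show "\<bar>?m - ?a\<bar> \<le> \<zeta> * tilt_const / ?r" using m by (simp add: field_simps)
    qed auto
    also have "\<dots> = \<zeta> * tilt_const * (s\<^sup>2 + s / ?r)" using s by (simp add: algebra_simps)
    finally show "cmod (char (tilt \<mu> b \<beta>) s - iexp (s * ?a) * char \<mu> s) \<le> \<zeta> * tilt_const * (s\<^sup>2 + s / ?r)"
      by (simp add: tilt_def g_def)
  qed
qed

lemma tail_bound_moment: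
  assumes d: "\<delta> > 0" and int: "integrable \<mu> (\<lambda>x. \<bar>x\<bar> powr (2 + \<delta>))" and b: "b > 0"
  shows "tail_bound b ((LINT x|\<mu>. \<bar>x\<bar> powr (2 + \<delta>)) * b powr (- (2 + \<delta>)))"
  unfolding tail_bound_def
proof (intro conjI allI impI)
  show "0 \<le> (LINT x|\<mu>. \<bar>x\<bar> powr (2 + \<delta>)) * b powr (- (2 + \<delta>))" by (simp add: integral_nonneg_AE)
  fix k :: nat assume k: "k \<le> 2"
  have "(LINT x|\<mu>. \<bar>x\<bar> ^ k * indicator (- {- b..b}) x) \<le> (LINT x|\<mu>. \<bar>x\<bar> powr (2 + \<delta>) * (b powr (- (2 + \<delta>)) * b ^ k))"
  proof (rule integral_mono)
    show "integrable \<mu> (\<lambda>x. \<bar>x\<bar> ^ k * indicator (- {- b..b}) x)" by (rule integrable_tail[OF k])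
    show "integrable \<mu> (\<lambda>x. \<bar>x\<bar> powr (2 + \<delta>) * (b powr (- (2 + \<delta>)) * b ^ k))" using int by (rule integrable_mult_left)
    fix x :: real
    show "\<bar>x\<bar> ^ k * indicator (- {- b..b}) x \<le> \<bar>x\<bar> powr (2 + \<delta>) * (b powr (- (2 + \<delta>)) * b ^ k)"
    proof (cases "x \<in> {- b..b}")
      case False
      then have x: "\<bar>x\<bar> > b" by auto
      then have x1: "\<bar>x\<bar> / b \<ge> 1" using b by simp
      have "(\<bar>x\<bar> / b) ^ k = (\<bar>x\<bar> / b) powr real k" using x1 by (simp add: powr_realpow)
      also have "\<dots> \<le> (\<bar>x\<bar> / b) powr (2 + \<delta>)" using k d x1 by (intro powr_mono) auto
      also have "\<dots> = \<bar>x\<bar> powr (2 + \<delta>) * b powr (- (2 + \<delta>))"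
        unfolding powr_divide powr_minus_divide by simp
      finally have "(\<bar>x\<bar> / b) ^ k * b ^ k \<le> \<bar>x\<bar> powr (2 + \<delta>) * b powr (- (2 + \<delta>)) * b ^ k"
        using b by (intro mult_right_mono) auto
      then show ?thesis using False b by (simp add: power_divide mult.assoc)
    next
      case True
      then show ?thesis using b by simp
    qed
  qed
  also have "\<dots> = (LINT x|\<mu>. \<bar>x\<bar> powr (2 + \<delta>)) * (b powr (- (2 + \<delta>)) * b ^ k)" by simp
  finally show "(LINT x|\<mu>. \<bar>x\<bar> ^ k * indicator (- {- b..b}) x) \<le> (LINT x|\<mu>. \<bar>x\<bar> powr (2 + \<delta>)) * b powr (- (2 + \<delta>)) * b ^ k"
    by (simp add: mult.assoc)
qed

end

section \<open>The local limit theorem for the truncated walk\<close>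

context centred_law
begin

text \<open>The Gaussian approximation to the probability that the walk is in \<open>[u, u + \<Delta>]\<close> after m steps, for \<open>\<Delta>\<close> small
  in comparison with the standard deviation.\<close>

definition gauss_local :: "nat \<Rightarrow> real \<Rightarrow> real \<Rightarrow> real" where
  "gauss_local m u \<Delta> = \<Delta> / (\<sigma> * sqrt (2 * pi * real m)) * exp (- u\<^sup>2 / (2 * \<sigma>\<^sup>2 * real m))"

text \<open>Orders of magnitude of the tail terms when the truncation level is \<open>n powr (1 / 2 - \<kappa>)\<close>.\<close>

lemma truncation_rates:
  fixes \<kappa> \<delta> M :: real
  assumes \<delta>: "\<delta> > 0" and \<kappa>: "0 < \<kappa>" "\<kappa> * (2 + \<delta>) \<le> \<delta> / 8"
  defines "b \<equiv> \<lambda>n. real n powr (1 / 2 - \<kappa>)"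
  defines "t \<equiv> \<lambda>n. M * b n powr (- (2 + \<delta>))"
  shows "\<kappa> \<le> 1 / 8" "(\<lambda>n. real n * t n) \<longlonglongrightarrow> 0" "(\<lambda>n. sqrt (real n) * (t n * b n)) \<longlonglongrightarrow> 0" "(\<lambda>n. t n * (b n)\<^sup>2) \<longlonglongrightarrow> 0"
proof -
  have "\<kappa> * \<delta> \<le> \<delta> / 8 * 1" using \<kappa> by (simp add: algebra_simps)
  then have "\<delta> * \<kappa> \<le> \<delta> * (1 / 8)" by (simp add: mult.commute)
  then show \<kappa>3: "\<kappa> \<le> 1 / 8" using \<delta> by (simp only: mult_le_cancel_left_pos)
  have x3: "1 + (1 / 2 - \<kappa>) * (- (2 + \<delta>)) < 0" using \<kappa>(2) \<delta> \<kappa>(1) by (simp add: algebra_simps)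
  then show "(\<lambda>n. real n * t n) \<longlonglongrightarrow> 0"
    unfolding t_def b_def by real_asymp
  have x4: "1 / 2 + (1 / 2 - \<kappa>) * (- (2 + \<delta>)) + (1 / 2 - \<kappa>) < 0" using \<kappa>(2) \<delta> \<kappa>(1) by (simp add: algebra_simps)
  then show "(\<lambda>n. sqrt (real n) * (t n * b n)) \<longlonglongrightarrow> 0"
    unfolding t_def b_def by real_asymp
  have x5: "(1 / 2 - \<kappa>) * (- (2 + \<delta>)) + (1 / 2 - \<kappa>) * 2 < 0" using \<kappa>3 \<delta> by (simp add: algebra_simps)
  then show "(\<lambda>n. t n * (b n)\<^sup>2) \<longlonglongrightarrow> 0"
    unfolding t_def b_def by real_asymp
qed

text \<open>Moderate deviations with a relative error, for the truncated walk: tilting by \<open>\<beta> = u / (\<sigma>\<^sup>2 m)\<close> moves the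
  centre of the walk to u, where the local limit theorem for laws close to a shift applies. The weight
  \<open>exp (- \<beta> s)\<close> is nearly constant on the target since \<open>\<bar>\<beta>\<bar> \<Delta>\<close> is small. Unlike in the untruncated case, the constant
  C is arbitrary.\<close>

lemma trunc_local_limit:
  fixes \<kappa> \<delta> \<epsilon> :: real
  assumes \<delta>: "\<delta> > 0" and mom: "integrable \<mu> (\<lambda>x. \<bar>x\<bar> powr (2 + \<delta>))"
    and \<kappa>: "0 < \<kappa>" "\<kappa> \<le> \<epsilon>" "\<kappa> * (2 + \<delta>) \<le> \<delta> / 8"
    and C: "C > 0" and \<Delta>0: "\<Delta>\<^sub>0 > 0" and e: "e > 0"
  shows "\<forall>\<^sub>F n in sequentially. \<forall>m u \<Delta>. real n powr (1 - \<kappa> / 4) \<le> real m \<longrightarrow> m \<le> n \<longrightarrow>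
     \<bar>u\<bar> \<le> C * sqrt (real n * ln (real n)) \<longrightarrow> \<Delta>\<^sub>0 \<le> \<Delta> \<longrightarrow> \<Delta> \<le> real n powr (1 / 2 - \<epsilon>) \<longrightarrow>
     \<bar>measure (cpow (trunc \<mu> (real n powr (1 / 2 - \<kappa>))) m) {u..u + \<Delta>} - gauss_local m u \<Delta>\<bar> \<le> e * gauss_local m u \<Delta>"
proof -
  define c0 where "c0 = 1 / (\<sigma> * sqrt (2 * pi))"
  have c0: "c0 > 0" using \<sigma>_pos by (simp add: c0_def)
  have "((\<lambda>x. exp (2 * x) * (1 + x / c0)) \<longlongrightarrow> exp (2 * 0) * (1 + 0 / c0)) (at_right 0)"
    by (intro tendsto_intros) (use c0 in auto)
  then have l1: "\<forall>\<^sub>F x in at_right 0. exp (2 * x) * (1 + x / c0) < 1 + e"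
    by (rule order_tendstoD) (use e in simp)
  have "((\<lambda>x. exp (- 2 * x) * (1 - x / c0)) \<longlongrightarrow> exp (- 2 * 0) * (1 - 0 / c0)) (at_right 0)"
    by (intro tendsto_intros) (use c0 in auto)
  then have l2: "\<forall>\<^sub>F x in at_right 0. 1 - e < exp (- 2 * x) * (1 - x / c0)"
    by (rule order_tendstoD) (use e in simp)
  have l3: "\<forall>\<^sub>F x in at_right (0 :: real). 0 < x" by (rule eventually_at_right_less)
  have "\<exists>x>0. exp (2 * x) * (1 + x / c0) < 1 + e \<and> 1 - e < exp (- 2 * x) * (1 - x / c0)"
    using eventually_happens[OF eventually_conj[OF l3 eventually_conj[OF l1 l2]]] by auto
  then obtain e' where e': "e' > 0" "exp (2 * e') * (1 + e' / c0) < 1 + e" "1 - e < exp (- 2 * e') * (1 - e' / c0)"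
    by blast
  obtain A \<theta> where \<theta>: "A > 0" "\<theta> > 0" and ILL:
    "\<forall>\<^sub>F m in sequentially. \<forall>\<rho> a u \<Delta>. step_law \<rho> \<longrightarrow> char_close \<rho> A \<theta> m a \<longrightarrow> \<Delta> \<ge> \<Delta>\<^sub>0 \<longrightarrow>
       \<Delta> \<le> \<theta> * sqrt (real m) \<longrightarrow> \<bar>u - real m * a\<bar> \<le> \<theta> * sqrt (real m) \<longrightarrow>
       \<bar>sqrt (real m) * measure (cpow \<rho> m) {u..u + \<Delta>} - \<Delta> / (\<sigma> * sqrt (2 * pi))\<bar> \<le> e' * \<Delta>"
    using interval_local_limit[OF \<Delta>0 e'(1)] by blast
  then obtain m0 where m0: "\<And>m \<rho> a u \<Delta>. m \<ge> m0 \<Longrightarrow> step_law \<rho> \<Longrightarrow> char_close \<rho> A \<theta> m a \<Longrightarrow> \<Delta> \<ge> \<Delta>\<^sub>0 \<Longrightarrow>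
       \<Delta> \<le> \<theta> * sqrt (real m) \<Longrightarrow> \<bar>u - real m * a\<bar> \<le> \<theta> * sqrt (real m) \<Longrightarrow>
       \<bar>sqrt (real m) * measure (cpow \<rho> m) {u..u + \<Delta>} - \<Delta> / (\<sigma> * sqrt (2 * pi))\<bar> \<le> e' * \<Delta>"
    unfolding eventually_sequentially by blast
  have tc: "tilt_const > 0" using tilt_const_ge by linarith
  define \<zeta> where "\<zeta> = min (1 / 16) (min (\<theta> / tilt_const) (e' / tilt_const))"
  have \<zeta>: "\<zeta> > 0" using \<theta> e' tc by (simp add: \<zeta>_def)
  have \<zeta>16: "\<zeta> \<le> 1 / 16" unfolding \<zeta>_def by (rule min.cobounded1)
  have "\<zeta> \<le> \<theta> / tilt_const" "\<zeta> \<le> e' / tilt_const" by (auto simp: \<zeta>_def)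
  then have \<zeta>': "\<zeta> * tilt_const \<le> \<theta>" "\<zeta> * tilt_const \<le> e'" using tc by (simp_all add: pos_le_divide_eq)
  define M where "M = (LINT x|\<mu>. \<bar>x\<bar> powr (2 + \<delta>))"
  define b where "b n = real n powr (1 / 2 - \<kappa>)" for n :: nat
  define t where "t n = M * b n powr (- (2 + \<delta>))" for n
  \<comment> \<open>bounds for \<open>\<bar>\<beta>\<bar>\<close> and for \<open>m \<beta>\<^sup>2\<close>\<close>
  define B where "B n = C * sqrt (real n * ln (real n)) / (\<sigma>\<^sup>2 * real n powr (1 - \<kappa> / 4))" for n :: nat
  define Q where "Q n = C\<^sup>2 * (real n * ln (real n)) / (\<sigma> ^ 4 * real n powr (1 - \<kappa> / 4))" for n :: nat
  have \<kappa>\<delta>: "\<kappa> * \<delta> \<le> \<delta> / 8 - 2 * \<kappa>" using \<kappa>(3) by (simp add: algebra_simps)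
  have \<kappa>2: "\<kappa> \<le> \<delta> / 16" using \<kappa>\<delta> \<kappa>(1) \<delta> mult_pos_pos[OF \<kappa>(1) \<delta>] by linarith
  note \<kappa>3 = truncation_rates(1)[OF \<delta> \<kappa>(1,3)]
  note rates = truncation_rates(2-4)[OF \<delta> \<kappa>(1,3), where M = M, folded b_def, folded t_def]
  note lim3 = rates(1) and lim4 = rates(2) and lim5 = rates(3)
  have lim1: "(\<lambda>n. B n * b n) \<longlonglongrightarrow> 0"
    unfolding B_def b_def using \<kappa>(1) C \<sigma>_pos by real_asymp
  have lim2: "(\<lambda>n. B n * b n * Q n) \<longlonglongrightarrow> 0"
    unfolding B_def b_def Q_def using \<kappa>(1) C \<sigma>_pos by real_asymp
  have x6: "\<kappa> / 8 + (1 / 2 - \<kappa>) * (- (2 + \<delta>)) + (1 / 2 - \<kappa>) * 2 < 0" using \<kappa>2 \<kappa>\<delta> \<kappa>(1) \<delta> by (simp add: algebra_simps)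
  have lim6: "(\<lambda>n. sqrt (Q n) * (t n * (b n)\<^sup>2)) \<longlonglongrightarrow> 0"
    unfolding t_def b_def Q_def using x6 C \<sigma>_pos by real_asymp
  have x7: "\<kappa> / 4 - \<epsilon> < 0" using \<kappa> by simp
  have lim7: "(\<lambda>n. B n * real n powr (1 / 2 - \<epsilon>)) \<longlonglongrightarrow> 0"
    unfolding B_def using x7 C \<sigma>_pos by real_asymp
  have x8: "\<kappa> / 8 - \<epsilon> < 0" using \<kappa> by simp
  have lim8: "(\<lambda>n. real n powr (1 / 2 - \<epsilon>) / sqrt (real n powr (1 - \<kappa> / 4))) \<longlonglongrightarrow> 0"
    using x8 by real_asymp
  have lim9: "filterlim (\<lambda>n. real n powr (1 - \<kappa> / 4)) at_top sequentially"
    using \<kappa>3 by real_asymp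
  have evm: "\<forall>\<^sub>F n in sequentially. real (max m0 1) \<le> real n powr (1 - \<kappa> / 4)"
    using lim9 unfolding filterlim_at_top by blast
  note ev = order_tendstoD(2)[OF lim1 \<zeta>] order_tendstoD(2)[OF lim2 \<zeta>] order_tendstoD(2)[OF lim3 \<zeta>]
    order_tendstoD(2)[OF lim4 \<zeta>] order_tendstoD(2)[OF lim5 \<zeta>] order_tendstoD(2)[OF lim6 \<zeta>]
    order_tendstoD(2)[OF lim7 e'(1)] order_tendstoD(2)[OF lim8 \<theta>(2)] evm
  show ?thesis
    using ev eventually_ge_at_top[of 1]
  proof eventually_elim
    case (elim n)
    show ?case
    proof (intro allI impI)
      fix m :: nat and u \<Delta> :: real
      assume m: "real n powr (1 - \<kappa> / 4) \<le> real m" "m \<le> n" and u: "\<bar>u\<bar> \<le> C * sqrt (real n * ln (real n))"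
        and \<Delta>: "\<Delta>\<^sub>0 \<le> \<Delta>" "\<Delta> \<le> real n powr (1 / 2 - \<epsilon>)"
      have n1: "real n \<ge> 1" using elim by simp
      have ln0: "ln (real n) \<ge> 0" using n1 by simp
      have "real (max m0 1) \<le> real m" using elim m(1) by linarith
      then have mm: "m \<ge> m0" "m > 0" by auto
      have r0: "sqrt (real m) > 0" using mm by simp
      have npos: "real n powr (1 - \<kappa> / 4) > 0" using n1 by simp
      have bn: "b n \<ge> 1" unfolding b_def using n1 \<kappa>3 by (intro ge_one_powr_ge_zero) auto
      define \<beta> where "\<beta> = u / (\<sigma>\<^sup>2 * real m)"
      have \<beta>B: "\<bar>\<beta>\<bar> \<le> B n"
        unfolding \<beta>_def B_def using u m \<sigma>_pos mm npos
        by (simp only: abs_divide) (intro frac_le, auto)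
      have \<beta>Q: "real m * \<beta>\<^sup>2 \<le> Q n"
      proof -
        have "\<bar>u\<bar>\<^sup>2 \<le> (C * sqrt (real n * ln (real n)))\<^sup>2" by (intro power_mono u) simp
        then have u2: "u\<^sup>2 \<le> C\<^sup>2 * (real n * ln (real n))" using ln0 by (simp add: power_mult_distrib)
        have "real m * \<beta>\<^sup>2 = u\<^sup>2 / (\<sigma> ^ 4 * real m)"
          using mm \<sigma>_pos by (simp add: \<beta>_def power_divide power_mult_distrib field_simps power2_eq_square power4_eq_xxxx)
        also have "\<dots> \<le> Q n"
          unfolding Q_def using u2 m(1) \<sigma>_pos npos by (intro frac_le) auto
        finally show ?thesis .
      qed
      have B0: "0 \<le> B n" using \<beta>B by linarith
      have M0: "M \<ge> 0" unfolding M_def by (simp add: integral_nonneg_AE)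
      have tn: "t n \<ge> 0" unfolding t_def using M0 by simp
      have tb: "tail_bound (b n) (t n)"
        unfolding t_def M_def using bn by (intro tail_bound_moment[OF \<delta> mom]) simp
      have h: "\<bar>\<beta>\<bar> * b n \<le> \<zeta>" using elim mult_right_mono[OF \<beta>B, of "b n"] bn by linarith
      have hQ: "\<bar>\<beta>\<bar> * b n * (real m * \<beta>\<^sup>2) \<le> \<zeta>"
      proof -
        have "\<bar>\<beta>\<bar> * b n * (real m * \<beta>\<^sup>2) \<le> B n * b n * Q n"
          using \<beta>B \<beta>Q bn B0 by (intro mult_mono) auto
        then show ?thesis using elim by linarith
      qed
      have mt: "real m * t n \<le> \<zeta>" using elim mult_right_mono[OF _ tn, of "real m" "real n"] m(2) by simp
      have t1: "sqrt (real m) * (t n * b n) \<le> \<zeta>"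
      proof -
        have "sqrt (real m) * (t n * b n) \<le> sqrt (real n) * (t n * b n)"
          using m(2) tn bn by (intro mult_right_mono) auto
        then show ?thesis using elim by linarith
      qed
      have t3: "sqrt (real m) * \<bar>\<beta>\<bar> * (t n * (b n)\<^sup>2) \<le> \<zeta>"
      proof -
        have "sqrt (real m) * \<bar>\<beta>\<bar> = sqrt (real m * \<beta>\<^sup>2)" by (simp add: real_sqrt_mult)
        also have "\<dots> \<le> sqrt (Q n)" using \<beta>Q by simp
        finally have "sqrt (real m) * \<bar>\<beta>\<bar> * (t n * (b n)\<^sup>2) \<le> sqrt (Q n) * (t n * (b n)\<^sup>2)"
          using tn by (intro mult_right_mono) auto
        then show ?thesis using elim by linarith
      qed
      have t2: "t n * (b n)\<^sup>2 \<le> \<zeta>" using elim by simp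
      note est = tilt_estimates[OF \<zeta> \<zeta>16 bn mm(2) tb h hQ mt t1 t2 t3]
      let ?Z = "tilt_mass \<mu> (b n) \<beta>" and ?\<rho> = "tilt \<mu> (b n) \<beta>"
      have Z: "?Z > 0" by (rule est(1))
      have \<rho>: "step_law ?\<rho>" by (rule step_law_tilt(1)[OF Z])
      have close: "char_close ?\<rho> A \<theta> m (\<beta> * \<sigma>\<^sup>2)" by (rule char_close_mono[OF est(2)[of A] order_refl \<zeta>'(1)])
      have \<Delta>pos: "\<Delta> > 0" using \<Delta> \<Delta>0 by simp
      have \<Delta>m: "\<Delta> \<le> \<theta> * sqrt (real m)"
      proof -
        have "real n powr (1 / 2 - \<epsilon>) \<le> \<theta> * sqrt (real n powr (1 - \<kappa> / 4))"
          using elim npos by (simp add: divide_less_eq)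
        also have "\<dots> \<le> \<theta> * sqrt (real m)" using m(1) \<theta> by (intro mult_left_mono) auto
        finally show ?thesis using \<Delta> by linarith
      qed
      have centre: "real m * (\<beta> * \<sigma>\<^sup>2) = u" using mm \<sigma>_pos by (simp add: \<beta>_def)
      define p where "p = measure (cpow ?\<rho> m) {u..u + \<Delta>}"
      have p: "\<bar>sqrt (real m) * p - \<Delta> / (\<sigma> * sqrt (2 * pi))\<bar> \<le> e' * \<Delta>"
        unfolding p_def by (rule m0[OF mm(1) \<rho> close \<Delta>(1) \<Delta>m]) (use centre \<theta> in simp)
      have p0: "p \<ge> 0" by (simp add: p_def)
      define g where "g = c0 * \<Delta> / sqrt (real m)"
      have g0: "g > 0" using c0 \<Delta>pos r0 by (simp add: g_def)
      have pu: "p \<le> (1 + e' / c0) * g" and pl: "(1 - e' / c0) * g \<le> p"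
      proof -
        have "\<bar>sqrt (real m) * p - c0 * \<Delta>\<bar> \<le> e' * \<Delta>" using p by (simp add: c0_def)
        then have "sqrt (real m) * p \<le> (c0 + e') * \<Delta>" "(c0 - e') * \<Delta> \<le> sqrt (real m) * p"
          by (auto simp: algebra_simps abs_le_iff)
        then have "p \<le> (c0 + e') * \<Delta> / sqrt (real m)" "(c0 - e') * \<Delta> / sqrt (real m) \<le> p"
          using r0 by (simp_all add: pos_le_divide_eq pos_divide_le_eq mult.commute)
        moreover have "(c0 + e') * \<Delta> / sqrt (real m) = (1 + e' / c0) * g" "(c0 - e') * \<Delta> / sqrt (real m) = (1 - e' / c0) * g"
        proof -
          have "(1 + e' / c0) * c0 = c0 + e'" "(1 - e' / c0) * c0 = c0 - e'"
            using c0 by (simp_all add: field_simps)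
          moreover have "k * g = k * c0 * \<Delta> / sqrt (real m)" for k by (simp add: g_def)
          ultimately show "(c0 + e') * \<Delta> / sqrt (real m) = (1 + e' / c0) * g"
            "(c0 - e') * \<Delta> / sqrt (real m) = (1 - e' / c0) * g" by simp_all
        qed
        ultimately show "p \<le> (1 + e' / c0) * g" "(1 - e' / c0) * g \<le> p" by simp_all
      qed
      define E where "E = exp (- u\<^sup>2 / (2 * \<sigma>\<^sup>2 * real m))"
      have G: "gauss_local m u \<Delta> = g * E"
        using \<sigma>_pos by (simp add: gauss_local_def g_def c0_def E_def real_sqrt_mult)
      have \<beta>\<Delta>: "\<bar>\<beta>\<bar> * \<Delta> \<le> e'"
      proof -
        have "\<bar>\<beta>\<bar> * \<Delta> \<le> B n * real n powr (1 / 2 - \<epsilon>)"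
          using \<beta>B \<Delta> \<Delta>pos B0 by (intro mult_mono) auto
        then show ?thesis using elim by linarith
      qed
      have s\<beta>: "\<bar>\<beta> * s - \<beta> * u\<bar> \<le> e'" if "s \<in> {u..u + \<Delta>}" for s
      proof -
        have "\<bar>\<beta> * s - \<beta> * u\<bar> = \<bar>\<beta>\<bar> * \<bar>s - u\<bar>" by (simp add: abs_mult[symmetric] right_diff_distrib)
        also have "\<dots> \<le> \<bar>\<beta>\<bar> * \<Delta>" using that by (intro mult_left_mono) auto
        finally show ?thesis using \<beta>\<Delta> by linarith
      qed
      have Zm: "?Z ^ m = exp (real m * ln ?Z)" using Z by (simp add: exp_of_nat_mult)
      have quad: "real m * \<beta>\<^sup>2 * \<sigma>\<^sup>2 / 2 - \<beta> * u = - u\<^sup>2 / (2 * \<sigma>\<^sup>2 * real m)"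
        using mm \<sigma>_pos by (simp add: \<beta>_def field_simps power2_eq_square)
      have lnZ: "\<bar>real m * ln ?Z - real m * \<beta>\<^sup>2 * \<sigma>\<^sup>2 / 2\<bar> \<le> e'" using est(3) \<zeta>'(2) by linarith
      have up: "measure (cpow (trunc \<mu> (b n)) m) {u..u + \<Delta>} \<le> ?Z ^ m * exp (- \<beta> * u + e') * p"
        unfolding p_def
      proof (rule measure_cpow_trunc_le[OF Z])
        fix s assume "s \<in> {u..u + \<Delta>}"
        then show "exp (- \<beta> * s) \<le> exp (- \<beta> * u + e')" using s\<beta>[of s] by simp
      qed auto
      have low: "?Z ^ m * exp (- \<beta> * u - e') * p \<le> measure (cpow (trunc \<mu> (b n)) m) {u..u + \<Delta>}"
        unfolding p_def
      proof (rule measure_cpow_trunc_ge[OF Z])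
        fix s assume "s \<in> {u..u + \<Delta>}"
        then show "exp (- \<beta> * u - e') \<le> exp (- \<beta> * s)" using s\<beta>[of s] by simp
      qed auto
      have "?Z ^ m * exp (- \<beta> * u + e') \<le> E * exp (2 * e')"
        unfolding Zm E_def exp_add[symmetric] exp_le_cancel_iff using lnZ quad by linarith
      then have "?Z ^ m * exp (- \<beta> * u + e') * p \<le> E * exp (2 * e') * ((1 + e' / c0) * g)"
        by (rule mult_mono[OF _ pu _ p0]) (simp add: E_def)
      also have "\<dots> = exp (2 * e') * (1 + e' / c0) * (g * E)" by simp
      also have "\<dots> \<le> (1 + e) * (g * E)" using e'(2) g0 by (intro mult_right_mono) (auto simp: E_def)
      finally have upper: "measure (cpow (trunc \<mu> (b n)) m) {u..u + \<Delta>} \<le> (1 + e) * (g * E)" using up by linarith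
      have "E * exp (- 2 * e') \<le> ?Z ^ m * exp (- \<beta> * u - e')"
        unfolding Zm E_def exp_add[symmetric] exp_le_cancel_iff using lnZ quad by linarith
      then have "E * exp (- 2 * e') * p \<le> ?Z ^ m * exp (- \<beta> * u - e') * p" using p0 by (rule mult_right_mono)
      moreover have "E * exp (- 2 * e') * ((1 - e' / c0) * g) \<le> E * exp (- 2 * e') * p"
        using pl by (intro mult_left_mono) (auto simp: E_def)
      moreover have "(1 - e) * (g * E) \<le> exp (- 2 * e') * (1 - e' / c0) * (g * E)"
        using e'(3) g0 by (intro mult_right_mono) (auto simp: E_def)
      moreover have "exp (- 2 * e') * (1 - e' / c0) * (g * E) = E * exp (- 2 * e') * ((1 - e' / c0) * g)" by simp
      ultimately have lower: "(1 - e) * (g * E) \<le> measure (cpow (trunc \<mu> (b n)) m) {u..u + \<Delta>}" using low by linarith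
      show "\<bar>measure (cpow (trunc \<mu> (real n powr (1 / 2 - \<kappa>))) m) {u..u + \<Delta>} - gauss_local m u \<Delta>\<bar> \<le> e * gauss_local m u \<Delta>"
        unfolding G b_def[symmetric] using upper lower by (simp add: abs_le_iff algebra_simps)
    qed
  qed
qed

text \<open>When few steps remain, a distance of order \<open>sqrt n\<close> is out of reach of the truncated walk.\<close>

lemma trunc_chernoff:
  fixes \<kappa> \<delta> c :: real
  assumes \<delta>: "\<delta> > 0" and mom: "integrable \<mu> (\<lambda>x. \<bar>x\<bar> powr (2 + \<delta>))"
    and \<kappa>: "0 < \<kappa>" "\<kappa> * (2 + \<delta>) \<le> \<delta> / 8" and c: "c > 0"
  shows "\<forall>\<^sub>F n in sequentially. \<forall>m S. real m \<le> real n powr (1 - \<kappa> / 4) \<longrightarrow> S \<in> sets borel \<longrightarrow>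
     (\<forall>s\<in>S. s \<ge> c * sqrt (real n)) \<or> (\<forall>s\<in>S. s \<le> - c * sqrt (real n)) \<longrightarrow>
     measure (cpow (trunc \<mu> (real n powr (1 / 2 - \<kappa>))) m) S \<le> exp (\<sigma>\<^sup>2 / 2 + 1 - c * real n powr (\<kappa> / 8))"
proof -
  have tc: "tilt_const > 0" using tilt_const_ge by linarith
  define \<zeta> where "\<zeta> = min (1 / 16) (1 / tilt_const)"
  have \<zeta>: "\<zeta> > 0" "\<zeta> \<le> 1 / 16" using tc by (auto simp: \<zeta>_def)
  have "\<zeta> \<le> 1 / tilt_const" by (auto simp: \<zeta>_def)
  then have \<zeta>': "\<zeta> * tilt_const \<le> 1" using tc by (simp add: pos_le_divide_eq)
  define M where "M = (LINT x|\<mu>. \<bar>x\<bar> powr (2 + \<delta>))"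
  define b where "b n = real n powr (1 / 2 - \<kappa>)" for n :: nat
  define t where "t n = M * b n powr (- (2 + \<delta>))" for n
  \<comment> \<open>the tilt is taken as large as \<open>m \<beta>\<^sup>2 \<le> 1\<close> allows for all the m considered\<close>
  define B where "B n = real n powr (\<kappa> / 8 - 1 / 2)" for n :: nat
  note \<kappa>3 = truncation_rates(1)[OF \<delta> \<kappa>]
  note rates = truncation_rates(2-4)[OF \<delta> \<kappa>, where M = M, folded b_def, folded t_def]
  note lim3 = rates(1) and lim4 = rates(2) and lim5 = rates(3)
  have lim1: "(\<lambda>n. B n * b n) \<longlonglongrightarrow> 0"
    unfolding B_def b_def using \<kappa>(1) by real_asymp
  note ev = order_tendstoD(2)[OF lim1 \<zeta>(1)] order_tendstoD(2)[OF lim3 \<zeta>(1)]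
    order_tendstoD(2)[OF lim4 \<zeta>(1)] order_tendstoD(2)[OF lim5 \<zeta>(1)]
  show ?thesis
    using ev eventually_ge_at_top[of 1]
  proof eventually_elim
    case (elim n)
    show ?case
    proof (intro allI impI)
      fix m :: nat and S :: "real set"
      assume m: "real m \<le> real n powr (1 - \<kappa> / 4)" and S: "S \<in> sets borel"
        and dir: "(\<forall>s\<in>S. s \<ge> c * sqrt (real n)) \<or> (\<forall>s\<in>S. s \<le> - c * sqrt (real n))"
      have n1: "real n \<ge> 1" using elim by simp
      have cn: "c * sqrt (real n) > 0" using c n1 by simp
      define \<beta> where "\<beta> = (if \<forall>s\<in>S. s \<ge> c * sqrt (real n) then B n else - B n)"
      have B0: "B n > 0" using n1 by (simp add: B_def)
      have \<beta>B: "\<bar>\<beta>\<bar> = B n" using B0 by (simp add: \<beta>_def)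
      have \<beta>2: "\<beta>\<^sup>2 = real n powr (\<kappa> / 4 - 1)"
      proof -
        have "\<beta>\<^sup>2 = (B n)\<^sup>2" by (metis \<beta>B power2_abs)
        also have "\<dots> = real n powr (\<kappa> / 4 - 1)"
          unfolding B_def using n1 by (simp add: power2_eq_square powr_add[symmetric] algebra_simps)
        finally show ?thesis .
      qed
      have \<beta>S: "c * real n powr (\<kappa> / 8) \<le> \<beta> * s" if "s \<in> S" for s
      proof -
        have "B n * (c * sqrt (real n)) = c * real n powr (\<kappa> / 8)"
          unfolding B_def powr_half_sqrt[OF of_nat_0_le_iff, symmetric]
          using n1 by (simp add: powr_add[symmetric])
        moreover have "B n * (c * sqrt (real n)) \<le> \<beta> * s"
        proof (cases "\<forall>s\<in>S. s \<ge> c * sqrt (real n)")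
          case True
          then show ?thesis using that B0 by (simp add: \<beta>_def)
        next
          case False
          then have "s \<le> - c * sqrt (real n)" using dir that by blast
          then have "B n * (c * sqrt (real n)) \<le> B n * (- s)" using B0 by (intro mult_left_mono) auto
          moreover have "\<beta> = - B n" unfolding \<beta>_def by (rule if_not_P[OF False])
          ultimately show ?thesis by simp
        qed
        ultimately show ?thesis by linarith
      qed
      show "measure (cpow (trunc \<mu> (real n powr (1 / 2 - \<kappa>))) m) S \<le> exp (\<sigma>\<^sup>2 / 2 + 1 - c * real n powr (\<kappa> / 8))"
      proof (cases "m = 0")
        case True
        have "0 \<notin> S" using dir cn by force
        then show ?thesis using True S by (simp add: measure_return)
      next
        case False
        then have mm: "m > 0" by simp
        have mn: "real m \<le> real n"
          using m powr_mono[of "1 - \<kappa> / 4" 1 "real n"] n1 \<kappa>(1) by simp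
        have bn: "b n \<ge> 1" unfolding b_def using n1 \<kappa>3 by (intro ge_one_powr_ge_zero) auto
        have mQ: "real m * \<beta>\<^sup>2 \<le> 1"
        proof -
          have "real m * \<beta>\<^sup>2 \<le> real n powr (1 - \<kappa> / 4) * real n powr (\<kappa> / 4 - 1)"
            unfolding \<beta>2 using m by (rule mult_right_mono) simp
          also have "\<dots> = 1" using n1 by (simp add: powr_add[symmetric])
          finally show ?thesis .
        qed
        have M0: "M \<ge> 0" unfolding M_def by (simp add: integral_nonneg_AE)
        have tn: "t n \<ge> 0" unfolding t_def using M0 by simp
        have tb: "tail_bound (b n) (t n)"
          unfolding t_def M_def using bn by (intro tail_bound_moment[OF \<delta> mom]) simp
        have h: "\<bar>\<beta>\<bar> * b n \<le> \<zeta>" unfolding \<beta>B using elim by linarith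
        have hQ: "\<bar>\<beta>\<bar> * b n * (real m * \<beta>\<^sup>2) \<le> \<zeta>"
          using mult_mono[OF h mQ] \<zeta> by simp
        have mt: "real m * t n \<le> \<zeta>" using elim mult_right_mono[OF mn tn] by linarith
        have t1: "sqrt (real m) * (t n * b n) \<le> \<zeta>"
        proof -
          have "sqrt (real m) * (t n * b n) \<le> sqrt (real n) * (t n * b n)"
            using mn tn bn by (intro mult_right_mono) auto
          then show ?thesis using elim by linarith
        qed
        have t2: "t n * (b n)\<^sup>2 \<le> \<zeta>" using elim by simp
        have t3: "sqrt (real m) * \<bar>\<beta>\<bar> * (t n * (b n)\<^sup>2) \<le> \<zeta>"
        proof -
          have "sqrt (real m) * \<bar>\<beta>\<bar> = sqrt (real m * \<beta>\<^sup>2)" by (simp add: real_sqrt_mult)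
          also have "\<dots> \<le> 1" using mQ by simp
          finally have "sqrt (real m) * \<bar>\<beta>\<bar> * (t n * (b n)\<^sup>2) \<le> 1 * (t n * (b n)\<^sup>2)"
            using tn by (intro mult_right_mono) auto
          then show ?thesis using elim by linarith
        qed
        note est = tilt_estimates[OF \<zeta> bn mm tb h hQ mt t1 t2 t3]
        let ?Z = "tilt_mass \<mu> (b n) \<beta>" and ?\<rho> = "tilt \<mu> (b n) \<beta>"
        have Z: "?Z > 0" by (rule est(1))
        interpret R: step_law ?\<rho> by (rule step_law_tilt(1)[OF Z])
        interpret RC: step_law "cpow ?\<rho> m" by (rule R.step_law_cpow)
        have Zm: "?Z ^ m = exp (real m * ln ?Z)" using Z by (simp add: exp_of_nat_mult)
        have "real m * \<beta>\<^sup>2 * \<sigma>\<^sup>2 \<le> 1 * \<sigma>\<^sup>2" by (rule mult_right_mono[OF mQ]) simp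
        then have lnZ: "real m * ln ?Z \<le> \<sigma>\<^sup>2 / 2 + 1" using est(3) \<zeta>' by linarith
        have "measure (cpow (trunc \<mu> (b n)) m) S \<le> ?Z ^ m * exp (- (c * real n powr (\<kappa> / 8))) * measure (cpow ?\<rho> m) S"
          by (rule measure_cpow_trunc_le[OF Z S]) (use \<beta>S in auto)
        also have "\<dots> \<le> ?Z ^ m * exp (- (c * real n powr (\<kappa> / 8))) * 1"
          using Z by (intro mult_left_mono RC.measure_le_1) auto
        also have "\<dots> \<le> exp (\<sigma>\<^sup>2 / 2 + 1) * exp (- (c * real n powr (\<kappa> / 8)))"
          unfolding Zm using lnZ by simp
        finally show ?thesis by (simp add: b_def exp_add[symmetric])
      qed
    qed
  qed
qed

end

section \<open>The killed walk and the discrete reflection principle\<close>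

text \<open>For a walk with step law \<open>\<nu>\<close> started at x, the mass of the paths of m steps that stay in \<open>[0, \<infinity>)\<close> at the times
  1 to m and end in S. The start itself is not tested; recursion is on the first step.\<close>

primrec kill :: "real measure \<Rightarrow> real set \<Rightarrow> nat \<Rightarrow> real \<Rightarrow> real" where
  "kill \<nu> S 0 x = indicator S x"
| "kill \<nu> S (Suc m) x = (LINT w|\<nu>. indicator {0..} (x + w) * kill \<nu> S m (x + w))"

text \<open>The same without killing.\<close>

definition free :: "real measure \<Rightarrow> real set \<Rightarrow> nat \<Rightarrow> real \<Rightarrow> real" where
  "free \<nu> S m x = (LINT s|cpow \<nu> m. indicator S (x + s))"

context step_law
begin

lemma kill_measurable [measurable (raw)]:
  assumes [measurable]: "S \<in> sets borel"
  shows "kill \<nu> S m \<in> borel_measurable borel"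
proof (induction m)
  case 0
  have "kill \<nu> S 0 = indicator S" by (simp add: fun_eq_iff)
  then show ?case by simp
next
  case (Suc m)
  note [measurable] = Suc
  have "kill \<nu> S (Suc m) = (\<lambda>x. LINT w|\<nu>. indicator {0..} (x + w) * kill \<nu> S m (x + w))" by (simp add: fun_eq_iff)
  then show ?case by simp
qed

lemma kill_bounds:
  assumes S: "S \<in> sets borel"
  shows "0 \<le> kill \<nu> S m x" "kill \<nu> S m x \<le> 1"
proof -
  have "0 \<le> kill \<nu> S m x \<and> kill \<nu> S m x \<le> 1"
  proof (induction m arbitrary: x)
    case 0
    show ?case by (simp add: indicator_def)
  next
    case (Suc m)
    have "0 \<le> kill \<nu> S (Suc m) x" by (simp add: integral_nonneg_AE Suc)
    moreover have "kill \<nu> S (Suc m) x \<le> 1"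
      unfolding kill.simps by (rule integral_le_const) (use Suc in \<open>auto simp: indicator_def\<close>)
    ultimately show ?case ..
  qed
  then show "0 \<le> kill \<nu> S m x" "kill \<nu> S m x \<le> 1" by simp_all
qed

lemma integrable_kill:
  assumes [measurable]: "S \<in> sets borel" and "step_law \<nu>'"
  shows "integrable \<nu> (\<lambda>w. indicator {0..} (x + w) * kill \<nu>' S m (x + w))"
proof (rule integrable_bounded[of _ 1])
  interpret N: step_law \<nu>' by fact
  note [measurable] = N.kill_measurable
  show "(\<lambda>w. indicator {0..} (x + w) * kill \<nu>' S m (x + w)) \<in> borel_measurable borel" by measurable
  show "norm (indicator {0..} (x + w) * kill \<nu>' S m (x + w)) \<le> 1" for w
    using N.kill_bounds[OF assms(1), of m "x + w"] by (simp add: indicator_def)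
qed

lemma free_measurable [measurable (raw)]:
  assumes [measurable]: "S \<in> sets borel"
  shows "free \<nu> S m \<in> borel_measurable borel"
proof -
  interpret N: step_law "cpow \<nu> m" by (rule step_law_cpow)
  have "free \<nu> S m = (\<lambda>x. LINT s|cpow \<nu> m. indicator S (x + s))" by (simp add: fun_eq_iff free_def)
  then show ?thesis by simp
qed

lemma free_bounds: "0 \<le> free \<nu> S m x" "free \<nu> S m x \<le> 1"
proof -
  interpret N: step_law "cpow \<nu> m" by (rule step_law_cpow)
  show "0 \<le> free \<nu> S m x" unfolding free_def by (rule integral_nonneg_AE) simp
  show "free \<nu> S m x \<le> 1" unfolding free_def by (rule N.integral_le_const) (auto simp: indicator_def)
qed

lemma free_0: "S \<in> sets borel \<Longrightarrow> free \<nu> S 0 x = indicator S x"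
  by (simp add: free_def integral_return)

lemma free_Suc:
  assumes [measurable]: "S \<in> sets borel"
  shows "free \<nu> S (Suc m) x = (LINT w|\<nu>. free \<nu> S m (x + w))"
  unfolding free_def by (subst integral_cpow_Suc[of _ 1]) (auto simp: add.assoc indicator_def)

lemma free_Icc: "free \<nu> {y..y + \<Delta>} m x = measure (cpow \<nu> m) {y - x..(y - x) + \<Delta>}"
proof -
  interpret N: step_law "cpow \<nu> m" by (rule step_law_cpow)
  have "(\<lambda>s. indicator {y..y + \<Delta>} (x + s)) = (indicator {y - x..(y - x) + \<Delta>} :: real \<Rightarrow> real)"
    by (auto simp: indicator_def fun_eq_iff)
  then show ?thesis by (simp add: free_def)
qed

lemma integrable_free:
  assumes [measurable]: "S \<in> sets borel" and N: "step_law \<nu>'"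
  shows "integrable \<nu> (\<lambda>w. free \<nu>' S m (x + w))"
proof (rule integrable_bounded[of _ 1])
  interpret N: step_law \<nu>' by fact
  note [measurable] = N.free_measurable
  show "(\<lambda>w. free \<nu>' S m (x + w)) \<in> borel_measurable borel" by measurable
  show "norm (free \<nu>' S m (x + w)) \<le> 1" for w
    using N.free_bounds[of S m "x + w"] by simp
qed

lemma kill_le_free:
  assumes S: "S \<in> sets borel"
  shows "kill \<nu> S m x \<le> free \<nu> S m x"
proof (induction m arbitrary: x)
  case 0
  then show ?case by (simp add: free_0 S)
next
  case (Suc m)
  show ?case
    unfolding free_Suc[OF S] kill.simps
  proof (rule integral_mono)
    show "integrable \<nu> (\<lambda>w. indicator {0..} (x + w) * kill \<nu> S m (x + w))" by (rule integrable_kill[OF S step_law_axioms])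
    show "integrable \<nu> (\<lambda>w. free \<nu> S m (x + w))" by (rule integrable_free[OF S step_law_axioms])
    show "indicator {0..} (x + w) * kill \<nu> S m (x + w) \<le> free \<nu> S m (x + w)" for w
      using Suc[of "x + w"] free_bounds[of S m "x + w"] by (simp add: indicator_def)
  qed
qed

text \<open>Discrete reflection. Let the mirror target \<open>S'\<close> lie below zero. A path from \<open>x \<ge> 0\<close> to \<open>S'\<close> must enter the negative
  half-line, and a path to \<open>S\<close> that is killed does so as well. If from every possible first negative position
  the two targets have almost equal mass, then so do they for the paths from x. Recursion on the first
  step replaces a decomposition at the exit time.\<close>

lemma discrete_reflection:
  assumes S: "S \<in> sets borel" and S': "S' \<in> sets borel" and neg: "S' \<subseteq> {..<0}"
    and supp: "AE w in \<nu>. - b \<le> w" and e: "e0 \<ge> 0" "e1 \<ge> 0"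
    and H: "\<And>m z. m < n \<Longrightarrow> - b \<le> z \<Longrightarrow> z < 0 \<Longrightarrow> \<bar>free \<nu> S m z - free \<nu> S' m z\<bar> \<le> e0 * free \<nu> S' m z + e1"
    and m: "m \<le> n" and x: "x \<ge> 0"
  shows "\<bar>free \<nu> S m x - kill \<nu> S m x - free \<nu> S' m x\<bar> \<le> e0 * free \<nu> S' m x + e1"
  using m x
proof (induction m arbitrary: x)
  case 0
  then have "x \<notin> S'" using neg by auto
  then show ?case using e by (simp add: free_0 S S')
next
  case (Suc m)
  let ?A = "\<lambda>w. free \<nu> S m (x + w) - indicator {0..} (x + w) * kill \<nu> S m (x + w) - free \<nu> S' m (x + w)"
  have i: "integrable \<nu> (\<lambda>w. free \<nu> S m (x + w))" "integrable \<nu> (\<lambda>w. free \<nu> S' m (x + w))"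
    "integrable \<nu> (\<lambda>w. indicator {0..} (x + w) * kill \<nu> S m (x + w))"
    by (rule integrable_free[OF S step_law_axioms] integrable_free[OF S' step_law_axioms] integrable_kill[OF S step_law_axioms])+
  have eq: "free \<nu> S (Suc m) x - kill \<nu> S (Suc m) x - free \<nu> S' (Suc m) x = (LINT w|\<nu>. ?A w)"
    unfolding free_Suc[OF S] free_Suc[OF S'] kill.simps using i by simp
  have "\<bar>free \<nu> S (Suc m) x - kill \<nu> S (Suc m) x - free \<nu> S' (Suc m) x\<bar> \<le> (LINT w|\<nu>. \<bar>?A w\<bar>)"
    unfolding eq by (rule integral_abs_bound)
  also have "\<dots> \<le> (LINT w|\<nu>. e0 * free \<nu> S' m (x + w) + e1)"
  proof (rule integral_mono_AE)
    show "integrable \<nu> (\<lambda>w. \<bar>?A w\<bar>)" using i by simp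
    show "integrable \<nu> (\<lambda>w. e0 * free \<nu> S' m (x + w) + e1)" using i by simp
    show "AE w in \<nu>. \<bar>?A w\<bar> \<le> e0 * free \<nu> S' m (x + w) + e1"
      using supp
    proof eventually_elim
      case (elim w)
      show ?case
      proof (cases "x + w \<ge> 0")
        case True
        then show ?thesis using Suc.IH[of "x + w"] Suc.prems by simp
      next
        case False
        then show ?thesis using H[of m "x + w"] Suc.prems elim by simp
      qed
    qed
  qed
  also have "\<dots> = e0 * free \<nu> S' (Suc m) x + measure \<nu> UNIV * e1"
    unfolding free_Suc[OF S'] using i by simp
  also have "\<dots> \<le> e0 * free \<nu> S' (Suc m) x + 1 * e1"
    by (intro add_left_mono mult_right_mono measure_le_1 e)
  finally show ?case by simp
qed

lemma integral_trunc:
  fixes h :: "real \<Rightarrow> real"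
  assumes [measurable]: "h \<in> borel_measurable borel"
  shows "(LINT w|trunc \<nu> b. h w) = (LINT w|\<nu>. indicator {- b..b} w * h w)"
proof -
  have "trunc \<nu> b = density \<nu> (\<lambda>w. ennreal (indicator {- b..b} w))"
    unfolding trunc_def by (simp add: ennreal_indicator)
  then show ?thesis by (simp add: integral_density)
qed

lemma AE_trunc: "AE w in trunc \<nu> b. - b \<le> w"
  unfolding trunc_def by (subst AE_density) (auto simp: indicator_def)

text \<open>Cost of truncating the steps: after the first large step the walk is bounded by a free walk with the
  remaining number of steps.\<close>

lemma kill_trunc_diff:
  assumes S: "S \<in> sets borel" and G: "\<And>m x. m < n \<Longrightarrow> free \<nu> S m x \<le> G m" and m: "m \<le> n"
  shows "0 \<le> kill \<nu> S m x - kill (trunc \<nu> b) S m x \<and>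
    kill \<nu> S m x - kill (trunc \<nu> b) S m x \<le> measure \<nu> (- {- b..b}) * (\<Sum>k<m. G k)"
  using m
proof (induction m arbitrary: x)
  case 0
  show ?case by simp
next
  case (Suc m)
  interpret T: step_law "trunc \<nu> b" by (rule step_law_trunc)
  note [measurable] = S T.kill_measurable
  define D where "D y = kill \<nu> S m y - kill (trunc \<nu> b) S m y" for y
  define A where "A w = indicator {0..} (x + w) * kill \<nu> S m (x + w) -
      indicator {- b..b} w * (indicator {0..} (x + w) * kill (trunc \<nu> b) S m (x + w))" for w
  have i1: "integrable \<nu> (\<lambda>w. indicator {0..} (x + w) * kill \<nu> S m (x + w))" by (rule integrable_kill[OF S step_law_axioms])
  have i2: "integrable \<nu> (\<lambda>w. indicator {- b..b} w * (indicator {0..} (x + w) * kill (trunc \<nu> b) S m (x + w)))"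
  proof (rule integrable_bounded[of _ 1])
    show "norm (indicator {- b..b} w * (indicator {0..} (x + w) * kill (trunc \<nu> b) S m (x + w))) \<le> 1" for w
      using T.kill_bounds[OF S, of m "x + w"] by (simp add: indicator_def)
  qed measurable
  have iA: "integrable \<nu> A" unfolding A_def using i1 i2 by simp
  have eq: "kill \<nu> S (Suc m) x - kill (trunc \<nu> b) S (Suc m) x = (LINT w|\<nu>. A w)"
    unfolding kill.simps A_def by (subst integral_trunc) (use i1 i2 in auto)
  have IH: "0 \<le> D y" "D y \<le> measure \<nu> (- {- b..b}) * (\<Sum>k<m. G k)" for y
    unfolding D_def using Suc by auto
  have kf: "kill \<nu> S m y \<le> G m" "0 \<le> kill \<nu> S m y" for y
    using kill_le_free[OF S, of m y] G[of m y] kill_bounds[OF S, of m y] Suc.prems by auto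
  have A0: "0 \<le> A w" for w
    using IH(1)[of "x + w"] kf(2)[of "x + w"] by (auto simp: A_def D_def indicator_def)
  have nn: "0 \<le> kill \<nu> S (Suc m) x - kill (trunc \<nu> b) S (Suc m) x"
    unfolding eq by (rule integral_nonneg_AE) (simp add: A0)
  let ?c = "measure \<nu> (- {- b..b}) * (\<Sum>k<m. G k)"
  have c0: "?c \<ge> 0" using IH[of 0] by linarith
  have G0: "G m \<ge> 0" using kf[of 0] by linarith
  have "(LINT w|\<nu>. A w) \<le> (LINT w|\<nu>. ?c + G m * indicator (- {- b..b}) w)"
  proof (rule integral_mono[OF iA])
    show "integrable \<nu> (\<lambda>w. ?c + G m * indicator (- {- b..b}) w)"
      by (intro Bochner_Integration.integrable_add integrable_mult_right integrable_bounded[of "indicator (- {- b..b})" 1])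
        (auto simp: indicator_def)
    show "A w \<le> ?c + G m * indicator (- {- b..b}) w" for w
      using IH(2)[of "x + w"] kf(1)[of "x + w"] c0 G0 by (auto simp: A_def D_def indicator_def)
  qed
  also have "\<dots> = measure \<nu> UNIV * ?c + G m * measure \<nu> (- {- b..b})"
  proof -
    have "integrable \<nu> (indicator (- {- b..b}) :: real \<Rightarrow> real)"
      by (rule integrable_bounded[of _ 1]) (auto simp: indicator_def)
    then show ?thesis by simp
  qed
  also have "\<dots> \<le> 1 * ?c + G m * measure \<nu> (- {- b..b})"
    by (intro add_right_mono mult_right_mono measure_le_1 c0)
  finally have up: "kill \<nu> S (Suc m) x - kill (trunc \<nu> b) S (Suc m) x \<le> measure \<nu> (- {- b..b}) * (\<Sum>k<Suc m. G k)"
    unfolding eq by (simp add: algebra_simps)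
  show ?case using nn up by (rule conjI)
qed

end

section \<open>Identification with the original probability space\<close>

lemma (in prob_space) expectation_indep:
  fixes \<phi> :: "'b \<Rightarrow> 'b \<Rightarrow> real"
  assumes ind: "indep_var N U N' V" and [measurable]: "(\<lambda>(u, v). \<phi> u v) \<in> borel_measurable (N \<Otimes>\<^sub>M N')"
    and bd: "\<And>u v. \<bar>\<phi> u v\<bar> \<le> 1"
  shows "expectation (\<lambda>\<omega>. \<phi> (U \<omega>) (V \<omega>)) = expectation (\<lambda>\<omega>. LINT v|distr M N' V. \<phi> (U \<omega>) v)"
proof -
  have [measurable]: "U \<in> measurable M N" "V \<in> measurable M N'"
    using indep_var_rv1[OF ind] indep_var_rv2[OF ind] by auto
  interpret DU: prob_space "distr M N U" by (rule prob_space_distr) simp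
  interpret DV: prob_space "distr M N' V" by (rule prob_space_distr) simp
  interpret P: pair_prob_space "distr M N U" "distr M N' V" ..
  have eq: "distr M N U \<Otimes>\<^sub>M distr M N' V = distr M (N \<Otimes>\<^sub>M N') (\<lambda>\<omega>. (U \<omega>, V \<omega>))"
    using ind unfolding indep_var_distribution_eq by blast
  have "expectation (\<lambda>\<omega>. \<phi> (U \<omega>) (V \<omega>)) = (LINT p|(distr M (N \<Otimes>\<^sub>M N') (\<lambda>\<omega>. (U \<omega>, V \<omega>))). (case p of (u, v) \<Rightarrow> \<phi> u v))"
    by (subst integral_distr) auto
  also have "\<dots> = (LINT p|(distr M N U \<Otimes>\<^sub>M distr M N' V). (case p of (u, v) \<Rightarrow> \<phi> u v))"
    unfolding eq ..
  also have "\<dots> = (LINT u|distr M N U. LINT v|distr M N' V. \<phi> u v)"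
  proof (rule P.integral_fst'[symmetric, of "\<lambda>p. case p of (u, v) \<Rightarrow> \<phi> u v", simplified])
    show "integrable (distr M N U \<Otimes>\<^sub>M distr M N' V) (\<lambda>p. case p of (u, v) \<Rightarrow> \<phi> u v)"
    proof (rule P.integrable_const_bound[of _ 1])
      show "AE p in distr M N U \<Otimes>\<^sub>M distr M N' V. norm (case p of (u, v) \<Rightarrow> \<phi> u v) \<le> 1"
        using bd by (intro AE_I2) (auto split: prod.split)
    qed measurable
  qed
  also have "\<dots> = expectation (\<lambda>\<omega>. LINT v|distr M N' V. \<phi> (U \<omega>) v)"
    by (subst integral_distr) auto
  finally show ?thesis .
qed

lemma exit_time_gt_iff: "exit_time X x \<omega> > enat n \<longleftrightarrow> (\<forall>k\<in>{1..n}. 0 \<le> x + walk X k \<omega>)"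
proof -
  have "exit_time X x \<omega> > enat n \<longleftrightarrow> enat (Suc n) \<le> Inf {enat k | k. k \<ge> 1 \<and> x + walk X k \<omega> < 0}"
    unfolding exit_time_def Suc_ile_eq ..
  also have "\<dots> \<longleftrightarrow> (\<forall>k\<ge>1. x + walk X k \<omega> < 0 \<longrightarrow> Suc n \<le> k)"
    unfolding le_Inf_iff by auto
  also have "\<dots> \<longleftrightarrow> (\<forall>k\<in>{1..n}. 0 \<le> x + walk X k \<omega>)"
  proof safe
    fix k assume "\<forall>k\<ge>1. x + walk X k \<omega> < 0 \<longrightarrow> Suc n \<le> k" "k \<in> {1..n}"
    then show "0 \<le> x + walk X k \<omega>" by (rule_tac ccontr) force
  next
    fix k :: nat assume *: "\<forall>k\<in>{1..n}. 0 \<le> x + walk X k \<omega>" "1 \<le> k" "x + walk X k \<omega> < 0"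
    show "Suc n \<le> k"
    proof (rule ccontr)
      assume "\<not> Suc n \<le> k"
      then have "k \<in> {1..n}" using *(2) by simp
      then show False using *(1,3) by force
    qed
  qed
  finally show ?thesis .
qed

lemma walk_Suc: "walk X (Suc k) \<omega> = walk X k \<omega> + X (Suc k) \<omega>"
  by (simp add: walk_def)

text \<open>The expectation of \<open>kill \<mu> S (n - k) (x + walk X k)\<close> on the event of survival up to time k does not depend on k, by
  independence of the step k + 1 from the past; k = 0 and k = n give the two sides.\<close>

lemma (in prob_space) measure_eq_kill:
  fixes X :: "nat \<Rightarrow> 'a \<Rightarrow> real" and \<mu> :: "real measure"
  assumes ind: "indep_vars (\<lambda>_. borel) X {1..}" and dist: "\<And>i. i \<ge> 1 \<Longrightarrow> distr M borel (X i) = \<mu>"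
    and S [measurable]: "S \<in> sets borel"
  shows "prob {\<omega> \<in> space M. x + walk X n \<omega> \<in> S \<and> exit_time X x \<omega> > enat n} = kill \<mu> S n x"
proof -
  have rv: "X i \<in> borel_measurable M" if "i \<ge> 1" for i
    using ind that unfolding indep_vars_def2 by auto
  have \<mu>: "step_law \<mu>"
  proof (rule step_law.intro)
    have "prob_space (distr M borel (X 1))" by (rule prob_space_distr) (simp add: rv)
    then show "subprob_space \<mu>" using dist[of 1] by (simp add: prob_space_imp_subprob_space)
    show "step_law_axioms \<mu>" by (rule step_law_axioms.intro) (use dist[of 1] in auto)
  qed
  interpret \<mu>: step_law \<mu> by (rule \<mu>)
  note [measurable] = \<mu>.kill_measurable
  define al where "al k \<omega> = (if \<forall>j\<in>{1..k}. 0 \<le> x + walk X j \<omega> then 1 else 0 :: real)" for k \<omega>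
  \<comment> \<open>survival up to time k as a function of the first k coordinates\<close>
  define av where "av k v = (if \<forall>j\<in>{1..k}. 0 \<le> x + (\<Sum>i=1..j. v i) then 1 else 0 :: real)" for k and v :: "nat \<Rightarrow> real"
  have step: "expectation (\<lambda>\<omega>. al k \<omega> * kill \<mu> S (Suc p) (x + walk X k \<omega>)) =
    expectation (\<lambda>\<omega>. al (Suc k) \<omega> * kill \<mu> S p (x + walk X (Suc k) \<omega>))" for k p
  proof -
    let ?N = "PiM {1..k} (\<lambda>_. borel :: real measure)" and ?N' = "PiM {Suc k} (\<lambda>_. borel :: real measure)"
    let ?U = "\<lambda>\<omega>. restrict (\<lambda>i. X i \<omega>) {1..k}" and ?V = "\<lambda>\<omega>. restrict (\<lambda>i. X i \<omega>) {Suc k}"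
    have iv: "indep_var ?N ?U ?N' ?V"
      by (rule indep_var_restrict[OF ind]) auto
    have [measurable]: "X (Suc k) \<in> borel_measurable M" by (rule rv) simp
    have [measurable]: "?V \<in> measurable M ?N'" using indep_var_rv2[OF iv] .
    have s: "(\<lambda>v. \<Sum>i=1..j. v i) \<in> borel_measurable ?N" if "j \<le> k" for j
      by (rule borel_measurable_sum) (use that in \<open>auto intro!: measurable_component_singleton\<close>)
    have [measurable]: "(\<lambda>v. \<Sum>i=1..k. v i) \<in> borel_measurable ?N" by (rule s) simp
    have [measurable]: "av k \<in> borel_measurable ?N"
      unfolding av_def
    proof (rule measurable_If)
      have "{v \<in> space ?N. 0 \<le> x + (\<Sum>i=1..j. v i)} \<in> sets ?N" if "j \<in> {1..k}" for j
        using that by (intro borel_measurable_le borel_measurable_add s) auto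
      then show "{v \<in> space ?N. \<forall>j\<in>{1..k}. 0 \<le> x + (\<Sum>i=1..j. v i)} \<in> sets ?N"
        by (intro sets.sets_Collect_finite_All) auto
    qed auto
    have [measurable]: "(\<lambda>v. v (Suc k)) \<in> borel_measurable ?N'"
      by (rule measurable_component_singleton) simp
    have w: "(\<Sum>i=1..j. ?U \<omega> i) = walk X j \<omega>" if "j \<le> k" for j \<omega>
      unfolding walk_def by (rule sum.cong) (use that in auto)
    have avU: "av k (?U \<omega>) = al k \<omega>" for \<omega>
      unfolding av_def al_def using w by (intro if_cong ball_cong refl) auto
    define \<phi> where "\<phi> u v = av k u * (indicator {0..} (x + (\<Sum>i=1..k. u i) + v (Suc k)) * kill \<mu> S p (x + (\<Sum>i=1..k. u i) + v (Suc k)))"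
      for u v :: "nat \<Rightarrow> real"
    have kb: "0 \<le> kill \<mu> S p y" "kill \<mu> S p y \<le> 1" for y by (rule \<mu>.kill_bounds[OF S])+
    have "expectation (\<lambda>\<omega>. \<phi> (?U \<omega>) (?V \<omega>)) = expectation (\<lambda>\<omega>. LINT v|distr M ?N' ?V. \<phi> (?U \<omega>) v)"
    proof (rule expectation_indep[OF iv])
      show "(\<lambda>(u, v). \<phi> u v) \<in> borel_measurable (?N \<Otimes>\<^sub>M ?N')"
        unfolding \<phi>_def by measurable
      show "\<bar>\<phi> u v\<bar> \<le> 1" for u v
        using kb[of "x + (\<Sum>i=1..k. u i) + v (Suc k)"] by (auto simp: \<phi>_def av_def indicator_def)
    qed
    moreover have "(LINT v|distr M ?N' ?V. \<phi> (?U \<omega>) v) = al k \<omega> * kill \<mu> S (Suc p) (x + walk X k \<omega>)" for \<omega>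
    proof -
      let ?h = "\<lambda>z. indicator {0..} (x + walk X k \<omega> + z) * kill \<mu> S p (x + walk X k \<omega> + z)"
      have "(LINT v|distr M ?N' ?V. \<phi> (?U \<omega>) v) = (LINT v|distr M ?N' ?V. al k \<omega> * ?h (v (Suc k)))"
        unfolding \<phi>_def avU w[OF order_refl] ..
      also have "\<dots> = al k \<omega> * (LINT v|distr M ?N' ?V. ?h (v (Suc k)))" by (rule integral_mult_right_zero)
      also have "(LINT v|distr M ?N' ?V. ?h (v (Suc k))) = (LINT \<omega>'|M. ?h (X (Suc k) \<omega>'))"
        by (subst integral_distr) auto
      also have "\<dots> = (LINT z|distr M borel (X (Suc k)). ?h z)"
        by (subst integral_distr) auto
      also have "\<dots> = kill \<mu> S (Suc p) (x + walk X k \<omega>)"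
        using dist[of "Suc k"] by simp
      finally show ?thesis .
    qed
    moreover have "\<phi> (?U \<omega>) (?V \<omega>) = al (Suc k) \<omega> * kill \<mu> S p (x + walk X (Suc k) \<omega>)" for \<omega>
    proof -
      have "al (Suc k) \<omega> = al k \<omega> * indicator {0..} (x + walk X k \<omega> + X (Suc k) \<omega>)"
        unfolding al_def by (auto simp: atLeastAtMostSuc_conv walk_Suc add.assoc indicator_def)
      then show ?thesis unfolding \<phi>_def avU w[OF order_refl] by (simp add: walk_Suc add.assoc)
    qed
    ultimately show ?thesis by simp
  qed
  have "expectation (\<lambda>\<omega>. al k \<omega> * kill \<mu> S (n - k) (x + walk X k \<omega>)) = kill \<mu> S n x" if "k \<le> n" for k
    using that
  proof (induction k)
    case 0
    then show ?case by (simp add: al_def walk_def prob_space)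
  next
    case (Suc k)
    then have "n - k = Suc (n - Suc k)" by simp
    then show ?case using Suc step[of k "n - Suc k"] by simp
  qed
  from this[of n] have "kill \<mu> S n x = expectation (\<lambda>\<omega>. al n \<omega> * indicator S (x + walk X n \<omega>))" by simp
  also have "\<dots> = expectation (\<lambda>\<omega>. indicator {\<omega> \<in> space M. x + walk X n \<omega> \<in> S \<and> exit_time X x \<omega> > enat n} \<omega>)"
    by (intro Bochner_Integration.integral_cong) (auto simp: al_def exit_time_gt_iff indicator_def)
  also have "\<dots> = prob {\<omega> \<in> space M. x + walk X n \<omega> \<in> S \<and> exit_time X x \<omega> > enat n}"
    by (auto intro!: arg_cong[where f = prob])
  finally show ?thesis by simp
qed

section \<open>Uniform local asymptotics of the killed walk\<close>

lemma sum_inverse_sqrt_le: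
  assumes "K \<ge> 0"
  shows "(\<Sum>m<Suc n. if m = 0 then 1 else K / sqrt (real m)) \<le> 1 + 2 * K * sqrt (real n)"
proof (induction n)
  case (Suc n)
  let ?a = "sqrt (real (Suc n))" and ?b = "sqrt (real n)"
  have "?b \<le> ?a" by simp
  moreover have a: "?a > 0" by simp
  ultimately have "0 \<le> (?a - ?b)\<^sup>2" by simp
  then have "2 * ?a * ?b \<le> ?a\<^sup>2 + ?b\<^sup>2" by (simp add: power2_diff)
  then have "2 * ?b * ?a + 1 \<le> 2 * ?a * ?a" by (simp add: power2_eq_square[symmetric] mult_ac)
  then have "1 / ?a \<le> 2 * ?a - 2 * ?b" by (subst pos_divide_le_eq[OF a], subst left_diff_distrib) linarith
  then have "K * (1 / ?a) \<le> K * (2 * ?a - 2 * ?b)" using assms by (rule mult_left_mono)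
  then have "K / ?a \<le> 2 * K * ?a - 2 * K * ?b" by (simp add: algebra_simps)
  moreover have "(\<Sum>m<Suc (Suc n). if m = 0 then 1 else K / sqrt (real m)) =
    (\<Sum>m<Suc n. if m = 0 then 1 else K / sqrt (real m)) + K / ?a" by simp
  ultimately show ?case using Suc by linarith
qed simp

context centred_law
begin

lemma gauss_local_nonneg: "\<Delta> \<ge> 0 \<Longrightarrow> 0 \<le> gauss_local m u \<Delta>"
  using \<sigma>_pos by (simp add: gauss_local_def)

lemma gauss_local_ratio:
  "gauss_local m u \<Delta> = gauss_local m v \<Delta> * exp ((v\<^sup>2 - u\<^sup>2) / (2 * \<sigma>\<^sup>2 * real m))"
proof -
  have "- u\<^sup>2 / (2 * \<sigma>\<^sup>2 * real m) = - v\<^sup>2 / (2 * \<sigma>\<^sup>2 * real m) + (v\<^sup>2 - u\<^sup>2) / (2 * \<sigma>\<^sup>2 * real m)"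
    by (simp add: diff_divide_distrib)
  then show ?thesis unfolding gauss_local_def by (simp only: exp_add mult.assoc)
qed

lemma gauss_local_psi:
  assumes "n > 0"
  shows "\<Delta> / (\<sigma> * sqrt (real n)) * psi (y / (\<sigma> * sqrt (real n))) (x / (\<sigma> * sqrt (real n))) =
    gauss_local n (y - x) \<Delta> - gauss_local n (y + x) \<Delta>"
proof -
  have sq: "(a / (\<sigma> * sqrt (real n)))\<^sup>2 = a\<^sup>2 / (\<sigma>\<^sup>2 * real n)" for a
    by (simp add: power_divide power_mult_distrib)
  have "\<Delta> / (\<sigma> * sqrt (2 * pi * real n)) = \<Delta> / (\<sigma> * sqrt (real n)) * (1 / sqrt (2 * pi))"
    by (simp add: real_sqrt_mult)
  then have "gauss_local n u \<Delta> = \<Delta> / (\<sigma> * sqrt (real n)) * (1 / sqrt (2 * pi) * exp (- (u / (\<sigma> * sqrt (real n)))\<^sup>2 / 2))" for u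
    unfolding gauss_local_def sq by (simp add: mult_ac)
  then show ?thesis
    unfolding psi_def add_divide_distrib[symmetric] diff_divide_distrib[symmetric] by (simp add: algebra_simps)
qed

text \<open>In the range of moderate deviations the Gaussian local probability decays only polynomially.\<close>

lemma gauss_local_lower:
  assumes n: "n > 0" and u: "u\<^sup>2 \<le> \<sigma>\<^sup>2 * (q * real n * ln (real n)) + \<eta>\<^sup>2 * real n" and \<Delta>: "\<Delta> \<ge> 0"
  shows "\<Delta> * (exp (- \<eta>\<^sup>2 / (2 * \<sigma>\<^sup>2)) / (\<sigma> * sqrt (2 * pi))) * real n powr (- 1 / 2 - q / 2) \<le> gauss_local n u \<Delta>"
proof -
  have n0: "real n > 0" using n by simp
  have "u\<^sup>2 / (2 * \<sigma>\<^sup>2 * real n) \<le> (\<sigma>\<^sup>2 * (q * real n * ln (real n)) + \<eta>\<^sup>2 * real n) / (2 * \<sigma>\<^sup>2 * real n)"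
    using u n0 \<sigma>_pos by (intro divide_right_mono) auto
  also have "\<dots> = q / 2 * ln (real n) + \<eta>\<^sup>2 / (2 * \<sigma>\<^sup>2)"
    using n0 \<sigma>_pos by (simp add: add_divide_distrib)
  finally have "- \<eta>\<^sup>2 / (2 * \<sigma>\<^sup>2) + (- (q / 2)) * ln (real n) \<le> - u\<^sup>2 / (2 * \<sigma>\<^sup>2 * real n)" by simp
  then have "exp (- \<eta>\<^sup>2 / (2 * \<sigma>\<^sup>2)) * real n powr (- (q / 2)) \<le> exp (- u\<^sup>2 / (2 * \<sigma>\<^sup>2 * real n))"
    using n0 by (simp add: powr_def exp_add[symmetric])
  then have main: "\<Delta> / (\<sigma> * sqrt (2 * pi * real n)) * (exp (- \<eta>\<^sup>2 / (2 * \<sigma>\<^sup>2)) * real n powr (- (q / 2))) \<le> gauss_local n u \<Delta>"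
    unfolding gauss_local_def using \<Delta> \<sigma>_pos by (intro mult_left_mono) auto
  have pw: "real n powr (- 1 / 2 - q / 2) = real n powr (- (q / 2)) / sqrt (real n)"
  proof -
    have "real n powr (- 1 / 2 - q / 2) = real n powr (- (q / 2) - 1 / 2)" by (rule arg_cong[where f = "\<lambda>p. real n powr p"]) simp
    then show ?thesis using n0 by (simp only: powr_diff powr_half_sqrt less_imp_le)
  qed
  have dv: "\<Delta> / (\<sigma> * sqrt (2 * pi * real n)) = \<Delta> / (\<sigma> * sqrt (2 * pi)) / sqrt (real n)"
    by (simp add: real_sqrt_mult)
  have "\<Delta> * (E / c) * (p / r) = \<Delta> / c / r * (E * p)" for E c p r :: real by simp
  with main show ?thesis unfolding pw dv by simp
qed

text \<open>The reflection argument for one starting point and one target interval, with errors kept explicit.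
  Below zero the truncated walk lands in \<open>[- b, 0)\<close>; from there the target and its mirror image have nearly
  the same local probability as long as at least \<open>\<Lambda>\<close> steps remain, and both are negligible otherwise.\<close>

lemma reflection_estimate:
  fixes n :: nat and x y \<Delta> e s :: real
  assumes e: "0 < e" "e \<le> 1 / 2" and s: "s \<ge> 0" and n: "n > 0"
    and x: "x \<ge> 0" and y: "y > 0" and \<Delta>: "\<Delta> \<ge> 0" and \<Lambda>: "\<Lambda> \<le> real n"
    and loc: "\<And>m u. \<Lambda> \<le> real m \<Longrightarrow> m \<le> n \<Longrightarrow> \<bar>u\<bar> \<le> x + y + \<Delta> + b \<Longrightarrow>
      \<bar>measure (cpow (trunc \<mu> b) m) {u..u + \<Delta>} - gauss_local m u \<Delta>\<bar> \<le> e * gauss_local m u \<Delta>"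
    and small: "\<And>m z. real m < \<Lambda> \<Longrightarrow> - b \<le> z \<Longrightarrow> z < 0 \<Longrightarrow>
      free (trunc \<mu> b) {y..y + \<Delta>} m z \<le> s \<and> free (trunc \<mu> b) {- y - \<Delta>..- y - \<Delta> + \<Delta>} m z \<le> s"
    and \<Lambda>0: "\<Lambda> > 0" and b: "b \<ge> 0"
    and R1: "(2 * b + \<Delta>) * (2 * y + \<Delta>) / (2 * \<sigma>\<^sup>2 * \<Lambda>) \<le> ln (1 + e)"
    and R2: "\<Delta> * (2 * y + 2 * x + \<Delta>) / (2 * \<sigma>\<^sup>2 * real n) \<le> e"
  shows "\<bar>kill (trunc \<mu> b) {y..y + \<Delta>} n x - (gauss_local n (y - x) \<Delta> - gauss_local n (y + x) \<Delta>)\<bar>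
     \<le> 19 * e * gauss_local n (y - x) \<Delta> + s"
proof -
  interpret T: step_law "trunc \<mu> b" by (rule step_law_trunc)
  let ?S = "{y..y + \<Delta>}" and ?S' = "{- y - \<Delta>..- y - \<Delta> + \<Delta>}"
  have H: "\<bar>free (trunc \<mu> b) ?S m z - free (trunc \<mu> b) ?S' m z\<bar> \<le> 8 * e * free (trunc \<mu> b) ?S' m z + s"
    if m: "m < n" and z: "- b \<le> z" "z < 0" for m z
  proof (cases "\<Lambda> \<le> real m")
    case True
    have m0: "real m > 0" using True \<Lambda>0 by linarith
    define p where "p = free (trunc \<mu> b) ?S m z"
    define p' where "p' = free (trunc \<mu> b) ?S' m z"
    define g where "g = gauss_local m (y - z) \<Delta>"
    define g' where "g' = gauss_local m (- y - \<Delta> - z) \<Delta>"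
    have g0: "g \<ge> 0" "g' \<ge> 0" using gauss_local_nonneg[OF \<Delta>] by (simp_all add: g_def g'_def)
    have p: "\<bar>p - g\<bar> \<le> e * g"
      unfolding p_def g_def T.free_Icc by (rule loc[OF True]) (use m z x y \<Delta> in auto)
    have p': "\<bar>p' - g'\<bar> \<le> e * g'"
      unfolding p'_def g'_def T.free_Icc by (rule loc[OF True]) (use m z x y \<Delta> in auto)
    define D where "D = ((- y - \<Delta> - z)\<^sup>2 - (y - z)\<^sup>2) / (2 * \<sigma>\<^sup>2 * real m)"
    have gD: "g = g' * exp D" unfolding g_def g'_def D_def by (rule gauss_local_ratio)
    have "(- y - \<Delta> - z)\<^sup>2 - (y - z)\<^sup>2 = (2 * z + \<Delta>) * (2 * y + \<Delta>)"
      by (simp add: power2_eq_square algebra_simps)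
    then have "\<bar>D\<bar> = \<bar>2 * z + \<Delta>\<bar> * (2 * y + \<Delta>) / (2 * \<sigma>\<^sup>2 * real m)"
      using y \<Delta> by (simp add: D_def abs_mult)
    also have "\<dots> \<le> (2 * b + \<Delta>) * (2 * y + \<Delta>) / (2 * \<sigma>\<^sup>2 * \<Lambda>)"
      using z True \<Lambda>0 y \<Delta> b \<sigma>_pos by (intro frac_le mult_right_mono mult_left_mono mult_nonneg_nonneg) auto
    finally have D: "\<bar>D\<bar> \<le> ln (1 + e)" using R1 by linarith
    have "exp D \<le> 1 + e" using D e by (subst ln_ge_iff[symmetric]) auto
    moreover have "1 - e \<le> exp D"
    proof -
      have "ln (1 + e) \<le> e" using e ln_add_one_self_le_self[of e] by simp
      then have "- e \<le> D" using D by linarith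
      then show ?thesis using exp_ge_add_one_self[of D] by linarith
    qed
    ultimately have "\<bar>exp D - 1\<bar> \<le> e" by linarith
    then have "g' * \<bar>exp D - 1\<bar> \<le> g' * e" using g0 by (intro mult_left_mono)
    moreover have "g' * \<bar>exp D - 1\<bar> = \<bar>g - g'\<bar>" 
    proof -
      have "g - g' = g' * (exp D - 1)" by (subst gD) (simp add: right_diff_distrib)
      then show ?thesis using g0 by (simp add: abs_mult)
    qed
    ultimately have gg: "\<bar>g - g'\<bar> \<le> e * g'" by (simp add: mult.commute)
    have eg: "e * g' \<le> 1 / 2 * g'" using e g0 by (intro mult_right_mono) auto
    have "g \<le> 2 * g'" using gg eg g0 by linarith
    then have "e * g \<le> e * (2 * g')" using e by (intro mult_left_mono) auto
    then have "\<bar>p - p'\<bar> \<le> 4 * (e * g')" using p p' gg by linarith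
    also have "e * g' \<le> e * (2 * p')"
      using e p' eg by (intro mult_left_mono) linarith+
    finally show ?thesis using s by (simp add: p_def p'_def)
  next
    case False
    then have "free (trunc \<mu> b) ?S m z \<le> s" "free (trunc \<mu> b) ?S' m z \<le> s"
      using small[of m z] z by auto
    moreover have "0 \<le> free (trunc \<mu> b) ?S m z" "0 \<le> free (trunc \<mu> b) ?S' m z" by (rule T.free_bounds)+
    moreover have "0 \<le> 8 * e * free (trunc \<mu> b) ?S' m z" using e T.free_bounds(1)[of ?S' m z] by simp
    ultimately show ?thesis by linarith
  qed
  define P where "P = free (trunc \<mu> b) ?S n x"
  define P' where "P' = free (trunc \<mu> b) ?S' n x"
  define k where "k = kill (trunc \<mu> b) ?S n x"
  define G where "G = gauss_local n (y - x) \<Delta>"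
  define G1 where "G1 = gauss_local n (y + x) \<Delta>"
  define G2 where "G2 = gauss_local n (- y - \<Delta> - x) \<Delta>"
  have G0: "G \<ge> 0" "G1 \<ge> 0" "G2 \<ge> 0" using gauss_local_nonneg[OF \<Delta>] by (simp_all add: G_def G1_def G2_def)
  have refl: "\<bar>P - k - P'\<bar> \<le> 8 * e * P' + s"
    unfolding P_def k_def P'_def
    by (rule T.discrete_reflection[where b = b and n = n])
      (use H x y e s AE_trunc \<Delta> in auto)
  have P: "\<bar>P - G\<bar> \<le> e * G"
    unfolding P_def G_def T.free_Icc by (rule loc[OF \<Lambda>]) (use x y \<Delta> b in auto)
  have P': "\<bar>P' - G2\<bar> \<le> e * G2"
    unfolding P'_def G2_def T.free_Icc by (rule loc[OF \<Lambda>]) (use x y \<Delta> b in auto)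
  have GG1: "G1 \<le> G"
  proof -
    have "((y + x)\<^sup>2 - (y - x)\<^sup>2) / (2 * \<sigma>\<^sup>2 * real n) \<ge> 0"
    proof -
      have "(y + x)\<^sup>2 - (y - x)\<^sup>2 = 4 * (y * x)" by (simp add: power2_eq_square algebra_simps)
      then show ?thesis using x y by simp
    qed
    then have "G1 * 1 \<le> G1 * exp (((y + x)\<^sup>2 - (y - x)\<^sup>2) / (2 * \<sigma>\<^sup>2 * real n))"
      using G0 by (intro mult_left_mono) auto
    also have "\<dots> = G" unfolding G_def G1_def by (rule gauss_local_ratio[symmetric])
    finally show ?thesis by simp
  qed
  have G12: "G2 \<le> G1" "G1 - G2 \<le> e * G1"
  proof -
    define D where "D = ((y + x)\<^sup>2 - (- y - \<Delta> - x)\<^sup>2) / (2 * \<sigma>\<^sup>2 * real n)"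
    have D: "G2 = G1 * exp D" unfolding G2_def G1_def D_def by (rule gauss_local_ratio)
    have "D = - (\<Delta> * (2 * y + 2 * x + \<Delta>) / (2 * \<sigma>\<^sup>2 * real n))"
      unfolding D_def minus_divide_left by (rule arg_cong[where f = "\<lambda>a. a / (2 * \<sigma>\<^sup>2 * real n)"])
        (simp add: power2_eq_square algebra_simps)
    moreover have "0 \<le> \<Delta> * (2 * y + 2 * x + \<Delta>) / (2 * \<sigma>\<^sup>2 * real n)" using \<Delta> x y by simp
    ultimately have D1: "- e \<le> D" "D \<le> 0" using R2 by linarith+
    have "G1 * exp D \<le> G1 * 1" using D1 G0 by (intro mult_left_mono) auto
    then show "G2 \<le> G1" by (simp add: D)
    have "1 - exp D \<le> e" using exp_ge_add_one_self[of D] D1 by linarith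
    then have "G1 * (1 - exp D) \<le> G1 * e" using G0 by (intro mult_left_mono)
    then show "G1 - G2 \<le> e * G1" by (simp add: D algebra_simps)
  qed
  have a: "e * G1 \<le> e * G" "e * G2 \<le> e * G" using e GG1 G12 by (auto intro!: mult_left_mono)
  have "P' \<le> 2 * G2" using P' e G0 mult_right_mono[of e "1 / 2" G2] by linarith
  then have "8 * e * P' \<le> 8 * e * (2 * G)" using e G12 GG1 by (intro mult_left_mono) auto
  then have "\<bar>k - (G - G1)\<bar> \<le> 19 * e * G + s" using refl P P' G12 a by linarith
  then show ?thesis by (simp add: k_def G_def G1_def)
qed

text \<open>The power \<open>n powr (1 / 2 - \<kappa>)\<close> is the truncation level. The restriction on q makes the cost of truncation,
  of order \<open>\<Delta> sqrt n\<close> times the tail of the step, and the Chernoff error negligible against the Gaussian local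
  probability, which is at least of order \<open>\<Delta> n powr (- 1 / 2 - q / 2)\<close>.\<close>

lemma kill_asymptotics:
  fixes \<delta> \<epsilon> \<eta> \<Delta>\<^sub>0 q e :: real
  assumes \<delta>: "\<delta> > 0" and mom: "integrable \<mu> (\<lambda>x. \<bar>x\<bar> powr (2 + \<delta>))"
    and pos: "\<epsilon> > 0" "\<eta> > 0" "\<Delta>\<^sub>0 > 0" and q: "0 < q" "q < \<delta> / 2" and e: "e > 0"
  shows "\<forall>\<^sub>F n in sequentially. \<forall>x y \<Delta>.
    x \<in> {inverse \<eta> * sqrt (real n)..\<eta> * sqrt (real n)} \<longrightarrow>
    y \<in> {inverse \<eta> * sqrt (real n)..\<sigma> * sqrt (q * real n * ln (real n))} \<longrightarrow>
    \<Delta> \<in> {\<Delta>\<^sub>0..real n powr (1 / 2 - \<epsilon>)} \<longrightarrow>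
    \<bar>kill \<mu> {y..y + \<Delta>} n x /
      (\<Delta> / (\<sigma> * sqrt (real n)) * psi (y / (\<sigma> * sqrt (real n))) (x / (\<sigma> * sqrt (real n)))) - 1\<bar> \<le> e"
proof -
  define \<kappa> where "\<kappa> = min (\<delta> / (8 * (2 + \<delta>))) \<epsilon>"
  have \<kappa>: "0 < \<kappa>" "\<kappa> \<le> \<epsilon>" using \<delta> pos by (auto simp: \<kappa>_def)
  have "\<kappa> \<le> \<delta> / (8 * (2 + \<delta>))" by (simp add: \<kappa>_def)
  then have \<kappa>3: "\<kappa> * (2 + \<delta>) \<le> \<delta> / 8" using \<delta> by (simp add: pos_le_divide_eq mult_ac)
  \<comment> \<open>the main term is at least the fraction \<open>k0\<close> of its positive Gaussian part, because \<open>x y \<ge> n / \<eta>\<^sup>2\<close>\<close>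
  define k0 where "k0 = 1 - exp (- (2 / (\<eta>\<^sup>2 * \<sigma>\<^sup>2)))"
  have k0: "k0 > 0" using pos \<sigma>_pos by (simp add: k0_def)
  define e1 where "e1 = min (1 / 2) (e * k0 / 21)"
  have e1: "0 < e1" using e k0 by (simp add: e1_def)
  have e1h: "e1 \<le> 1 / 2" unfolding e1_def by (rule min.cobounded1)
  have "e1 \<le> e * k0 / 21" unfolding e1_def by (rule min.cobounded2)
  then have e1k: "21 * e1 \<le> e * k0" by simp
  define C where "C = 2 + \<eta> + \<sigma> * sqrt q"
  have C: "C > 0" using pos \<sigma>_pos q by (simp add: C_def add_pos_nonneg)
  define c where "c = inverse \<eta> / 2"
  have c: "c > 0" using pos by (simp add: c_def)
  define b where "b n = real n powr (1 / 2 - \<kappa>)" for n :: nat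
  define M where "M = (LINT x|\<mu>. \<bar>x\<bar> powr (2 + \<delta>))"
  define t where "t n = M * b n powr (- (2 + \<delta>))" for n
  define s where "s n = exp (\<sigma>\<^sup>2 / 2 + 1 - c * real n powr (\<kappa> / 8))" for n :: nat
  define \<Lambda> where "\<Lambda> n = real n powr (1 - \<kappa> / 4)" for n :: nat
  define c2 where "c2 = exp (- \<eta>\<^sup>2 / (2 * \<sigma>\<^sup>2)) / (\<sigma> * sqrt (2 * pi))"
  have c2: "c2 > 0" using \<sigma>_pos by (simp add: c2_def)
  obtain K where K: "K > 0"
    "\<And>m u \<Delta>. m > 0 \<Longrightarrow> \<Delta> \<ge> 0 \<Longrightarrow> sqrt (real m) * measure (cpow \<mu> m) {u..u + \<Delta>} \<le> K * (1 + \<Delta>)"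
    using concentration by blast
  define W where "W = 1 / \<Delta>\<^sub>0 + 2 * K * (1 / \<Delta>\<^sub>0 + 1)"
  have W: "W > 0" using pos K by (simp add: W_def add_pos_pos)
  note loc = trunc_local_limit[OF \<delta> mom \<kappa> \<kappa>3 C pos(3) e1]
  note chern = trunc_chernoff[OF \<delta> mom \<kappa>(1) \<kappa>3 c]
  have l1: "(\<lambda>n. b n / sqrt (real n)) \<longlonglongrightarrow> 0"
    unfolding b_def using \<kappa>(1) by real_asymp
  have x2: "\<kappa> / 4 - \<epsilon> < 0" using \<kappa> by simp
  have l2a: "(\<lambda>n. (2 * b n) * (2 * (\<sigma> * sqrt (q * real n * ln (real n))) + real n powr (1 / 2 - \<epsilon>)) / (2 * \<sigma>\<^sup>2 * \<Lambda> n)) \<longlonglongrightarrow> 0"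
    unfolding b_def \<Lambda>_def using \<kappa> x2 \<sigma>_pos q by real_asymp
  have l2b: "(\<lambda>n. real n powr (1 / 2 - \<epsilon>) * (2 * (\<sigma> * sqrt (q * real n * ln (real n))) + real n powr (1 / 2 - \<epsilon>)) / (2 * \<sigma>\<^sup>2 * \<Lambda> n)) \<longlonglongrightarrow> 0"
    unfolding \<Lambda>_def using \<kappa> x2 pos \<sigma>_pos q by real_asymp
  have l2: "(\<lambda>n. (2 * b n + real n powr (1 / 2 - \<epsilon>)) * (2 * (\<sigma> * sqrt (q * real n * ln (real n))) + real n powr (1 / 2 - \<epsilon>)) / (2 * \<sigma>\<^sup>2 * \<Lambda> n)) \<longlonglongrightarrow> 0"
    using tendsto_add[OF l2a l2b] by (simp add: distrib_right add_divide_distrib)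
  have l3: "(\<lambda>n. real n powr (1 / 2 - \<epsilon>) * (2 * (\<sigma> * sqrt (q * real n * ln (real n))) + 2 * (\<eta> * sqrt (real n)) + real n powr (1 / 2 - \<epsilon>)) / (2 * \<sigma>\<^sup>2 * real n)) \<longlonglongrightarrow> 0"
    using pos \<sigma>_pos q by real_asymp
  have x4: "(1 / 2 - \<kappa>) * (- (2 + \<delta>)) + 1 / 2 + (1 / 2 + q / 2) < 0" using \<kappa>3 \<delta> q by (simp add: algebra_simps)
  have l4: "(\<lambda>n. t n * sqrt (real n) * real n powr (1 / 2 + q / 2)) \<longlonglongrightarrow> 0"
    unfolding t_def b_def using x4 by real_asymp
  have l5: "(\<lambda>n. s n * real n powr (1 / 2 + q / 2)) \<longlonglongrightarrow> 0"
    unfolding s_def using \<kappa>(1) c by real_asymp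
  have ln1: "ln (1 + e1) > 0" using e1 by simp
  have th4: "e1 * c2 / W > 0" and th5: "e1 * c2 * \<Delta>\<^sub>0 > 0" using e1 c2 W pos by simp_all
  show ?thesis
    using loc chern order_tendstoD(2)[OF l1 c] order_tendstoD(2)[OF l2 ln1] order_tendstoD(2)[OF l3 e1]
      order_tendstoD(2)[OF l4 th4] order_tendstoD(2)[OF l5 th5] eventually_ge_at_top[of 3]
  proof eventually_elim
    case (elim n)
    note loc = elim(1) and chern = elim(2) and b_small = elim(3) and R1 = elim(4) and R2 = elim(5)
      and t_small = elim(6) and s_small = elim(7) and n3 = elim(8)
    show ?case
    proof (intro allI impI)
      fix x y \<Delta>
      assume x: "x \<in> {inverse \<eta> * sqrt (real n)..\<eta> * sqrt (real n)}"
        and y: "y \<in> {inverse \<eta> * sqrt (real n)..\<sigma> * sqrt (q * real n * ln (real n))}"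
        and \<Delta>: "\<Delta> \<in> {\<Delta>\<^sub>0..real n powr (1 / 2 - \<epsilon>)}"
      have n0: "n > 0" and n1: "real n \<ge> 1" and r0: "sqrt (real n) > 0" using n3 by auto
      have "exp 1 \<le> real n" using exp_le n3 by linarith
      then have lnn: "ln (real n) \<ge> 1" using n0 by (simp add: ln_ge_iff)
      have i0: "inverse \<eta> * sqrt (real n) > 0" using pos r0 by simp
      have xp: "x > 0" and yp: "y > 0" and \<Delta>p: "\<Delta> > 0" using x y \<Delta> i0 pos by auto
      have b0: "b n > 0" and \<Lambda>0: "\<Lambda> n > 0" using n0 by (simp_all add: b_def \<Lambda>_def)
      have \<Lambda>n: "\<Lambda> n \<le> real n" unfolding \<Lambda>_def using powr_mono[of "1 - \<kappa> / 4" 1 "real n"] n1 \<kappa>(1) by simp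
      have bs: "b n \<le> c * sqrt (real n)" using b_small r0 by (simp add: divide_less_eq)
      have \<Delta>s: "\<Delta> \<le> sqrt (real n)"
        using \<Delta> powr_mono[of "1 / 2 - \<epsilon>" "1 / 2" "real n"] n1 pos by (simp add: powr_half_sqrt)
      have bsq: "b n \<le> sqrt (real n)"
        using powr_mono[of "1 / 2 - \<kappa>" "1 / 2" "real n"] n1 \<kappa>(1) by (simp add: powr_half_sqrt b_def)
      have sqq: "sqrt (q * real n * ln (real n)) = sqrt q * sqrt (real n * ln (real n))"
        by (simp add: real_sqrt_mult)
      have range: "x + y + \<Delta> + b n \<le> C * sqrt (real n * ln (real n))"
      proof -
        have "real n * 1 \<le> real n * ln (real n)" using lnn by (intro mult_left_mono) auto
        then have "sqrt (real n) \<le> sqrt (real n * ln (real n))" by simp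
        then have "(2 + \<eta>) * sqrt (real n) \<le> (2 + \<eta>) * sqrt (real n * ln (real n))" using pos by (intro mult_left_mono) auto
        moreover have "x + y + \<Delta> + b n \<le> (2 + \<eta>) * sqrt (real n) + \<sigma> * sqrt q * sqrt (real n * ln (real n))"
          using x y \<Delta>s bsq unfolding sqq by (simp add: algebra_simps)
        ultimately show ?thesis by (simp add: C_def algebra_simps)
      qed
      let ?S = "{y..y + \<Delta>}" and ?S' = "{- y - \<Delta>..- y - \<Delta> + \<Delta>}"
      define g where "g = gauss_local n (y - x) \<Delta>"
      define g1 where "g1 = gauss_local n (y + x) \<Delta>"
      interpret T: step_law "trunc \<mu> (b n)" by (rule step_law_trunc)
      have k: "\<bar>kill (trunc \<mu> (b n)) ?S n x - (g - g1)\<bar> \<le> 19 * e1 * g + s n"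
        unfolding g_def g1_def
      proof (rule reflection_estimate[OF e1 e1h _ n0 _ yp _ \<Lambda>n])
        show "\<bar>measure (cpow (trunc \<mu> (b n)) m) {u..u + \<Delta>} - gauss_local m u \<Delta>\<bar> \<le> e1 * gauss_local m u \<Delta>"
          if "\<Lambda> n \<le> real m" "m \<le> n" "\<bar>u\<bar> \<le> x + y + \<Delta> + b n" for m u
        proof -
          have "\<bar>u\<bar> \<le> C * sqrt (real n * ln (real n))" using that(3) range by linarith
          then show ?thesis
            using loc[unfolded b_def[symmetric] \<Lambda>_def[symmetric], rule_format, OF that(1,2)] \<Delta> by auto
        qed
        show "free (trunc \<mu> (b n)) ?S m z \<le> s n \<and> free (trunc \<mu> (b n)) ?S' m z \<le> s n"
          if m: "real m < \<Lambda> n" and z: "- b n \<le> z" "z < 0" for m z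
        proof -
          have i: "inverse \<eta> * sqrt (real n) = 2 * (c * sqrt (real n))" by (simp add: c_def)
          have pos_side: "\<forall>v\<in>{y - z..y - z + \<Delta>}. v \<ge> c * sqrt (real n)"
            using y z i bs b0 by auto
          have neg_side: "\<forall>v\<in>{- y - \<Delta> - z..- y - \<Delta> - z + \<Delta>}. v \<le> - c * sqrt (real n)"
            using y z i bs b0 by auto
          have m': "real m \<le> real n powr (1 - \<kappa> / 4)" using m by (simp add: \<Lambda>_def)
          show ?thesis
            unfolding T.free_Icc s_def
            using chern[unfolded b_def[symmetric], rule_format, OF m', of "{y - z..y - z + \<Delta>}"] pos_side
              chern[unfolded b_def[symmetric], rule_format, OF m', of "{- y - \<Delta> - z..- y - \<Delta> - z + \<Delta>}"] neg_side
            by simp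
        qed
        show "(2 * b n + \<Delta>) * (2 * y + \<Delta>) / (2 * \<sigma>\<^sup>2 * \<Lambda> n) \<le> ln (1 + e1)"
        proof (rule order_trans[OF _ less_imp_le[OF R1]])
          show "(2 * b n + \<Delta>) * (2 * y + \<Delta>) / (2 * \<sigma>\<^sup>2 * \<Lambda> n) \<le>
            (2 * b n + real n powr (1 / 2 - \<epsilon>)) * (2 * (\<sigma> * sqrt (q * real n * ln (real n))) + real n powr (1 / 2 - \<epsilon>)) / (2 * \<sigma>\<^sup>2 * \<Lambda> n)"
            using \<Delta> y yp \<Delta>p b0 \<Lambda>0 by (intro divide_right_mono mult_mono) auto
        qed
        show "\<Delta> * (2 * y + 2 * x + \<Delta>) / (2 * \<sigma>\<^sup>2 * real n) \<le> e1"
        proof (rule order_trans[OF _ less_imp_le[OF R2]])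
          show "\<Delta> * (2 * y + 2 * x + \<Delta>) / (2 * \<sigma>\<^sup>2 * real n) \<le>
            real n powr (1 / 2 - \<epsilon>) * (2 * (\<sigma> * sqrt (q * real n * ln (real n))) + 2 * (\<eta> * sqrt (real n)) + real n powr (1 / 2 - \<epsilon>)) / (2 * \<sigma>\<^sup>2 * real n)"
            using \<Delta> y x yp xp \<Delta>p by (intro divide_right_mono mult_mono) auto
        qed
      qed (use xp \<Delta>p \<Lambda>0 b0 in \<open>auto simp: s_def\<close>)
      have tail: "measure \<mu> (- {- b n..b n}) \<le> t n"
        using tail_bound_moment[OF \<delta> mom b0] unfolding tail_bound_def t_def M_def by (auto dest!: spec[of _ 0])
      have t0: "t n \<ge> 0" unfolding t_def M_def by (simp add: integral_nonneg_AE)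
      \<comment> \<open>with no step left there is no decay, hence the separate value 1 at 0\<close>
      define Gm where "Gm m = (if m = 0 then 1 else K * (1 + \<Delta>) / sqrt (real m))" for m :: nat
      have "free \<mu> ?S m v \<le> Gm m" for m v
      proof (cases "m = 0")
        case True
        then show ?thesis using free_bounds(2)[of ?S m v] by (simp add: Gm_def)
      next
        case False
        then show ?thesis
          using K(2)[of m \<Delta> "y - v"] \<Delta>p unfolding free_Icc by (simp add: Gm_def pos_le_divide_eq mult.commute)
      qed
      from kill_trunc_diff[where S = ?S and n = n and G = Gm and m = n and x = x and b = "b n", OF _ this]
      have tr: "0 \<le> kill \<mu> ?S n x - kill (trunc \<mu> (b n)) ?S n x"
        "kill \<mu> ?S n x - kill (trunc \<mu> (b n)) ?S n x \<le> measure \<mu> (- {- b n..b n}) * (\<Sum>k<n. Gm k)" by auto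
      have Gm0: "0 \<le> Gm m" for m using K \<Delta>p by (simp add: Gm_def)
      have "(\<Sum>k<n. Gm k) \<le> (\<Sum>k<Suc n. Gm k)" using Gm0[of n] by simp
      also have "\<dots> \<le> 1 + 2 * (K * (1 + \<Delta>)) * sqrt (real n)"
        unfolding Gm_def by (rule sum_inverse_sqrt_le) (use K \<Delta>p in simp)
      also have "\<dots> \<le> W * \<Delta> * sqrt (real n)"
      proof -
        have d: "1 \<le> \<Delta> / \<Delta>\<^sub>0" using \<Delta> pos by simp
        have "1 * 1 \<le> \<Delta> / \<Delta>\<^sub>0 * sqrt (real n)" using d n1 by (intro mult_mono) auto
        moreover have "2 * (K * (1 + \<Delta>)) * sqrt (real n) \<le> 2 * (K * (\<Delta> / \<Delta>\<^sub>0 + \<Delta>)) * sqrt (real n)"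
          using d K by (intro mult_right_mono mult_left_mono add_right_mono) auto
        ultimately show ?thesis by (simp add: W_def algebra_simps)
      qed
      finally have "measure \<mu> (- {- b n..b n}) * (\<Sum>k<n. Gm k) \<le> t n * (W * \<Delta> * sqrt (real n))"
        using tail t0 Gm0 by (intro mult_mono sum_nonneg) auto
      with tr(2) have tr2: "kill \<mu> ?S n x - kill (trunc \<mu> (b n)) ?S n x \<le> \<Delta> * (t n * sqrt (real n) * W)" by (simp add: mult_ac)
      define pw where "pw = real n powr (- 1 / 2 - q / 2)"
      have pw: "real n powr (1 / 2 + q / 2) * pw = 1" "pw > 0" using n0 by (simp_all add: pw_def powr_add[symmetric])
      have glow: "\<Delta> * c2 * pw \<le> g"
        unfolding g_def c2_def pw_def
      proof (rule gauss_local_lower[OF n0 _ less_imp_le[OF \<Delta>p]])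
        have "y\<^sup>2 \<le> (\<sigma> * sqrt (q * real n * ln (real n)))\<^sup>2" using y yp by (intro power_mono) auto
        also have "\<dots> = \<sigma>\<^sup>2 * (q * real n * ln (real n))" using q lnn by (simp add: power_mult_distrib)
        finally have y2: "y\<^sup>2 \<le> \<sigma>\<^sup>2 * (q * real n * ln (real n))" .
        have "x\<^sup>2 \<le> (\<eta> * sqrt (real n))\<^sup>2" using x xp by (intro power_mono) auto
        then have x2: "x\<^sup>2 \<le> \<eta>\<^sup>2 * real n" by (simp add: power_mult_distrib)
        have "(y - x)\<^sup>2 \<le> y\<^sup>2 + x\<^sup>2" using xp yp by (simp add: power2_diff)
        then show "(y - x)\<^sup>2 \<le> \<sigma>\<^sup>2 * (q * real n * ln (real n)) + \<eta>\<^sup>2 * real n" using x2 y2 by linarith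
      qed
      have t_le: "\<Delta> * (t n * sqrt (real n) * W) \<le> e1 * g"
      proof -
        have "t n * sqrt (real n) * real n powr (1 / 2 + q / 2) * W \<le> e1 * c2"
          using t_small W by (simp add: pos_less_divide_eq)
        then have "t n * sqrt (real n) * real n powr (1 / 2 + q / 2) * W * (\<Delta> * pw) \<le> e1 * c2 * (\<Delta> * pw)"
          using pw \<Delta>p by (intro mult_right_mono) auto
        moreover have "t n * sqrt (real n) * real n powr (1 / 2 + q / 2) * W * (\<Delta> * pw) =
          \<Delta> * (t n * sqrt (real n) * W) * (real n powr (1 / 2 + q / 2) * pw)" by (simp only: mult_ac)
        moreover have "e1 * c2 * (\<Delta> * pw) = e1 * (\<Delta> * c2 * pw)" by simp
        moreover have "e1 * (\<Delta> * c2 * pw) \<le> e1 * g" using glow e1 by (intro mult_left_mono) auto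
        ultimately show ?thesis unfolding pw(1) by linarith
      qed
      have s_le: "s n \<le> e1 * g"
      proof -
        have "s n * real n powr (1 / 2 + q / 2) * pw \<le> e1 * c2 * \<Delta>\<^sub>0 * pw"
          using s_small pw by (intro mult_right_mono) auto
        then have "s n \<le> e1 * c2 * \<Delta>\<^sub>0 * pw" by (simp only: mult.assoc pw(1) mult_1_right)
        also have "\<dots> \<le> e1 * c2 * \<Delta> * pw" using e1 c2 \<Delta> pw by (intro mult_right_mono mult_left_mono) auto
        also have "\<dots> = e1 * (\<Delta> * c2 * pw)" by simp
        also have "\<dots> \<le> e1 * g" using glow e1 by (intro mult_left_mono) auto
        finally show ?thesis .
      qed
      have gp: "g > 0"
        using glow \<Delta>p c2 pw(2) mult_pos_pos[OF mult_pos_pos[OF \<Delta>p c2] pw(2)] by linarith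
      have num: "\<bar>kill \<mu> ?S n x - (g - g1)\<bar> \<le> 21 * e1 * g" using k tr(1) tr2 t_le s_le by linarith
      have den: "k0 * g \<le> g - g1"
      proof -
        have "g1 = g * exp (((y - x)\<^sup>2 - (y + x)\<^sup>2) / (2 * \<sigma>\<^sup>2 * real n))"
          unfolding g_def g1_def by (rule gauss_local_ratio)
        also have "((y - x)\<^sup>2 - (y + x)\<^sup>2) / (2 * \<sigma>\<^sup>2 * real n) = - (2 * (y * x) / (\<sigma>\<^sup>2 * real n))"
          by (simp add: power2_eq_square algebra_simps)
        finally have g1: "g1 = g * exp (- (2 * (y * x) / (\<sigma>\<^sup>2 * real n)))" .
        have "(inverse \<eta> * sqrt (real n)) * (inverse \<eta> * sqrt (real n)) \<le> y * x"
          using x y i0 yp by (intro mult_mono) auto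
        moreover have "(inverse \<eta> * sqrt (real n)) * (inverse \<eta> * sqrt (real n)) = real n / \<eta>\<^sup>2"
          by (simp add: power2_eq_square divide_inverse mult_ac)
        ultimately have "2 * (real n / \<eta>\<^sup>2) / (\<sigma>\<^sup>2 * real n) \<le> 2 * (y * x) / (\<sigma>\<^sup>2 * real n)"
          by (intro divide_right_mono) auto
        then have "2 / (\<eta>\<^sup>2 * \<sigma>\<^sup>2) \<le> 2 * (y * x) / (\<sigma>\<^sup>2 * real n)" using n0 by (simp add: mult_ac)
        then have "g * exp (- (2 * (y * x) / (\<sigma>\<^sup>2 * real n))) \<le> g * exp (- (2 / (\<eta>\<^sup>2 * \<sigma>\<^sup>2)))"
          using gp by (intro mult_left_mono) auto
        then show ?thesis unfolding g1 k0_def by (simp add: algebra_simps)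
      qed
      have dpos: "g - g1 > 0" using den mult_pos_pos[OF k0 gp] by linarith
      have "21 * e1 * g \<le> e * k0 * g" using e1k gp by (intro mult_right_mono) auto
      also have "\<dots> \<le> e * (g - g1)" using den e by (simp add: mult.assoc)
      finally have "\<bar>kill \<mu> ?S n x - (g - g1)\<bar> \<le> e * (g - g1)" using num by linarith
      moreover have "\<bar>kill \<mu> ?S n x / (g - g1) - 1\<bar> = \<bar>kill \<mu> ?S n x - (g - g1)\<bar> / (g - g1)"
      proof -
        have "a / d - 1 = (a - d) / d" if "d > 0" for a d :: real
          using that by (simp add: diff_divide_distrib)
        from this[OF dpos] show ?thesis using dpos by (simp only: abs_divide abs_of_pos)
      qed
      ultimately have "\<bar>kill \<mu> ?S n x / (g - g1) - 1\<bar> \<le> e" using dpos by (simp add: pos_divide_le_eq)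
      then show "\<bar>kill \<mu> ?S n x /
        (\<Delta> / (\<sigma> * sqrt (real n)) * psi (y / (\<sigma> * sqrt (real n))) (x / (\<sigma> * sqrt (real n)))) - 1\<bar> \<le> e"
        unfolding gauss_local_psi[OF n0] g_def g1_def .
    qed
  qed
qed

end

lemma unif_asymp_equivI:
  assumes "\<And>e. e > 0 \<Longrightarrow> \<forall>\<^sub>F n in sequentially. \<forall>\<theta>\<in>A n. \<bar>a n \<theta> / b n \<theta> - 1\<bar> \<le> e"
  shows "unif_asymp_equiv A a b"
  unfolding unif_asymp_equiv_def
proof (rule order_tendstoI)
  fix l :: ennreal assume "0 < l"
  then obtain z where z: "0 < z" "z < l" using dense by blast
  then obtain e where e: "z = ennreal e" "e \<ge> 0" by (cases z) auto
  then have "e > 0" using z by (cases "e = 0") auto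
  from assms[OF this] show "\<forall>\<^sub>F n in sequentially. (SUP \<theta>\<in>A n. ennreal \<bar>a n \<theta> / b n \<theta> - 1\<bar>) < l"
  proof eventually_elim
    case (elim n)
    have "(SUP \<theta>\<in>A n. ennreal \<bar>a n \<theta> / b n \<theta> - 1\<bar>) \<le> z"
      unfolding e by (rule SUP_least) (use elim in \<open>auto intro: ennreal_leI\<close>)
    then show ?case by (rule le_less_trans[OF _ z(2)])
  qed
qed simp

theorem theorem1p6:
  fixes M :: "'a measure" and X :: "nat \<Rightarrow> 'a \<Rightarrow> real" and \<sigma> \<delta> :: real
  assumes "prob_space M"
    and "prob_space.indep_vars M (\<lambda>_. borel) X {1..}"
    and "\<And>i. i \<ge> 1 \<Longrightarrow> distr M borel (X i) = distr M borel (X 1)"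
    and "integrable M (X 1)" and "integral\<^sup>L M (X 1) = 0"
    and "integrable M (\<lambda>\<omega>. (X 1 \<omega>)\<^sup>2)" and "(\<integral>\<omega>. (X 1 \<omega>)\<^sup>2 \<partial>M) = \<sigma>\<^sup>2" and "\<sigma> > 0"
    and "non_lattice M (X 1)"
    and "\<delta> > 0" and "integrable M (\<lambda>\<omega>. \<bar>X 1 \<omega>\<bar> powr (2 + \<delta>))"
  shows "\<forall>\<epsilon>>0. \<forall>\<eta>>0. \<forall>\<Delta>\<^sub>0>0. \<exists>q\<^sub>0>0. \<forall>q\<in>{0<..<q\<^sub>0}.
    unif_asymp_equiv
      (\<lambda>n. {inverse \<eta> * sqrt (real n) .. \<eta> * sqrt (real n)}
         \<times> {inverse \<eta> * sqrt (real n) .. \<sigma> * sqrt (q * real n * ln (real n))}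
         \<times> {\<Delta>\<^sub>0 .. real n powr (1 / 2 - \<epsilon>)})
      (\<lambda>n (x, y, \<Delta>). measure M {\<omega> \<in> space M. x + walk X n \<omega> \<in> {y .. y + \<Delta>}
                                             \<and> exit_time X x \<omega> > enat n})
      (\<lambda>n (x, y, \<Delta>). \<Delta> / (\<sigma> * sqrt (real n))
                       * psi (y / (\<sigma> * sqrt (real n))) (x / (\<sigma> * sqrt (real n))))"
  proof -
  interpret prob_space M by fact
  define \<mu> where "\<mu> = distr M borel (X 1)"
  have rv: "X i \<in> borel_measurable M" if "i \<ge> 1" for i
    using assms(2) that unfolding indep_vars_def2 by auto
  have rv1 [measurable]: "X 1 \<in> borel_measurable M" by (rule rv[OF order_refl])
  have dist: "distr M borel (X i) = \<mu>" if "i \<ge> 1" for i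
    unfolding \<mu>_def by (rule assms(3)[OF that])
  interpret L: centred_law \<mu> \<sigma>
  proof (rule centred_law.intro)
    show "real_distribution \<mu>" unfolding \<mu>_def by (rule real_distribution_distr[OF rv1])
    show "centred_law_axioms \<mu> \<sigma>"
    proof
      show "non_lattice \<mu> (\<lambda>x. x)"
        unfolding non_lattice_def
      proof (intro allI impI ballI)
        fix h a :: real assume h: "h > 0" "a \<in> {0..<h}"
        have [measurable]: "{h * of_int k + a | k. True} \<in> sets borel"
        proof (rule sets.countable)
          show "countable {h * of_int k + a | k. True}"
            using countable_image[of "UNIV :: int set" "\<lambda>k. h * of_int k + a"] by (simp add: full_SetCompr_eq)
        qed auto
        have "measure \<mu> {\<omega> \<in> space \<mu>. \<omega> \<in> {h * of_int k + a | k. True}} =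
          measure M {\<omega> \<in> space M. X 1 \<omega> \<in> {h * of_int k + a | k. True}}"
          unfolding \<mu>_def by (subst measure_distr[OF rv1]) (auto intro!: arg_cong[where f = prob])
        then show "measure \<mu> {\<omega> \<in> space \<mu>. \<omega> \<in> {h * of_int k + a | k. True}} \<noteq> 1"
          using assms(9) h unfolding non_lattice_def by simp
      qed
    next
      show "integrable \<mu> (\<lambda>x. x)"
        unfolding \<mu>_def using assms(4) by (subst integrable_distr_eq[OF rv1]) auto
      show "(LINT x|\<mu>. x) = 0"
        unfolding \<mu>_def using assms(5) by (subst integral_distr[OF rv1]) auto
      show "integrable \<mu> (\<lambda>x. x\<^sup>2)"
        unfolding \<mu>_def using assms(6) by (subst integrable_distr_eq[OF rv1]) auto
      show "(LINT x|\<mu>. x\<^sup>2) = \<sigma>\<^sup>2"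
        unfolding \<mu>_def using assms(7) by (subst integral_distr[OF rv1]) auto
      show "\<sigma> > 0" by (rule assms(8))
    qed
  qed
  have mom: "integrable \<mu> (\<lambda>x. \<bar>x\<bar> powr (2 + \<delta>))"
    unfolding \<mu>_def using assms(11) by (subst integrable_distr_eq[OF rv1]) auto
  have prob_kill: "prob {\<omega> \<in> space M. x + walk X n \<omega> \<in> {y..y + \<Delta>} \<and> exit_time X x \<omega> > enat n} = kill \<mu> {y..y + \<Delta>} n x"
    for n x y \<Delta> by (rule measure_eq_kill[OF assms(2) dist]) auto
  show ?thesis
  proof (intro allI impI exI[of _ "\<delta> / 2"] conjI ballI)
    fix \<epsilon> \<eta> \<Delta>\<^sub>0 q :: real
    assume pos: "\<epsilon> > 0" "\<eta> > 0" "\<Delta>\<^sub>0 > 0" and q: "q \<in> {0<..<\<delta> / 2}"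
    show "unif_asymp_equiv
      (\<lambda>n. {inverse \<eta> * sqrt (real n) .. \<eta> * sqrt (real n)}
         \<times> {inverse \<eta> * sqrt (real n) .. \<sigma> * sqrt (q * real n * ln (real n))}
         \<times> {\<Delta>\<^sub>0 .. real n powr (1 / 2 - \<epsilon>)})
      (\<lambda>n (x, y, \<Delta>). measure M {\<omega> \<in> space M. x + walk X n \<omega> \<in> {y .. y + \<Delta>}
                                             \<and> exit_time X x \<omega> > enat n})
      (\<lambda>n (x, y, \<Delta>). \<Delta> / (\<sigma> * sqrt (real n))
                       * psi (y / (\<sigma> * sqrt (real n))) (x / (\<sigma> * sqrt (real n))))"
    proof (rule unif_asymp_equivI)
      fix e :: real assume e: "e > 0"
      have q': "0 < q" "q < \<delta> / 2" using q by auto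
      show "\<forall>\<^sub>F n in sequentially. \<forall>\<theta>\<in>{inverse \<eta> * sqrt (real n) .. \<eta> * sqrt (real n)}
         \<times> {inverse \<eta> * sqrt (real n) .. \<sigma> * sqrt (q * real n * ln (real n))}
         \<times> {\<Delta>\<^sub>0 .. real n powr (1 / 2 - \<epsilon>)}.
        \<bar>(case \<theta> of (x, y, \<Delta>) \<Rightarrow> measure M {\<omega> \<in> space M. x + walk X n \<omega> \<in> {y .. y + \<Delta>} \<and> exit_time X x \<omega> > enat n}) /
         (case \<theta> of (x, y, \<Delta>) \<Rightarrow> \<Delta> / (\<sigma> * sqrt (real n)) * psi (y / (\<sigma> * sqrt (real n))) (x / (\<sigma> * sqrt (real n)))) - 1\<bar> \<le> e"
        using L.kill_asymptotics[OF assms(10) mom pos q' e]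
      proof eventually_elim
        case (elim n)
        show ?case
          unfolding prob_kill
        proof
          fix \<theta> assume \<theta>: "\<theta> \<in> {inverse \<eta> * sqrt (real n) .. \<eta> * sqrt (real n)}
            \<times> {inverse \<eta> * sqrt (real n) .. \<sigma> * sqrt (q * real n * ln (real n))}
            \<times> {\<Delta>\<^sub>0 .. real n powr (1 / 2 - \<epsilon>)}"
          obtain x y \<Delta> where xyz: "\<theta> = (x, y, \<Delta>)" by (cases \<theta>)
          show "\<bar>(case \<theta> of (x, y, \<Delta>) \<Rightarrow> kill \<mu> {y..y + \<Delta>} n x) /
            (case \<theta> of (x, y, \<Delta>) \<Rightarrow> \<Delta> / (\<sigma> * sqrt (real n)) * psi (y / (\<sigma> * sqrt (real n))) (x / (\<sigma> * sqrt (real n)))) - 1\<bar> \<le> e"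
            using elim \<theta> unfolding xyz prod.case mem_Times_iff by simp
        qed
      qed
    qed
  qed (use assms(10) in simp)
qed

end
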